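(* There is an absolute constant $C$ such that the following holds. Let $\mathcal G=(V,E)$ be a finite simple graph with $V=\{1,\dots,N\}$, at least one edge, and chromatic index $\chi$; fix a proper edge coloring of $\mathcal G$ with $\chi$ colors, with color classes $E_1,\dots,E_\chi$, and put $\nu=\lceil \chi/2\rceil$. Let $t_{ij}\in\mathbb R$ for $(i,j)\in E$, let $$H=\sum_{(i,j)\in E}t_{ij}(a_i^\dagger a_j+a_j^\dagger a_i)=\sum_{\alpha=1}^{\chi}h_\alpha,\qquad h_\alpha=\sum_{(i,j)\in E_\alpha}t_{ij}(a_i^\dagger a_j+a_j^\dagger a_i),$$ and let $\tau\in\mathbb R$ and let $M\ge 1$ be an integer. Then there is an adaptive quantum circuit on qubits with all-to-all connectivity which acts on a Jordan--Wigner encoding of the $N$ physical fermionic modes together with $(2\nu+1)N$ ancillary qubits ($\nu N$ of which carry $\nu$ auxiliary fermionic modes per site), and which, for every state $|\Psi_{\mathrm{phys}}\rangle$ of the physical modes, maps the encoding of $|\Psi_{\mathrm{phys}}\rangle$ with the auxiliary modes in the vacuum to the encoding of $$|\Psi_{\mathrm{aux}}\rangle\Big(\prod_{\alpha=1}^{\chi}e^{-i\tau h_\alpha}\Big)^{M}|\Psi_{\mathrm{phys}}\rangle$$ (up to a global phase), where $|\Psi_{\mathrm{aux}}\rangle$ is a state of the auxiliary modes not depending on $|\Psi_{\mathrm{phys}}\rangle$, $\tau$ or $M$ (it may depend on the measurement outcomes obtained while it is being prepared), and whose depth is at most $$C\big(\chi\log\chi+\chi\log N+M\chi\log\chi\big).$$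 In particular, if $M\ge\log N$, then the depth is $O(M\chi\log\chi)$, i.e. it exceeds $M\chi$ by at most a factor $O(\log\chi)$ that is independent of $N$.
   Context: Fermionic modes: $a_i$ ($1\le i\le N$) are the annihilation operators of the physical modes and $b_i^{(\ell)}$ ($1\le i\le N$, $1\le \ell\le\nu$) those of the auxiliary modes; all of these satisfy the canonical anticommutation relations jointly. The Jordan--Wigner (JW) encoding associates one qubit to each mode, with mode ordering $(a_1,b_1^{(1)},\dots,b_1^{(\nu)},a_2,b_2^{(1)},\dots,b_2^{(\nu)},\dots,a_N,b_N^{(1)},\dots,b_N^{(\nu)})$. If $A$ (resp. $B$) is a polynomial in the auxiliary (resp. physical) creation operators, with $A|\mathrm{vac}\rangle=|\Psi_{\mathrm{aux}}\rangle$ and $B|\mathrm{vac}\rangle=|\Psi_{\mathrm{phys}}\rangle$, then $|\Psi_{\mathrm{aux}}\rangle|\Psi_{\mathrm{phys}}\rangle$ denotes $AB|\mathrm{vac}\rangle$. A proper edge coloring of $\mathcal G$ assigns colors to edges so that edges sharing a vertex have distinct colors; the chromatic index $\chi$ is the minimum number of colors in such a coloring. Circuits: a circuit consists of layers; in each layer one applies one- and two-qubit gates (on arbitrary pairs of qubits) and single-qubit measurements, acting on disjoint qubits; later gates may depend on earlier measurement outcomes (adaptive circuit), classical processing is free, and depth is the number of layers. In depth bounds, $\log x$ is read as $\max\{1,\log x\}$. *)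

theory Defs
  imports Complex_Main
begin

text \<open>
  A vector of the Hilbert space with orthonormal basis indexed by the subsets of a finite set
  \<open>Q\<close> is its amplitude function, which vanishes outside \<open>Pow Q\<close>.  For qubits, \<open>x \<subseteq> Q\<close> is the
  computational basis state in which exactly the qubits in \<open>x\<close> are 1; for fermionic modes, it is
  the set of occupied modes.
\<close>

type_synonym 'a ket = "'a set \<Rightarrow> complex"

definition scale :: "complex \<Rightarrow> 'a ket \<Rightarrow> 'a ket" where
  "scale c \<psi> = (\<lambda>x. c * \<psi> x)"

definition ket_norm :: "'a set \<Rightarrow> 'a ket \<Rightarrow> real" where
  "ket_norm Q \<psi> = sqrt (\<Sum>x\<in>Pow Q. (cmod (\<psi> x))\<^sup>2)"

definition state_on :: "'a set \<Rightarrow> 'a ket \<Rightarrow> bool" where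
  "state_on Q \<psi> \<longleftrightarrow> (\<forall>x. \<psi> x \<noteq> 0 \<longrightarrow> x \<subseteq> Q) \<and> ket_norm Q \<psi> = 1"

text \<open>Exponential of an operator by its power series, taken amplitude by amplitude (the operators
  it is applied to act on finite-dimensional spaces).\<close>

definition op_exp :: "('a ket \<Rightarrow> 'a ket) \<Rightarrow> 'a ket \<Rightarrow> 'a ket" where
  "op_exp A \<psi> = (\<lambda>x. \<Sum>n. ((A ^^ n) \<psi>) x / fact n)"


section \<open>Graphs and edge colorings\<close>

definition simple_graph :: "'v set \<Rightarrow> 'v set set \<Rightarrow> bool" where
  "simple_graph V E \<longleftrightarrow> finite V \<and> (\<forall>e\<in>E. e \<subseteq> V \<and> card e = 2)"

definition proper_edge_coloring :: "'v set set \<Rightarrow> nat \<Rightarrow> ('v set \<Rightarrow> nat) \<Rightarrow> bool" where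
  "proper_edge_coloring E k c \<longleftrightarrow>
     c ` E \<subseteq> {1..k} \<and> (\<forall>e\<in>E. \<forall>f\<in>E. e \<noteq> f \<and> e \<inter> f \<noteq> {} \<longrightarrow> c e \<noteq> c f)"

definition chromatic_index :: "'v set set \<Rightarrow> nat" where
  "chromatic_index E = (LEAST k. \<exists>c. proper_edge_coloring E k c)"

definition color_class :: "'v set set \<Rightarrow> ('v set \<Rightarrow> nat) \<Rightarrow> nat \<Rightarrow> 'v set set" where
  "color_class E c \<alpha> = {e \<in> E. c e = \<alpha>}"


section \<open>Fermionic modes and the Jordan--Wigner encoding\<close>

datatype mode = Phys nat | Aux nat nat

definition phys_modes :: "nat \<Rightarrow> mode set" where
  "phys_modes N = {Phys i | i. i \<in> {1..N}}"

definition aux_modes :: "nat \<Rightarrow> nat \<Rightarrow> mode set" where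
  "aux_modes N \<nu> = {Aux i l | i l. i \<in> {1..N} \<and> l \<in> {1..\<nu>}}"

definition mode_list :: "nat \<Rightarrow> nat \<Rightarrow> mode list" where
  "mode_list N \<nu> = concat (map (\<lambda>i. Phys i # map (Aux i) [1..<Suc \<nu>]) [1..<Suc N])"

text \<open>The (zero-based) position of a mode in this list; see \<open>map_mode_pos\<close> below.\<close>

fun mode_pos :: "nat \<Rightarrow> mode \<Rightarrow> nat" where
  "mode_pos \<nu> (Phys i) = (i - 1) * (\<nu> + 1)"
| "mode_pos \<nu> (Aux i l) = (i - 1) * (\<nu> + 1) + l"

text \<open>The basis vector of occupation set \<open>S\<close> is the product of the creation operators of \<open>S\<close>, in
  the mode ordering, applied to the vacuum; this fixes the signs.\<close>

definition fermi_sign :: "nat \<Rightarrow> mode \<Rightarrow> mode set \<Rightarrow> complex" where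
  "fermi_sign \<nu> m S = (- 1) ^ card {k \<in> S. mode_pos \<nu> k < mode_pos \<nu> m}"

definition annihilate :: "nat \<Rightarrow> mode \<Rightarrow> mode ket \<Rightarrow> mode ket" where
  "annihilate \<nu> m \<psi> = (\<lambda>S. if m \<in> S then 0 else fermi_sign \<nu> m S * \<psi> (insert m S))"

definition create :: "nat \<Rightarrow> mode \<Rightarrow> mode ket \<Rightarrow> mode ket" where
  "create \<nu> m \<psi> = (\<lambda>S. if m \<in> S then fermi_sign \<nu> m S * \<psi> (S - {m}) else 0)"

definition vac :: "mode ket" where
  "vac = (\<lambda>S. if S = {} then 1 else 0)"

text \<open>The polynomial \<open>A\<close> in the creation operators with \<open>A vac = \<Psi>\<close>; see \<open>creation_poly_vac\<close>.\<close>

definition creation_poly :: "nat \<Rightarrow> nat \<Rightarrow> mode ket \<Rightarrow> mode ket \<Rightarrow> mode ket" where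
  "creation_poly N \<nu> \<Psi> \<phi> =
     (\<lambda>T. \<Sum>S\<in>Pow (set (mode_list N \<nu>)).
        \<Psi> S * foldr (create \<nu>) (filter (\<lambda>m. m \<in> S) (mode_list N \<nu>)) \<phi> T)"

definition aux_phys_product :: "nat \<Rightarrow> nat \<Rightarrow> mode ket \<Rightarrow> mode ket \<Rightarrow> mode ket" where
  "aux_phys_product N \<nu> \<Psi>\<^sub>a \<Psi>\<^sub>p = creation_poly N \<nu> \<Psi>\<^sub>a (creation_poly N \<nu> \<Psi>\<^sub>p vac)"

text \<open>The mode at position \<open>p\<close> is carried by qubit \<open>p\<close>.  Amplitudes are 0 on basis states in which
  some other qubit is 1, i.e. all qubits that carry no mode are in the state 0.\<close>

definition jw_encode :: "nat \<Rightarrow> nat \<Rightarrow> mode ket \<Rightarrow> nat ket" where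
  "jw_encode N \<nu> \<psi> = (\<lambda>x. if x \<subseteq> mode_pos \<nu> ` set (mode_list N \<nu>)
     then \<psi> {m \<in> set (mode_list N \<nu>). mode_pos \<nu> m \<in> x} else 0)"


section \<open>Hopping Hamiltonian and its Trotter product\<close>

text \<open>Each edge is summed once, as \<open>{i, j}\<close> with \<open>i < j\<close>.\<close>

definition hopping :: "nat \<Rightarrow> (nat \<Rightarrow> nat \<Rightarrow> real) \<Rightarrow> nat set set \<Rightarrow> mode ket \<Rightarrow> mode ket" where
  "hopping \<nu> t F \<psi> = (\<lambda>S. \<Sum>(i, j)\<in>{(i, j). i < j \<and> {i, j} \<in> F}.
     of_real (t i j) * (create \<nu> (Phys i) (annihilate \<nu> (Phys j) \<psi>) S
                      + create \<nu> (Phys j) (annihilate \<nu> (Phys i) \<psi>) S))"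

definition evolve :: "real \<Rightarrow> ('a ket \<Rightarrow> 'a ket) \<Rightarrow> 'a ket \<Rightarrow> 'a ket" where
  "evolve \<tau> h = op_exp (\<lambda>\<psi>. scale (- \<i> * of_real \<tau>) (h \<psi>))"

definition trotter ::
  "nat \<Rightarrow> (nat \<Rightarrow> nat \<Rightarrow> real) \<Rightarrow> nat set set \<Rightarrow> (nat set \<Rightarrow> nat) \<Rightarrow> nat \<Rightarrow> real \<Rightarrow> nat \<Rightarrow> mode ket \<Rightarrow> mode ket"
where
  "trotter \<nu> t E c \<chi> \<tau> M =
     (foldr (\<lambda>\<alpha>. evolve \<tau> (hopping \<nu> t (color_class E c \<alpha>))) [1..<Suc \<chi>]) ^^ M"


section \<open>Adaptive circuits\<close>

text \<open>\<open>Gate S U\<close> applies the matrix \<open>U\<close>, whose rows and columns are indexed by the subsets of \<open>S\<close>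
  (the basis states of the qubits in \<open>S\<close>); \<open>Measure q\<close> measures in the computational basis.\<close>

datatype instr = Gate "nat set" "nat set \<Rightarrow> nat set \<Rightarrow> complex" | Measure nat

fun instr_qubits :: "instr \<Rightarrow> nat set" where
  "instr_qubits (Gate S U) = S"
| "instr_qubits (Measure q) = {q}"

definition unitary_on :: "nat set \<Rightarrow> (nat set \<Rightarrow> nat set \<Rightarrow> complex) \<Rightarrow> bool" where
  "unitary_on S U \<longleftrightarrow> (\<forall>x\<in>Pow S. \<forall>y\<in>Pow S.
     (\<Sum>z\<in>Pow S. cnj (U z x) * U z y) = (if x = y then 1 else 0))"

fun valid_instr :: "instr \<Rightarrow> bool" where
  "valid_instr (Gate S U) \<longleftrightarrow> card S \<in> {1, 2} \<and> unitary_on S U"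
| "valid_instr (Measure q) \<longleftrightarrow> True"

type_synonym layer = "instr list"

definition valid_layer :: "nat set \<Rightarrow> layer \<Rightarrow> bool" where
  "valid_layer Q ls \<longleftrightarrow> (\<forall>g\<in>set ls. valid_instr g \<and> instr_qubits g \<subseteq> Q) \<and>
     sorted_wrt (\<lambda>g g'. instr_qubits g \<inter> instr_qubits g' = {}) ls"

definition measured :: "layer \<Rightarrow> nat set" where
  "measured ls = {q. Measure q \<in> set ls}"

text \<open>The outcome of a layer is the set of those measured qubits that gave 1.  A history lists the
  outcomes of the layers executed so far, most recent first; it determines the next layer.\<close>

type_synonym history = "nat set list"

datatype circuit = Circuit (depth: nat) (next_layer: "history \<Rightarrow> layer")

definition valid_circuit :: "nat set \<Rightarrow> circuit \<Rightarrow> bool" where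
  "valid_circuit Q c \<longleftrightarrow> (\<forall>h. length h < depth c \<longrightarrow> valid_layer Q (next_layer c h))"

fun possible_history :: "circuit \<Rightarrow> history \<Rightarrow> bool" where
  "possible_history c [] \<longleftrightarrow> True"
| "possible_history c (r # h) \<longleftrightarrow> possible_history c h \<and> r \<subseteq> measured (next_layer c h)"

fun apply_instr :: "nat set \<Rightarrow> instr \<Rightarrow> nat ket \<Rightarrow> nat ket" where
  "apply_instr r (Gate S U) \<psi> = (\<lambda>x. \<Sum>y\<in>Pow S. U (x \<inter> S) y * \<psi> ((x - S) \<union> y))"
| "apply_instr r (Measure q) \<psi> = (\<lambda>x. if q \<in> x \<longleftrightarrow> q \<in> r then \<psi> x else 0)"

text \<open>Unnormalized: the squared norm of the result is the probability of the history.\<close>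

fun run :: "circuit \<Rightarrow> history \<Rightarrow> nat ket \<Rightarrow> nat ket" where
  "run c [] \<psi> = \<psi>"
| "run c (r # h) \<psi> = fold (apply_instr r) (next_layer c h) (run c h \<psi>)"

text \<open>The normalized state after a history of positive probability.\<close>

definition post_state :: "nat set \<Rightarrow> circuit \<Rightarrow> history \<Rightarrow> nat ket \<Rightarrow> nat ket" where
  "post_state Q c h \<psi> = scale (of_real (inverse (ket_norm Q (run c h \<psi>)))) (run c h \<psi>)"

text \<open>\<open>c\<close> first executes \<open>p\<close>: the layers of \<open>p\<close> are the initial layers of \<open>c\<close>.  The part of a complete
  history \<open>h\<close> of \<open>c\<close> produced by \<open>p\<close> is \<open>drop (depth c - depth p) h\<close>.\<close>

definition begins_with :: "circuit \<Rightarrow> circuit \<Rightarrow> bool" where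
  "begins_with c p \<longleftrightarrow> depth p \<le> depth c \<and> (\<forall>h. length h < depth p \<longrightarrow> next_layer c h = next_layer p h)"

text \<open>The logarithm of the depth bounds; the base only affects the constants.\<close>

definition log1 :: "real \<Rightarrow> real" where
  "log1 x = max 1 (ln x)"


section \<open>Consistency of the conventions\<close>

lemma map_mode_pos: "map (mode_pos \<nu>) (mode_list N \<nu>) = [0..<N * (\<nu> + 1)]"
proof (induction N)
  case (Suc N)
  have b: "map (mode_pos \<nu>) (Phys (Suc N) # map (Aux (Suc N)) [1..<Suc \<nu>])
      = [N * (\<nu> + 1)..<Suc N * (\<nu> + 1)]"
    by (rule nth_equalityI) (auto simp: nth_Cons simp del: upt_Suc split: nat.split)
  have "mode_list (Suc N) \<nu> = mode_list N \<nu> @ Phys (Suc N) # map (Aux (Suc N)) [1..<Suc \<nu>]"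
    by (simp add: mode_list_def)
  then have "map (mode_pos \<nu>) (mode_list (Suc N) \<nu>)
      = [0..<N * (\<nu> + 1)] @ [N * (\<nu> + 1)..<Suc N * (\<nu> + 1)]"
    using Suc.IH b by simp
  also have "\<dots> = [0..<Suc N * (\<nu> + 1)]"
    by (metis add.commute le_add1 mult_Suc upt_add_eq_append zero_le le_add2 le_add_diff_inverse)
  finally show ?case .
qed (simp add: mode_list_def)

lemma set_mode_list: "set (mode_list N \<nu>) = phys_modes N \<union> aux_modes N \<nu>"
  by (fastforce simp: mode_list_def phys_modes_def aux_modes_def simp del: upt_Suc)

lemma inj_on_mode_pos: "inj_on (mode_pos \<nu>) (set (mode_list N \<nu>))"
  by (metis distinct_map distinct_upt map_mode_pos)

lemma finite_modes: "finite (set (mode_list N \<nu>))"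
  by simp

lemma fermi_sign_insert:
  assumes "finite S" "k \<notin> S"
  shows "fermi_sign \<nu> m (insert k S)
    = (if mode_pos \<nu> k < mode_pos \<nu> m then - fermi_sign \<nu> m S else fermi_sign \<nu> m S)"
proof -
  have "{j \<in> insert k S. mode_pos \<nu> j < mode_pos \<nu> m}
     = (if mode_pos \<nu> k < mode_pos \<nu> m then insert k {j \<in> S. mode_pos \<nu> j < mode_pos \<nu> m}
        else {j \<in> S. mode_pos \<nu> j < mode_pos \<nu> m})" by auto
  with assms show ?thesis by (simp add: fermi_sign_def)
qed

lemma fermi_sign_square: "fermi_sign \<nu> m S * fermi_sign \<nu> m S = 1"
  by (simp add: fermi_sign_def flip: power_mult_distrib)

lemma fermi_sign_square': "fermi_sign \<nu> m S * (fermi_sign \<nu> m S * z) = z"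
  by (simp add: fermi_sign_square flip: mult.assoc)

text \<open>The canonical anticommutation relations, on amplitudes of configurations of the modes.\<close>

lemma car_annihilate:
  assumes "m \<in> set (mode_list N \<nu>)" "k \<in> set (mode_list N \<nu>)" "finite S"
  shows "annihilate \<nu> m (annihilate \<nu> k \<psi>) S + annihilate \<nu> k (annihilate \<nu> m \<psi>) S = 0"
proof (cases "m = k")
  case False
  then have "mode_pos \<nu> m \<noteq> mode_pos \<nu> k"
    using assms inj_on_mode_pos by (metis inj_on_def)
  with False assms(3) show ?thesis
    by (auto simp: annihilate_def fermi_sign_insert insert_commute)
qed (simp add: annihilate_def)

lemma car_create_annihilate:
  assumes "m \<in> set (mode_list N \<nu>)" "k \<in> set (mode_list N \<nu>)" "finite S"
  shows "annihilate \<nu> m (create \<nu> k \<psi>) S + create \<nu> k (annihilate \<nu> m \<psi>) S = (if m = k then \<psi> S else 0)"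
proof (cases "m = k")
  case True
  have "fermi_sign \<nu> k (insert k S) = fermi_sign \<nu> k S" for S
    unfolding fermi_sign_def by (rule arg_cong[where f = "\<lambda>A. (-1) ^ card A"]) auto
  moreover have "fermi_sign \<nu> k (S - {k}) = fermi_sign \<nu> k S"
    unfolding fermi_sign_def by (rule arg_cong[where f = "\<lambda>A. (-1) ^ card A"]) auto
  ultimately show ?thesis
    using True by (auto simp: annihilate_def create_def fermi_sign_square' insert_absorb)
next
  case False
  then have p: "mode_pos \<nu> m \<noteq> mode_pos \<nu> k"
    using assms inj_on_mode_pos by (metis inj_on_def)
  show ?thesis
  proof (cases "k \<in> S \<and> m \<notin> S")
    case True
    then obtain T where T: "S = insert k T" "k \<notin> T" "m \<notin> T" "finite T"
      by (metis Set.set_insert assms(3) finite_insert insertCI)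
    have "insert m (insert k T) - {k} = insert m T" using False T by auto
    then show ?thesis
      using False p T
      by (auto simp: annihilate_def create_def fermi_sign_insert insert_commute)
  qed (use False in \<open>auto simp: annihilate_def create_def\<close>)
qed

lemma creation_string_vac:
  assumes "sorted_wrt (\<lambda>a b. mode_pos \<nu> a < mode_pos \<nu> b) ms"
  shows "foldr (create \<nu>) ms vac = (\<lambda>T. if T = set ms then 1 else 0)"
  using assms
proof (induction ms)
  case Nil
  show ?case by (simp add: vac_def)
next
  case (Cons a ms)
  have n: "a \<notin> set ms" using Cons.prems by auto
  have s: "fermi_sign \<nu> a (insert a (set ms)) = 1"
  proof -
    have "{k \<in> insert a (set ms). mode_pos \<nu> k < mode_pos \<nu> a} = {}"
      using Cons.prems by auto
    then show ?thesis by (simp add: fermi_sign_def del: Collect_empty_eq)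
  qed
  have "T - {a} = set ms \<longleftrightarrow> T = insert a (set ms)" if "a \<in> T" for T
    using n that by auto
  then show ?case
    using Cons n s by (auto simp: create_def fun_eq_iff)
qed

lemma creation_poly_vac:
  assumes "\<And>S. \<Psi> S \<noteq> 0 \<Longrightarrow> S \<subseteq> set (mode_list N \<nu>)"
  shows "creation_poly N \<nu> \<Psi> vac = \<Psi>"
proof
  fix T
  have "sorted_wrt (<) (map (mode_pos \<nu>) (mode_list N \<nu>))"
    unfolding map_mode_pos by (rule sorted_wrt_upt)
  then have "sorted_wrt (\<lambda>a b. mode_pos \<nu> a < mode_pos \<nu> b) (mode_list N \<nu>)"
    by (simp add: sorted_wrt_map)
  then have *: "foldr (create \<nu>) (filter (\<lambda>m. m \<in> S) (mode_list N \<nu>)) vac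
      = (\<lambda>T. if T = S then 1 else 0)" if "S \<subseteq> set (mode_list N \<nu>)" for S
    using that by (subst creation_string_vac) (auto simp: sorted_wrt_filter fun_eq_iff)
  have "creation_poly N \<nu> \<Psi> vac T
      = (\<Sum>S\<in>Pow (set (mode_list N \<nu>)). if S = T then \<Psi> S else 0)"
    unfolding creation_poly_def by (rule sum.cong) (auto simp: *)
  also have "\<dots> = \<Psi> T"
    using assms[of T] by (auto simp: sum.delta)
  finally show "creation_poly N \<nu> \<Psi> vac T = \<Psi> T" .
qed

text \<open>Annihilation operators become a lowering operator with a string of Pauli Z factors on the
  preceding qubits.\<close>

lemma jw_encode_annihilate:
  assumes "m \<in> set (mode_list N \<nu>)" and "x \<subseteq> {..<N * (\<nu> + 1)}"
  shows "jw_encode N \<nu> (annihilate \<nu> m \<psi>) x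
    = (if mode_pos \<nu> m \<in> x then 0
       else (\<Prod>q<mode_pos \<nu> m. if q \<in> x then - 1 else 1) * jw_encode N \<nu> \<psi> (insert (mode_pos \<nu> m) x))"
proof -
  let ?L = "set (mode_list N \<nu>)" and ?p = "mode_pos \<nu>"
  let ?S = "{k \<in> ?L. ?p k \<in> x}"
  have im: "?p ` ?L = {..<N * (\<nu> + 1)}"
    by (metis map_mode_pos set_map set_upt atLeast0LessThan)
  have "?p m \<in> ?p ` ?L" using assms(1) by auto
  then have ins: "insert (?p m) x \<subseteq> ?p ` ?L" using assms(2) im by auto
  have S: "{k \<in> ?L. ?p k \<in> insert (?p m) x} = insert m ?S"
    using assms(1) inj_on_mode_pos by (auto dest: inj_onD)
  have "?p ` {k \<in> ?S. ?p k < ?p m} = {q \<in> x. q < ?p m}"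
  proof
    show "{q \<in> x. q < ?p m} \<subseteq> ?p ` {k \<in> ?S. ?p k < ?p m}"
    proof
      fix q assume q: "q \<in> {q \<in> x. q < ?p m}"
      then have "q \<in> ?p ` ?L" using assms(2) im by blast
      with q show "q \<in> ?p ` {k \<in> ?S. ?p k < ?p m}" by blast
    qed
  qed auto
  moreover have "inj_on ?p {k \<in> ?S. ?p k < ?p m}"
    by (rule inj_on_subset[OF inj_on_mode_pos]) auto
  ultimately have c: "card {k \<in> ?S. ?p k < ?p m} = card {q \<in> x. q < ?p m}"
    by (simp flip: card_image)
  have "(\<Prod>q<?p m. if q \<in> x then - 1 else (1::complex)) = (- 1) ^ card ({..<?p m} \<inter> x)"
    by (simp add: prod.If_cases)
  also have "{..<?p m} \<inter> x = {q \<in> x. q < ?p m}" by auto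
  finally have "(\<Prod>q<?p m. if q \<in> x then - 1 else 1) = fermi_sign \<nu> m ?S"
    by (simp only: fermi_sign_def c)
  then show ?thesis
    using ins S assms im by (auto simp: jw_encode_def annihilate_def)
qed

lemma hopping_color_classes:
  assumes "simple_graph V E" "proper_edge_coloring E \<chi> c"
  shows "hopping \<nu> t E \<psi> S = (\<Sum>\<alpha>=1..\<chi>. hopping \<nu> t (color_class E c \<alpha>) \<psi> S)"
proof -
  let ?P = "\<lambda>F. {(i, j). i < j \<and> {i, j} \<in> F}"
  have sub: "?P E \<subseteq> V \<times> V" using assms(1) by (auto simp: simple_graph_def)
  have fin: "finite (?P E)"
    by (rule finite_subset[OF sub]) (use assms(1) in \<open>auto simp: simple_graph_def\<close>)
  have U: "?P E = (\<Union>\<alpha>\<in>{1..\<chi>}. ?P (color_class E c \<alpha>))"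
    using assms(2) by (fastforce simp: color_class_def proper_edge_coloring_def)
  have "finite (?P (color_class E c \<alpha>))" for \<alpha>
    by (rule finite_subset[OF _ fin]) (auto simp: color_class_def)
  then show ?thesis
    unfolding hopping_def U
    by (intro sum.UNION_disjoint) (auto simp: color_class_def)
qed

end

theory Submission
  imports Defs
begin

text \<open>
  An edge qubit is attached to every edge.  For an edge \<open>e = {i, j}\<close>, \<open>i < j\<close>, the hopping term is
  \<open>T e\<close> times the projection onto unequal occupations of \<open>i\<close> and \<open>j\<close>, where \<open>T e = X i Z \<dots> Z X j\<close> is
  a Majorana bilinear.  Replace a state \<open>\<psi>\<close> by the superposition, over all sets \<open>b\<close> of edges, of
  \<open>T b \<psi>\<close>, where \<open>T b\<close> is the ordered product of the bilinears of \<open>b\<close> and \<open>b\<close> is recorded in the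
  edge qubits.  Then \<open>T e\<close> acts by toggling \<open>e\<close> in \<open>b\<close>, up to a sign that depends only on the edges
  of \<open>b\<close> at the two ends of \<open>e\<close>; so a Trotter step of one color has constant depth, independently
  of \<open>N\<close>.

  To encode the edges of one color, the sign of the reordering that makes matched sites adjacent is
  applied, after which \<open>T e\<close> is \<open>X i X j\<close>.  This sign is a product over the binary digits of
  the new positions, and for each digit it is a prefix parity, which an adaptive circuit computes in
  constant depth; hence the factor \<open>log N\<close>.  For decoding, the edge qubits are measured, and the
  known Pauli operator \<open>T b\<close> is undone.  The auxiliary modes thus start and end in the vacuum, and
  their qubits only serve as workspace.
\<close>

section \<open>Symmetric differences and parities\<close>

text \<open>The obstacle is the length of the Jordan-Wigner strings: removing them for a color class
  takes a reordering sign of depth of order log N, and paying this in every Trotter step would give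
  M \<chi> log N. The superposition over edge sets pays it once per color; afterwards, multiplying
  by a bilinear only relabels. The sign of the relabelling is local because a bilinear is a product
  of two different kinds of Majorana operators, one kind for lower and one for upper ends: only
  later edges with the same lower end or with the same upper end matter. So two parities per site
  suffice, kept in \<open>U\<close> and \<open>V\<close>. As each color is a matching, one layer of
  CNOTs per register and color updates them while the colors are swept in the order of the Trotter
  product. The site qubits are made to show the occupations before \<open>T b\<close>, so that the
  test for unequal occupations is local as well. Matchings also bound the qubits: at most N/2 edges
  per color, hence at most \<nu> N edge qubits, besides two registers of N qubits. A Trotter step
  costs 15 layers per color; the encoding costs 22 layers per color and binary digit, plus a
  constant per color.\<close>

definition sdiff :: "'a set \<Rightarrow> 'a set \<Rightarrow> 'a set" (infixl "\<ominus>" 65) where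
  "A \<ominus> B = {x. (x \<in> A) \<noteq> (x \<in> B)}"

lemma in_sdiff [simp]: "x \<in> A \<ominus> B \<longleftrightarrow> (x \<in> A) \<noteq> (x \<in> B)"
  by (simp add: sdiff_def)

lemma sdiff_assoc: "(A \<ominus> B) \<ominus> C = A \<ominus> (B \<ominus> C)"
  by auto

lemma sdiff_commute: "A \<ominus> B = B \<ominus> A"
  by auto

lemma sdiff_left_commute: "A \<ominus> (B \<ominus> C) = B \<ominus> (A \<ominus> C)"
  by auto

lemmas sdiff_ac = sdiff_assoc sdiff_commute sdiff_left_commute

lemma sdiff_empty [simp]: "A \<ominus> {} = A" "{} \<ominus> A = A"
  by auto

lemma sdiff_self [simp]: "A \<ominus> A = {}" "A \<ominus> (A \<ominus> B) = B" "(B \<ominus> A) \<ominus> A = B"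
  by auto

lemma sdiff_right_cancel: "A \<ominus> C = B \<ominus> C \<longleftrightarrow> A = B"
  by (metis sdiff_self(3))

lemma finite_sdiff [simp]: "finite A \<Longrightarrow> finite B \<Longrightarrow> finite (A \<ominus> B)"
  by (rule finite_subset[of _ "A \<union> B"]) auto

lemma sdiff_Int: "(A \<ominus> B) \<inter> C = (A \<inter> C) \<ominus> (B \<inter> C)" "C \<inter> (A \<ominus> B) = (C \<inter> A) \<ominus> (C \<inter> B)"
  by auto

text \<open>Sets form a vector space over the field with two elements under
  \<open>\<ominus>\<close>, and the maps sending \<open>x\<close> to
  \<open>psign (x \<inter> A)\<close> are its characters: products of Z act on amplitudes by such
  signs, products of X by shifts. An infinite set has \<open>card\<close> 0 and so sign 1; hence the
  finiteness hypotheses below.\<close>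

definition psign :: "'a set \<Rightarrow> complex" where
  "psign A = (- 1) ^ card A"

lemma psign_empty [simp]: "psign {} = 1"
  by (simp add: psign_def)

lemma psign_square [simp]: "psign A * psign A = 1" "psign A * (psign A * z) = z"
  by (simp_all add: psign_def flip: power_mult_distrib mult.assoc)

lemma psign_cases: "psign A = 1 \<or> psign A = - 1"
  by (auto simp: psign_def minus_one_power_iff)

lemma psign_nonzero [simp]: "psign A \<noteq> 0"
  by (simp add: psign_def)

lemma psign_insert: "finite A \<Longrightarrow> psign (insert a A) = (if a \<in> A then psign A else - psign A)"
  by (simp add: psign_def insert_absorb)

lemma psign_Un_disjoint: "finite A \<Longrightarrow> finite B \<Longrightarrow> A \<inter> B = {} \<Longrightarrow> psign (A \<union> B) = psign A * psign B"
  by (simp add: psign_def card_Un_disjoint power_add)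

lemma psign_sdiff:
  assumes "finite A" "finite B"
  shows "psign (A \<ominus> B) = psign A * psign B"
proof -
  have "A \<ominus> B = (A - B) \<union> (B - A)" by auto
  then have 1: "psign (A \<ominus> B) = psign (A - B) * psign (B - A)"
    using psign_Un_disjoint[of "A - B" "B - A"] assms by auto
  have 2: "psign A = psign (A - B) * psign (A \<inter> B)"
    using psign_Un_disjoint[of "A - B" "A \<inter> B"] assms by (simp add: Un_Diff_Int Diff_Int_distrib2)
  have "B = (B - A) \<union> (A \<inter> B)" by auto
  then have 3: "psign B = psign (B - A) * psign (A \<inter> B)"
    using psign_Un_disjoint[of "B - A" "A \<inter> B"] assms by auto
  show ?thesis unfolding 1 2 3 by (simp add: mult.left_commute)
qed

lemma psign_image: "inj_on f A \<Longrightarrow> psign (f ` A) = psign A"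
  by (simp add: psign_def card_image)

lemma psign_Sigma:
  assumes "finite A" "\<And>a. a \<in> A \<Longrightarrow> finite (R a)"
  shows "psign (Sigma A R) = (\<Prod>a\<in>A. psign (R a))"
  using assms by (simp add: psign_def card_SigmaI power_sum)

section \<open>Gates and layers on abstract qubits\<close>

type_synonym 'w gate = "'w set \<times> ('w set \<Rightarrow> 'w set \<Rightarrow> complex)"

text \<open>The condition of \<open>unitary_on\<close> over an arbitrary type of qubit names.
  Circuits are built on named wires and transported to numbered qubits only in
  \<open>reach_circuit\<close>.\<close>

definition unitary_mat :: "'w set \<Rightarrow> ('w set \<Rightarrow> 'w set \<Rightarrow> complex) \<Rightarrow> bool" where
  "unitary_mat S U \<longleftrightarrow> (\<forall>x\<in>Pow S. \<forall>y\<in>Pow S.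
     (\<Sum>z\<in>Pow S. cnj (U z x) * U z y) = (if x = y then 1 else 0))"

definition app :: "'w gate \<Rightarrow> 'w ket \<Rightarrow> 'w ket" where
  "app g \<psi> = (\<lambda>x. \<Sum>y\<in>Pow (fst g). snd g (x \<inter> fst g) y * \<psi> ((x - fst g) \<union> y))"

definition gates_ok :: "'w set \<Rightarrow> 'w gate list \<Rightarrow> bool" where
  "gates_ok W gs \<longleftrightarrow>
     (\<forall>g\<in>set gs. card (fst g) \<in> {1, 2} \<and> fst g \<subseteq> W \<and> unitary_mat (fst g) (snd g)) \<and>
     sorted_wrt (\<lambda>g g'. fst g \<inter> fst g' = {}) gs"

definition proj :: "'w set \<Rightarrow> 'w set \<Rightarrow> 'w ket \<Rightarrow> 'w ket" where
  "proj A r \<psi> = (\<lambda>x. if x \<inter> A = r then \<psi> x else 0)"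

definition supp :: "'w set \<Rightarrow> 'w ket \<Rightarrow> bool" where
  "supp W \<psi> \<longleftrightarrow> (\<forall>x. \<not> x \<subseteq> W \<longrightarrow> \<psi> x = 0)"

text \<open>\<open>reach W d F H\<close>: some adaptive circuit of depth \<open>d\<close> on the qubits \<open>W\<close> maps, for every index \<open>a\<close>
  and whatever the measurement outcomes are, the vector \<open>F a\<close> to a multiple of \<open>H a\<close>.\<close>

inductive reach :: "'w set \<Rightarrow> nat \<Rightarrow> ('i \<Rightarrow> 'w ket) \<Rightarrow> ('i \<Rightarrow> 'w ket) \<Rightarrow> bool"
  for W :: "'w set" where
  stop: "(\<And>a. \<exists>z. F a = scale z (H a)) \<Longrightarrow> reach W 0 F H"
| gates: "gates_ok W gs \<Longrightarrow> reach W d (\<lambda>a. fold app gs (F a)) H \<Longrightarrow> reach W (Suc d) F H"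
| meas: "A \<subseteq> W \<Longrightarrow> (\<And>r. r \<subseteq> A \<Longrightarrow> reach W d (\<lambda>a. proj A r (F a)) H) \<Longrightarrow> reach W (Suc d) F H"

section \<open>Scalar factors and composition of circuits\<close>

lemma scale_scale: "scale c (scale d \<psi>) = scale (c * d) \<psi>"
  by (simp add: scale_def mult.assoc)

lemma scale_one [simp]: "scale 1 \<psi> = \<psi>"
  by (simp add: scale_def)

lemma app_scale: "app g (scale c \<psi>) = scale c (app g \<psi>)"
  by (auto simp: app_def scale_def sum_distrib_left fun_eq_iff mult.left_commute)

lemma fold_app_scale: "fold app gs (scale c \<psi>) = scale c (fold app gs \<psi>)"
  by (induction gs arbitrary: \<psi>) (auto simp: app_scale)

lemma proj_scale: "proj A r (scale c \<psi>) = scale c (proj A r \<psi>)"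
  by (auto simp: proj_def scale_def)

text \<open>Gates and projections are linear, so a factor present at the start survives to the end.
  Normalizations and signs depending on measurement outcomes can thus be dropped as they arise; the
  factor may be 0, for impossible outcomes.\<close>

lemma reach_scale:
  assumes "reach W d G H" "\<And>a. \<exists>z. F a = scale z (G a)"
  shows "reach W d F H"
  using assms
proof (induction arbitrary: F rule: reach.induct)
  case (stop G H)
  have "\<exists>z. F a = scale z (H a)" for a
    using stop(1)[of a] stop(2)[of a] by (auto simp: scale_scale)
  then show ?case by (rule reach.stop)
next
  case (gates gs d G H)
  have "reach W d (\<lambda>a. fold app gs (F a)) H"
  proof (rule gates.IH)
    fix a
    obtain z where "F a = scale z (G a)" using gates.prems by blast
    then show "\<exists>z. fold app gs (F a) = scale z (fold app gs (G a))"
      by (auto simp: fold_app_scale)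
  qed
  with gates(1) show ?case by (rule reach.gates)
next
  case (meas A d G H)
  show ?case
  proof (rule reach.meas[OF meas(1)])
    fix r assume r: "r \<subseteq> A"
    show "reach W d (\<lambda>a. proj A r (F a)) H"
    proof (rule meas.IH[OF r])
      fix a
      obtain z where "F a = scale z (G a)" using meas.prems by blast
      then show "\<exists>z. proj A r (F a) = scale z (proj A r (G a))"
        by (auto simp: proj_scale)
    qed
  qed
qed

lemma reach_refl: "reach W 0 F F"
  by (rule reach.stop) (rule exI[of _ 1], simp)

lemma reach_trans:
  assumes "reach W d F G" "reach W d' G H"
  shows "reach W (d + d') F H"
  using assms
proof (induction rule: reach.induct)
  case (stop F G)
  then show ?case by (simp add: reach_scale)
next
  case (gates gs d F G)
  then show ?case by (simp add: reach.gates)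
next
  case (meas A d F G)
  then show ?case by (simp add: reach.meas)
qed

lemma reach_iterate:
  assumes "\<And>k. k < n \<Longrightarrow> reach W d (F k) (F (Suc k))"
  shows "reach W (n * d) (F 0) (F n)"
  using assms
proof (induction n)
  case (Suc n)
  then have "reach W (n * d) (F 0) (F n)" "reach W d (F n) (F (Suc n))" by auto
  from reach_trans[OF this] show ?case by (simp add: add.commute)
qed (simp add: reach_refl)

lemma reach_down:
  assumes "\<And>k. k < n \<Longrightarrow> reach W d (F (Suc k)) (F k)"
  shows "reach W (n * d) (F n) (F 0)"
  using assms
proof (induction n)
  case (Suc n)
  then have "reach W d (F (Suc n)) (F n)" "reach W (n * d) (F n) (F 0)" by auto
  from reach_trans[OF this] show ?case by simp
qed (simp add: reach_refl)

text \<open>The index stands for the unknown physical state. Composing with an evolution of that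
  state lets a circuit proved correct for all inputs run on an already evolved one, which is how
  successive Trotter steps are chained.\<close>

lemma reach_reindex: "reach W d F H \<Longrightarrow> reach W d (\<lambda>a. F (f a)) (\<lambda>a. H (f a))"
proof (induction rule: reach.induct)
  case (stop F G)
  then show ?case by (intro reach.stop) auto
next
  case (gates gs d F G)
  then show ?case by (auto intro: reach.gates)
next
  case (meas A d F G)
  then show ?case by (auto intro: reach.meas)
qed

subsection \<open>Monomial gates\<close>

text \<open>Row \<open>x\<close> has its only nonzero entry in column \<open>f x\<close>, so the
  gate acts on amplitudes by pulling back along \<open>f\<close>. CNOT, CZ, X and Z are all of this
  form with an involution \<open>f\<close>, for which unitarity is immediate.\<close>

definition mono_gate :: "'w set \<Rightarrow> ('w set \<Rightarrow> complex) \<Rightarrow> ('w set \<Rightarrow> 'w set) \<Rightarrow> 'w gate" where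
  "mono_gate S s f = (S, \<lambda>x y. if y = f x then s x else 0)"

lemma app_mono_gate:
  assumes "finite S" "\<And>x. x \<subseteq> S \<Longrightarrow> f x \<subseteq> S"
  shows "app (mono_gate S s f) \<psi> = (\<lambda>x. s (x \<inter> S) * \<psi> ((x - S) \<union> f (x \<inter> S)))"
proof
  fix x
  have "app (mono_gate S s f) \<psi> x
     = (\<Sum>y\<in>Pow S. if y = f (x \<inter> S) then s (x \<inter> S) * \<psi> ((x - S) \<union> y) else 0)"
    unfolding app_def mono_gate_def by (intro sum.cong) auto
  also have "\<dots> = s (x \<inter> S) * \<psi> ((x - S) \<union> f (x \<inter> S))"
    using assms by (simp add: sum.delta)
  finally show "app (mono_gate S s f) \<psi> x = s (x \<inter> S) * \<psi> ((x - S) \<union> f (x \<inter> S))" .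
qed

lemma unitary_mono_gate:
  assumes "finite S" "\<And>x. x \<subseteq> S \<Longrightarrow> f x \<subseteq> S \<and> f (f x) = x" "\<And>x. cmod (s x) = 1"
  shows "unitary_mat (fst (mono_gate S s f)) (snd (mono_gate S s f))"
  unfolding unitary_mat_def mono_gate_def
proof (intro ballI, simp only: fst_conv snd_conv)
  fix x y assume xy: "x \<in> Pow S" "y \<in> Pow S"
  have n: "cnj (s z) * s z = 1" for z
    using assms(3)[of z] by (metis complex_norm_square mult.commute of_real_1 one_power2)
  have "x = f z \<longleftrightarrow> z = f x" if "z \<subseteq> S" for z using assms(2) that xy by blast
  then have "(\<Sum>z\<in>Pow S. cnj (if x = f z then s z else 0) * (if y = f z then s z else 0))
      = (\<Sum>z\<in>Pow S. if z = f x then (if x = y then 1 else 0) else 0)"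
    using n assms(2) xy by (intro sum.cong) auto
  also have "\<dots> = (if x = y then 1 else 0)" using assms xy by (auto simp: sum.delta)
  finally show "(\<Sum>z\<in>Pow S. cnj (if x = f z then s z else 0) * (if y = f z then s z else 0))
      = (if x = y then 1 else 0)" .
qed

definition flips :: "('w \<times> 'w) set \<Rightarrow> 'w set \<Rightarrow> 'w set" where
  "flips R x = {t. \<exists>c\<in>x. (c, t) \<in> R}"

definition disjoint_pairs :: "('w \<times> 'w) set \<Rightarrow> bool" where
  "disjoint_pairs R \<longleftrightarrow> (\<forall>p\<in>R. fst p \<noteq> snd p) \<and>
     (\<forall>p\<in>R. \<forall>q\<in>R. p \<noteq> q \<longrightarrow> {fst p, snd p} \<inter> {fst q, snd q} = {})"

text \<open>Pairs of qubits are (control, target).\<close>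

definition cnots :: "('w \<times> 'w) set \<Rightarrow> 'w ket \<Rightarrow> 'w ket" where
  "cnots R \<psi> = (\<lambda>x. \<psi> (x \<ominus> flips R x))"

definition czs :: "('w \<times> 'w) set \<Rightarrow> 'w ket \<Rightarrow> 'w ket" where
  "czs R \<psi> = (\<lambda>x. psign {p \<in> R. fst p \<in> x \<and> snd p \<in> x} * \<psi> x)"

definition xs :: "'w set \<Rightarrow> 'w ket \<Rightarrow> 'w ket" where
  "xs A \<psi> = (\<lambda>x. \<psi> (x \<ominus> A))"

definition zs :: "'w set \<Rightarrow> 'w ket \<Rightarrow> 'w ket" where
  "zs A \<psi> = (\<lambda>x. psign (x \<inter> A) * \<psi> x)"

text \<open>Hadamard gates without their factors 1/sqrt 2, which are irrelevant because
  \<open>reach\<close> determines vectors only up to a multiple.\<close>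

definition hs :: "'w set \<Rightarrow> 'w ket \<Rightarrow> 'w ket" where
  "hs A \<psi> = (\<lambda>x. \<Sum>y\<in>Pow A. psign (x \<inter> y) * \<psi> ((x - A) \<union> y))"

lemma gates_ok_map:
  assumes "distinct ps" "set ps = R"
    and "\<And>p. p \<in> R \<Longrightarrow> card (fst (g p)) \<in> {1, 2} \<and> fst (g p) \<subseteq> W \<and> unitary_mat (fst (g p)) (snd (g p))"
    and "\<And>p q. p \<in> R \<Longrightarrow> q \<in> R \<Longrightarrow> p \<noteq> q \<Longrightarrow> fst (g p) \<inter> fst (g q) = {}"
  shows "gates_ok W (map g ps)"
proof -
  have "sorted_wrt (\<lambda>p q. fst (g p) \<inter> fst (g q) = {}) ps"
    unfolding sorted_wrt_iff_nth_less
    by (intro allI impI assms(4)) (use assms(1,2) in \<open>auto simp: nth_eq_iff_index_eq\<close>)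
  then show ?thesis
    using assms unfolding gates_ok_def by (auto simp: sorted_wrt_map)
qed

text \<open>\<open>G T\<close> is a closed form for the joint effect of the gates with index in
  \<open>T\<close>. The constant \<open>c\<close> absorbs one normalization factor per gate; it is 1
  except for Hadamard gates.\<close>

lemma reach_layer:
  assumes "finite R"
    and ok: "\<And>p. p \<in> R \<Longrightarrow> card (fst (g p)) \<in> {1, 2} \<and> fst (g p) \<subseteq> W \<and> unitary_mat (fst (g p)) (snd (g p))"
    and disj: "\<And>p q. p \<in> R \<Longrightarrow> q \<in> R \<Longrightarrow> p \<noteq> q \<Longrightarrow> fst (g p) \<inter> fst (g q) = {}"
    and empty: "\<And>\<psi>. G {} \<psi> = \<psi>"
    and insert: "\<And>p T \<psi>. insert p T \<subseteq> R \<Longrightarrow> p \<notin> T \<Longrightarrow> G T (app (g p) \<psi>) = scale c (G (insert p T) \<psi>)"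
  shows "reach W 1 F (\<lambda>a. G R (F a))"
proof -
  obtain ps where ps: "distinct ps" "set ps = R"
    using finite_distinct_list[OF assms(1)] by blast
  have "\<exists>z. fold (\<lambda>p. app (g p)) qs \<psi> = scale z (G (set qs) \<psi>)" if "distinct qs" "set qs \<subseteq> R" for qs \<psi>
    using that
  proof (induction qs arbitrary: \<psi>)
    case Nil
    show ?case by (auto simp: empty intro!: exI[of _ 1])
  next
    case (Cons p qs)
    then obtain z where "fold (\<lambda>p. app (g p)) qs (app (g p) \<psi>) = scale z (G (set qs) (app (g p) \<psi>))"
      by auto
    then show ?case using Cons.prems insert[of p "set qs" \<psi>] by (auto simp: scale_scale)
  qed
  then have "reach W 0 (\<lambda>a. fold app (map g ps) (F a)) (\<lambda>a. G R (F a))"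
    using ps by (intro reach.stop) (auto simp: fold_map comp_def)
  moreover have "gates_ok W (map g ps)" by (rule gates_ok_map[OF ps ok disj])
  ultimately show ?thesis by (simp add: reach.gates)
qed

definition cnot_gate :: "'w \<times> 'w \<Rightarrow> 'w gate" where
  "cnot_gate p = mono_gate {fst p, snd p} (\<lambda>x. 1) (\<lambda>x. if fst p \<in> x then x \<ominus> {snd p} else x)"

definition cz_gate :: "'w \<times> 'w \<Rightarrow> 'w gate" where
  "cz_gate p = mono_gate {fst p, snd p} (\<lambda>x. if fst p \<in> x \<and> snd p \<in> x then - 1 else 1) id"

definition x_gate :: "'w \<Rightarrow> 'w gate" where
  "x_gate q = mono_gate {q} (\<lambda>x. 1) (\<lambda>x. x \<ominus> {q})"

definition z_gate :: "'w \<Rightarrow> 'w gate" where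
  "z_gate q = mono_gate {q} (\<lambda>x. if q \<in> x then - 1 else 1) id"

lemma fst_mono_gate [simp]: "fst (mono_gate S s f) = S"
  by (simp add: mono_gate_def)

lemma app_cnot_gate:
  assumes "fst p \<noteq> snd p"
  shows "app (cnot_gate p) \<psi> x = \<psi> (if fst p \<in> x then x \<ominus> {snd p} else x)"
proof -
  have "(x - {fst p, snd p}) \<union> (if fst p \<in> x \<inter> {fst p, snd p} then (x \<inter> {fst p, snd p}) \<ominus> {snd p} else x \<inter> {fst p, snd p})
     = (if fst p \<in> x then x \<ominus> {snd p} else x)"
    using assms by auto
  then show ?thesis
    unfolding cnot_gate_def by (subst app_mono_gate) (auto simp: if_distrib)
qed

lemma app_cz_gate: "app (cz_gate p) \<psi> x = (if fst p \<in> x \<and> snd p \<in> x then - 1 else 1) * \<psi> x"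
  unfolding cz_gate_def by (subst app_mono_gate) (auto simp: Un_Diff_Int)

lemma app_x_gate: "app (x_gate q) \<psi> x = \<psi> (x \<ominus> {q})"
proof -
  have "(x - {q}) \<union> ((x \<inter> {q}) \<ominus> {q}) = x \<ominus> {q}" by auto
  then show ?thesis unfolding x_gate_def by (subst app_mono_gate) auto
qed

lemma app_z_gate: "app (z_gate q) \<psi> x = (if q \<in> x then - 1 else 1) * \<psi> x"
  unfolding z_gate_def by (subst app_mono_gate) (auto simp: Un_Diff_Int)

lemma pair_gate_ok:
  assumes R: "disjoint_pairs R" "fst ` R \<union> snd ` R \<subseteq> W" and p: "p \<in> R"
  shows "card {fst p, snd p} \<in> {1, 2} \<and> {fst p, snd p} \<subseteq> W"
    and "\<And>q. q \<in> R \<Longrightarrow> p \<noteq> q \<Longrightarrow> {fst p, snd p} \<inter> {fst q, snd q} = {}"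
  using assms by (auto simp: disjoint_pairs_def)

lemma reach_cnots:
  fixes F :: "'i \<Rightarrow> 'w ket"
  assumes fin: "finite R" and R: "disjoint_pairs R" "fst ` R \<union> snd ` R \<subseteq> W"
  shows "reach W 1 F (\<lambda>a. cnots R (F a))"
proof (rule reach_layer[OF fin, where g = cnot_gate and c = 1])
  fix p assume p: "p \<in> R"
  show "card (fst (cnot_gate p)) \<in> {1, 2} \<and> fst (cnot_gate p) \<subseteq> W
      \<and> unitary_mat (fst (cnot_gate p)) (snd (cnot_gate p))"
    using pair_gate_ok(1)[OF R p] p R(1) unfolding cnot_gate_def
    by (intro conjI unitary_mono_gate) (auto simp: disjoint_pairs_def)
next
  fix p q assume "p \<in> R" "q \<in> R" "p \<noteq> q"
  then show "fst (cnot_gate p) \<inter> fst (cnot_gate q) = {}"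
    using pair_gate_ok(2)[OF R] by (simp add: cnot_gate_def)
next
  fix p T and \<psi> :: "'w ket" assume T: "insert p T \<subseteq> R" "p \<notin> T"
  have ne: "fst p \<noteq> snd p" using T R by (auto simp: disjoint_pairs_def)
  have dq: "{fst p, snd p} \<inter> {fst q, snd q} = {}" if "q \<in> T" for q
    using pair_gate_ok(2)[OF R, of p q] T that by blast
  show "cnots T (app (cnot_gate p) \<psi>) = scale 1 (cnots (insert p T) \<psi>)"
  proof
    fix x
    have 1: "fst p \<notin> flips T x" "snd p \<notin> flips T x"
      using dq by (fastforce simp: flips_def)+
    have "flips (insert p T) x = flips T x \<union> (if fst p \<in> x then {snd p} else {})"
      by (cases p) (auto simp: flips_def)
    then have "(if fst p \<in> x \<ominus> flips T x then (x \<ominus> flips T x) \<ominus> {snd p} else x \<ominus> flips T x) = x \<ominus> flips (insert p T) x"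
      using 1 by auto
    then show "cnots T (app (cnot_gate p) \<psi>) x = scale 1 (cnots (insert p T) \<psi>) x"
      by (simp add: cnots_def app_cnot_gate[OF ne])
  qed
qed (simp add: cnots_def flips_def)

lemma reach_czs:
  fixes F :: "'i \<Rightarrow> 'w ket"
  assumes fin: "finite R" and R: "disjoint_pairs R" "fst ` R \<union> snd ` R \<subseteq> W"
  shows "reach W 1 F (\<lambda>a. czs R (F a))"
proof (rule reach_layer[OF fin, where g = cz_gate and c = 1])
  fix p assume p: "p \<in> R"
  show "card (fst (cz_gate p)) \<in> {1, 2} \<and> fst (cz_gate p) \<subseteq> W
      \<and> unitary_mat (fst (cz_gate p)) (snd (cz_gate p))"
    using pair_gate_ok(1)[OF R p] unfolding cz_gate_def
    by (intro conjI unitary_mono_gate) auto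
next
  fix p q assume "p \<in> R" "q \<in> R" "p \<noteq> q"
  then show "fst (cz_gate p) \<inter> fst (cz_gate q) = {}"
    using pair_gate_ok(2)[OF R] by (simp add: cz_gate_def)
next
  fix p T and \<psi> :: "'w ket" assume T: "insert p T \<subseteq> R" "p \<notin> T"
  have "finite T" by (rule finite_subset[OF _ fin]) (use T in auto)
  moreover have "{q \<in> insert p T. fst q \<in> x \<and> snd q \<in> x} =
     (if fst p \<in> x \<and> snd p \<in> x then insert p {q \<in> T. fst q \<in> x \<and> snd q \<in> x} else {q \<in> T. fst q \<in> x \<and> snd q \<in> x})" for x
    by auto
  ultimately show "czs T (app (cz_gate p) \<psi>) = scale 1 (czs (insert p T) \<psi>)"
    using T by (auto simp: fun_eq_iff czs_def app_cz_gate psign_insert)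
qed (simp add: czs_def)

lemma reach_xs:
  fixes F :: "'i \<Rightarrow> 'w ket"
  assumes fin: "finite A" and A: "A \<subseteq> W"
  shows "reach W 1 F (\<lambda>a. xs A (F a))"
proof (rule reach_layer[OF fin, where g = x_gate and c = 1])
  fix p assume "p \<in> A"
  then show "card (fst (x_gate p)) \<in> {1, 2} \<and> fst (x_gate p) \<subseteq> W
      \<and> unitary_mat (fst (x_gate p)) (snd (x_gate p))"
    unfolding x_gate_def using A by (intro conjI unitary_mono_gate) auto
next
  fix p :: 'w and T and \<psi> :: "'w ket" assume "p \<notin> T"
  then have "(x \<ominus> T) \<ominus> {p} = x \<ominus> insert p T" for x by auto
  then show "xs T (app (x_gate p) \<psi>) = scale 1 (xs (insert p T) \<psi>)"
    by (simp add: xs_def app_x_gate)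
qed (auto simp: x_gate_def xs_def)

lemma reach_zs:
  fixes F :: "'i \<Rightarrow> 'w ket"
  assumes fin: "finite A" and A: "A \<subseteq> W"
  shows "reach W 1 F (\<lambda>a. zs A (F a))"
proof (rule reach_layer[OF fin, where g = z_gate and c = 1])
  fix p assume "p \<in> A"
  then show "card (fst (z_gate p)) \<in> {1, 2} \<and> fst (z_gate p) \<subseteq> W
      \<and> unitary_mat (fst (z_gate p)) (snd (z_gate p))"
    unfolding z_gate_def using A by (intro conjI unitary_mono_gate) auto
next
  fix p T and \<psi> :: "'w ket" assume T: "insert p T \<subseteq> A" "p \<notin> T"
  have "finite T" by (rule finite_subset[OF _ fin]) (use T in auto)
  moreover have "x \<inter> insert p T = (if p \<in> x then insert p (x \<inter> T) else x \<inter> T)" for x by auto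
  ultimately show "zs T (app (z_gate p) \<psi>) = scale 1 (zs (insert p T) \<psi>)"
    using T by (auto simp: fun_eq_iff zs_def app_z_gate psign_insert)
qed (auto simp: z_gate_def zs_def)

section \<open>Hadamard layers\<close>

definition h_gate :: "'w \<Rightarrow> 'w gate" where
  "h_gate q = ({q}, \<lambda>x y. psign (x \<inter> y) / complex_of_real (sqrt 2))"

lemma unitary_h_gate: "unitary_mat (fst (h_gate q)) (snd (h_gate q))"
proof -
  have "complex_of_real (sqrt 2) * complex_of_real (sqrt 2) = 2"
    by (simp flip: of_real_mult)
  then show ?thesis
    by (auto simp: unitary_mat_def h_gate_def Pow_insert subset_singleton_iff psign_def divide_simps)
qed

lemma app_h_gate: "app (h_gate q) \<psi> = scale (1 / complex_of_real (sqrt 2)) (hs {q} \<psi>)"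
proof
  fix x
  have "psign (x \<inter> {q} \<inter> y) / complex_of_real (sqrt 2) * \<psi> ((x - {q}) \<union> y)
     = 1 / complex_of_real (sqrt 2) * (psign (x \<inter> y) * \<psi> ((x - {q}) \<union> y))" if "y \<in> Pow {q}" for y
    using that by (auto simp: subset_singleton_iff)
  then show "app (h_gate q) \<psi> x = scale (1 / complex_of_real (sqrt 2)) (hs {q} \<psi>) x"
    unfolding app_def h_gate_def fst_conv snd_conv scale_def hs_def sum_distrib_left
    by (intro sum.cong) auto
qed

lemma hs_insert:
  assumes "finite A" "q \<notin> A"
  shows "hs A (hs {q} \<psi>) = hs (insert q A) \<psi>"
proof
  fix x
  have "hs A (hs {q} \<psi>) x = (\<Sum>y\<in>Pow A. \<Sum>w\<in>Pow {q}.
      psign (x \<inter> y) * (psign (((x - A) \<union> y) \<inter> w) * \<psi> ((((x - A) \<union> y) - {q}) \<union> w)))"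
    by (simp add: hs_def sum_distrib_left)
  also have "\<dots> = (\<Sum>y\<in>Pow A. \<Sum>w\<in>Pow {q}. psign (x \<inter> (y \<union> w)) * \<psi> ((x - insert q A) \<union> (y \<union> w)))"
  proof (intro sum.cong refl)
    fix y w assume yw: "y \<in> Pow A" "w \<in> Pow {q}"
    have f: "finite y" "finite w" using yw assms finite_subset by auto
    have "psign (x \<inter> (y \<union> w)) = psign ((x \<inter> y) \<union> (x \<inter> w))" by (simp add: Int_Un_distrib)
    also have "\<dots> = psign (x \<inter> y) * psign (x \<inter> w)"
      using yw assms f by (intro psign_Un_disjoint) auto
    finally have "psign (x \<inter> (y \<union> w)) = psign (x \<inter> y) * psign (x \<inter> w)" .
    moreover have "((x - A) \<union> y) \<inter> w = x \<inter> w" "(((x - A) \<union> y) - {q}) \<union> w = (x - insert q A) \<union> (y \<union> w)"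
      using yw assms by auto
    ultimately show "psign (x \<inter> y) * (psign (((x - A) \<union> y) \<inter> w) * \<psi> ((((x - A) \<union> y) - {q}) \<union> w))
      = psign (x \<inter> (y \<union> w)) * \<psi> ((x - insert q A) \<union> (y \<union> w))" by (simp add: mult.assoc)
  qed
  also have "\<dots> = (\<Sum>(y, w)\<in>Pow A \<times> Pow {q}. psign (x \<inter> (y \<union> w)) * \<psi> ((x - insert q A) \<union> (y \<union> w)))"
    by (rule sum.cartesian_product)
  also have "\<dots> = (\<Sum>u\<in>Pow (insert q A). psign (x \<inter> u) * \<psi> ((x - insert q A) \<union> u))"
    by (rule sum.reindex_bij_witness[where i = "\<lambda>u. (u \<inter> A, u \<inter> {q})" and j = "\<lambda>(y, w). y \<union> w"])
       (use assms in \<open>auto simp: Int_Un_distrib2\<close>)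
  finally show "hs A (hs {q} \<psi>) x = hs (insert q A) \<psi> x" by (simp add: hs_def)
qed

lemma hs_scale: "hs A (scale c \<psi>) = scale c (hs A \<psi>)"
  by (auto simp: hs_def scale_def sum_distrib_left fun_eq_iff mult.left_commute)

lemma reach_hs:
  fixes F :: "'i \<Rightarrow> 'w ket"
  assumes fin: "finite A" and A: "A \<subseteq> W"
  shows "reach W 1 F (\<lambda>a. hs A (F a))"
proof (rule reach_layer[OF fin, where g = h_gate and c = "1 / complex_of_real (sqrt 2)"])
  fix p assume "p \<in> A"
  then show "card (fst (h_gate p)) \<in> {1, 2} \<and> fst (h_gate p) \<subseteq> W
      \<and> unitary_mat (fst (h_gate p)) (snd (h_gate p))"
    using A unitary_h_gate by (auto simp: h_gate_def)
next
  fix p T and \<psi> :: "'w ket" assume T: "insert p T \<subseteq> A" "p \<notin> T"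
  have "finite T" by (rule finite_subset[OF _ fin]) (use T in auto)
  then show "hs T (app (h_gate p) \<psi>) = scale (1 / complex_of_real (sqrt 2)) (hs (insert p T) \<psi>)"
    using T by (simp add: app_h_gate hs_scale hs_insert)
qed (auto simp: h_gate_def hs_def)

section \<open>Realization by circuits\<close>

text \<open>The pattern of \<open>jw_encode\<close>, with \<open>\<iota>\<close> in the role of the
  mode positions: all qubits outside the image of \<open>\<iota>\<close> are in the state 0.\<close>

definition push :: "('w \<Rightarrow> nat) \<Rightarrow> 'w set \<Rightarrow> 'w ket \<Rightarrow> nat ket" where
  "push \<iota> W \<psi> = (\<lambda>x. if x \<subseteq> \<iota> ` W then \<psi> {w \<in> W. \<iota> w \<in> x} else 0)"

definition instr_of :: "('w \<Rightarrow> nat) \<Rightarrow> 'w gate \<Rightarrow> instr" where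
  "instr_of \<iota> g = Gate (\<iota> ` fst g) (\<lambda>x y. snd g {w \<in> fst g. \<iota> w \<in> x} {w \<in> fst g. \<iota> w \<in> y})"

lemma image_back: "inj_on \<iota> W \<Longrightarrow> S \<subseteq> W \<Longrightarrow> X \<subseteq> W \<Longrightarrow> {w \<in> S. \<iota> w \<in> \<iota> ` X} = S \<inter> X"
proof (rule set_eqI)
  fix w assume a: "inj_on \<iota> W" "S \<subseteq> W" "X \<subseteq> W"
  show "w \<in> {w \<in> S. \<iota> w \<in> \<iota> ` X} \<longleftrightarrow> w \<in> S \<inter> X"
    using inj_on_image_mem_iff[OF a(1) _ a(3), of w] a(2) by (cases "w \<in> S") auto
qed

lemma push_image: "inj_on \<iota> W \<Longrightarrow> X \<subseteq> W \<Longrightarrow> push \<iota> W \<psi> (\<iota> ` X) = \<psi> X"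
  by (simp add: push_def image_mono image_back inf.absorb2)

lemma sum_Pow_image:
  assumes "inj_on \<iota> S"
  shows "(\<Sum>y\<in>Pow (\<iota> ` S). f y) = (\<Sum>y\<in>Pow S. f (\<iota> ` y))"
proof -
  have "Pow (\<iota> ` S) = image \<iota> ` Pow S" by (simp add: image_Pow_surj)
  moreover have "inj_on (image \<iota>) (Pow S)" using assms by (rule inj_on_image_Pow)
  ultimately show ?thesis by (simp add: sum.reindex)
qed

lemma apply_instr_of:
  assumes \<iota>: "inj_on \<iota> W" and S: "fst g \<subseteq> W"
  shows "apply_instr r (instr_of \<iota> g) (push \<iota> W \<psi>) = push \<iota> W (app g \<psi>)"
proof
  fix x
  let ?S = "fst g"
  have inS: "inj_on \<iota> ?S" using \<iota> S inj_on_subset by blast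
  have L: "apply_instr r (instr_of \<iota> g) (push \<iota> W \<psi>) x =
     (\<Sum>y\<in>Pow ?S. snd g {w \<in> ?S. \<iota> w \<in> x \<inter> \<iota> ` ?S} {w \<in> ?S. \<iota> w \<in> \<iota> ` y} * push \<iota> W \<psi> ((x - \<iota> ` ?S) \<union> \<iota> ` y))"
    by (simp add: instr_of_def sum_Pow_image[OF inS])
  show "apply_instr r (instr_of \<iota> g) (push \<iota> W \<psi>) x = push \<iota> W (app g \<psi>) x"
  proof (cases "x \<subseteq> \<iota> ` W")
    case False
    then have "\<not> (x - \<iota> ` ?S) \<union> \<iota> ` y \<subseteq> \<iota> ` W" for y using S by blast
    then have "push \<iota> W \<psi> ((x - \<iota> ` ?S) \<union> \<iota> ` y) = 0" for y unfolding push_def by (simp only: if_False)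
    then show ?thesis unfolding L using False by (simp add: push_def)
  next
    case True
    then obtain X where X: "X \<subseteq> W" "x = \<iota> ` X" by (auto simp: subset_image_iff)
    have "snd g {w \<in> ?S. \<iota> w \<in> x \<inter> \<iota> ` ?S} {w \<in> ?S. \<iota> w \<in> \<iota> ` y} * push \<iota> W \<psi> ((x - \<iota> ` ?S) \<union> \<iota> ` y)
       = snd g (X \<inter> ?S) y * \<psi> ((X - ?S) \<union> y)" if y: "y \<subseteq> ?S" for y
    proof -
      have "{w \<in> ?S. \<iota> w \<in> x \<inter> \<iota> ` ?S} = X \<inter> ?S" using image_back[OF \<iota> S X(1)] X(2) by blast
      moreover have "{w \<in> ?S. \<iota> w \<in> \<iota> ` y} = y" using image_back[OF inS subset_refl y] y by blast
      moreover have "(x - \<iota> ` ?S) \<union> \<iota> ` y = \<iota> ` ((X - ?S) \<union> y)"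
      proof -
        have "\<iota> ` (X - ?S) = \<iota> ` X - \<iota> ` ?S"
          by (rule inj_on_image_set_diff[OF \<iota>]) (use X S in auto)
        then show ?thesis by (simp only: image_Un X(2))
      qed
      moreover have "(X - ?S) \<union> y \<subseteq> W" using X S y by auto
      ultimately show ?thesis using \<iota> by (simp add: push_image)
    qed
    then have "apply_instr r (instr_of \<iota> g) (push \<iota> W \<psi>) x = app g \<psi> X"
      unfolding L app_def by (intro sum.cong refl) blast
    then show ?thesis by (simp add: X(2) push_image[OF \<iota> X(1)])
  qed
qed

lemma fold_instr_of:
  assumes "inj_on \<iota> W" "\<forall>g\<in>set gs. fst g \<subseteq> W"
  shows "fold (apply_instr r) (map (instr_of \<iota>) gs) (push \<iota> W \<psi>) = push \<iota> W (fold app gs \<psi>)"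
  using assms(2) by (induction gs arbitrary: \<psi>) (auto simp: apply_instr_of[OF assms(1)])

lemma fold_measure:
  "fold (apply_instr r) (map Measure qs) \<psi> = (\<lambda>x. if \<forall>q\<in>set qs. q \<in> x \<longleftrightarrow> q \<in> r then \<psi> x else 0)"
  by (induction qs arbitrary: \<psi>) (auto simp: fun_eq_iff)

lemma push_proj:
  assumes "inj_on \<iota> W" "A \<subseteq> W"
  shows "(\<lambda>x. if \<forall>q\<in>\<iota> ` A. q \<in> x \<longleftrightarrow> q \<in> r then push \<iota> W \<psi> x else 0)
    = push \<iota> W (proj A {w \<in> A. \<iota> w \<in> r} \<psi>)"
  using assms by (auto simp: push_def proj_def fun_eq_iff)

lemma unitary_on_instr_of:
  assumes \<iota>: "inj_on \<iota> (fst g)" and U: "unitary_mat (fst g) (snd g)"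
  shows "unitary_on (\<iota> ` fst g) (\<lambda>x y. snd g {w \<in> fst g. \<iota> w \<in> x} {w \<in> fst g. \<iota> w \<in> y})"
  unfolding unitary_on_def
proof (intro ballI)
  let ?S = "fst g"
  fix x y assume "x \<in> Pow (\<iota> ` ?S)" "y \<in> Pow (\<iota> ` ?S)"
  then obtain X Y where XY: "X \<subseteq> ?S" "x = \<iota> ` X" "Y \<subseteq> ?S" "y = \<iota> ` Y"
    by (auto simp: subset_image_iff)
  have b: "{w \<in> ?S. \<iota> w \<in> \<iota> ` Z} = Z" if "Z \<subseteq> ?S" for Z
    using image_back[OF \<iota> subset_refl that] that by blast
  have "x = y \<longleftrightarrow> X = Y" using XY \<iota> inj_on_image_eq_iff by metis
  then show "(\<Sum>z\<in>Pow (\<iota> ` ?S). cnj (snd g {w \<in> ?S. \<iota> w \<in> z} {w \<in> ?S. \<iota> w \<in> x}) *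
      snd g {w \<in> ?S. \<iota> w \<in> z} {w \<in> ?S. \<iota> w \<in> y}) = (if x = y then 1 else 0)"
    using U XY unfolding sum_Pow_image[OF \<iota>] by (simp add: b unitary_mat_def)
qed

lemma valid_layer_instr_of:
  assumes \<iota>: "inj_on \<iota> W" "\<iota> ` W \<subseteq> Q" and ok: "gates_ok W gs"
  shows "valid_layer Q (map (instr_of \<iota>) gs)"
proof -
  have "valid_instr (instr_of \<iota> g) \<and> instr_qubits (instr_of \<iota> g) \<subseteq> Q" if g: "g \<in> set gs" for g
  proof -
    have S: "fst g \<subseteq> W" "card (fst g) \<in> {1, 2}" "unitary_mat (fst g) (snd g)"
      using ok g by (auto simp: gates_ok_def)
    then have "inj_on \<iota> (fst g)" using \<iota> inj_on_subset by blast
    then show ?thesis using S \<iota> by (auto simp: instr_of_def card_image unitary_on_instr_of)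
  qed
  moreover have "sorted_wrt (\<lambda>g g'. instr_qubits (instr_of \<iota> g) \<inter> instr_qubits (instr_of \<iota> g') = {}) gs"
  proof (rule sorted_wrt_mono_rel)
    show "sorted_wrt (\<lambda>g g'. fst g \<inter> fst g' = {}) gs" using ok by (simp add: gates_ok_def)
    fix g g' assume "g \<in> set gs" "g' \<in> set gs" "fst g \<inter> fst g' = {}"
    moreover have "fst g \<subseteq> W" "fst g' \<subseteq> W" using ok \<open>g \<in> set gs\<close> \<open>g' \<in> set gs\<close> by (auto simp: gates_ok_def)
    ultimately show "instr_qubits (instr_of \<iota> g) \<inter> instr_qubits (instr_of \<iota> g') = {}"
      using \<iota>(1) by (simp add: instr_of_def flip: inj_on_image_Int)
  qed
  ultimately show ?thesis by (auto simp: valid_layer_def sorted_wrt_map)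
qed

text \<open>Histories list the latest outcome first, so the outcome of the layer put in front is
  \<open>last h\<close>, and the circuit that follows sees \<open>butlast h\<close>.\<close>

definition cons_circuit :: "nat \<Rightarrow> layer \<Rightarrow> (nat set \<Rightarrow> circuit) \<Rightarrow> circuit" where
  "cons_circuit d ls cs = Circuit (Suc d) (\<lambda>h. if h = [] then ls else next_layer (cs (last h)) (butlast h))"

lemma run_cons_circuit:
  "run (cons_circuit d ls cs) (h @ [r]) \<psi> = run (cs r) h (fold (apply_instr r) ls \<psi>)"
  by (induction h) (auto simp: cons_circuit_def)

lemma valid_cons_circuit:
  assumes "valid_layer Q ls" "\<And>r. valid_circuit Q (cs r) \<and> depth (cs r) = d"
  shows "valid_circuit Q (cons_circuit d ls cs)"
  unfolding valid_circuit_def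
proof (intro allI impI)
  fix h :: history assume h: "length h < depth (cons_circuit d ls cs)"
  show "valid_layer Q (next_layer (cons_circuit d ls cs) h)"
  proof (cases "h = []")
    case False
    then have "length (butlast h) < d" using h by (cases h) (auto simp: cons_circuit_def)
    then show ?thesis using False assms(2) by (auto simp: cons_circuit_def valid_circuit_def)
  qed (use assms in \<open>simp add: cons_circuit_def\<close>)
qed

text \<open>A derivation of \<open>reach\<close> is a decision tree that branches at measurements;
  the circuits of the branches are glued by choice. Every history of the right length is covered,
  because entries of a recorded outcome outside the measured qubits influence neither the projection
  nor the branch taken.\<close>

theorem reach_circuit:
  assumes "reach W d F H" and \<iota>: "inj_on \<iota> W" "\<iota> ` W \<subseteq> Q" and W: "finite W"
  shows "\<exists>c. valid_circuit Q c \<and> depth c = d \<and>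
     (\<forall>a h. length h = d \<longrightarrow> (\<exists>z. run c h (push \<iota> W (F a)) = scale z (push \<iota> W (H a))))"
  using assms(1)
proof (induction rule: reach.induct)
  case (stop F H)
  have "valid_circuit Q (Circuit 0 (\<lambda>_. []))" by (simp add: valid_circuit_def)
  moreover have "\<exists>z. push \<iota> W (F a) = scale z (push \<iota> W (H a))" for a
  proof -
    obtain z where "F a = scale z (H a)" using stop by blast
    then show ?thesis by (intro exI[of _ z]) (auto simp: push_def scale_def)
  qed
  ultimately show ?case by (intro exI[of _ "Circuit 0 (\<lambda>_. [])"]) auto
next
  case (gates gs d F H)
  from gates.IH obtain c where c: "valid_circuit Q c" "depth c = d"
     "\<And>a h. length h = d \<Longrightarrow> \<exists>z. run c h (push \<iota> W (fold app gs (F a))) = scale z (push \<iota> W (H a))"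
    by auto
  let ?c = "cons_circuit d (map (instr_of \<iota>) gs) (\<lambda>_. c)"
  have "valid_circuit Q ?c"
    by (rule valid_cons_circuit[OF valid_layer_instr_of]) (use gates \<iota> c in auto)
  moreover have "\<exists>z. run ?c h (push \<iota> W (F a)) = scale z (push \<iota> W (H a))" if h: "length h = Suc d" for a h
  proof -
    obtain h' r where h': "h = h' @ [r]" using h by (auto simp: length_Suc_conv_rev)
    have "\<forall>g\<in>set gs. fst g \<subseteq> W" using gates(1) by (auto simp: gates_ok_def)
    then have "run ?c h (push \<iota> W (F a)) = run c h' (push \<iota> W (fold app gs (F a)))"
      using h' \<iota> by (simp add: run_cons_circuit fold_instr_of)
    then show ?thesis using c(3)[of h' a] h h' by simp
  qed
  moreover have "depth ?c = Suc d" by (simp add: cons_circuit_def)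
  ultimately show ?case by (intro exI[of _ ?c]) simp
next
  case (meas A d F H)
  define cs where "cs r = (SOME c. valid_circuit Q c \<and> depth c = d \<and>
     (\<forall>a h. length h = d \<longrightarrow> (\<exists>z. run c h (push \<iota> W (proj A r (F a))) = scale z (push \<iota> W (H a)))))" for r
  have cs: "valid_circuit Q (cs r) \<and> depth (cs r) = d \<and>
     (\<forall>a h. length h = d \<longrightarrow> (\<exists>z. run (cs r) h (push \<iota> W (proj A r (F a))) = scale z (push \<iota> W (H a))))"
    if "r \<subseteq> A" for r
    unfolding cs_def by (rule someI_ex) (rule meas.IH[OF that])
  have finA: "finite A" using meas(1) W finite_subset by blast
  obtain ws where ws: "distinct ws" "set ws = A" using finite_distinct_list[OF finA] by blast
  define ls where "ls = map Measure (map \<iota> ws)"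
  \<comment> \<open>Cutting the recorded outcome down to \<open>A\<close> ensures that every
    history, even an impossible one, selects a branch for which \<open>cs\<close> is
    specified.\<close>
  define cs' where "cs' r = cs {w \<in> A. \<iota> w \<in> r}" for r
  let ?c = "cons_circuit d ls cs'"
  have inA: "inj_on \<iota> A" using \<iota>(1) meas(1) inj_on_subset by blast
  have "sorted_wrt (\<lambda>p q. \<iota> p \<noteq> \<iota> q) ws"
    unfolding sorted_wrt_iff_nth_less
  proof (intro allI impI)
    fix i j assume ij: "i < j" "j < length ws"
    then have "ws ! i \<noteq> ws ! j" "ws ! i \<in> A" "ws ! j \<in> A" using ws by (auto simp: nth_eq_iff_index_eq)
    then show "\<iota> (ws ! i) \<noteq> \<iota> (ws ! j)" using inA by (auto dest: inj_onD)
  qed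
  then have "valid_layer Q ls"
    using ws \<iota> meas(1) by (auto simp: ls_def valid_layer_def sorted_wrt_map)
  moreover have "valid_circuit Q (cs' r) \<and> depth (cs' r) = d" for r
    using cs[of "{w \<in> A. \<iota> w \<in> r}"] by (auto simp: cs'_def)
  ultimately have "valid_circuit Q ?c" by (rule valid_cons_circuit)
  moreover have "\<exists>z. run ?c h (push \<iota> W (F a)) = scale z (push \<iota> W (H a))" if h: "length h = Suc d" for a h
  proof -
    obtain h' r where h': "h = h' @ [r]" using h by (auto simp: length_Suc_conv_rev)
    have "run ?c h (push \<iota> W (F a)) = run (cs' r) h' (fold (apply_instr r) ls (push \<iota> W (F a)))"
      unfolding h' by (rule run_cons_circuit)
    also have "fold (apply_instr r) ls (push \<iota> W (F a)) = push \<iota> W (proj A {w \<in> A. \<iota> w \<in> r} (F a))"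
      unfolding ls_def fold_measure using push_proj[OF \<iota>(1) meas(1), of r "F a"] ws by simp
    finally have "run ?c h (push \<iota> W (F a)) = run (cs' r) h' (push \<iota> W (proj A {w \<in> A. \<iota> w \<in> r} (F a)))" .
    moreover have "\<exists>z. run (cs' r) h' (push \<iota> W (proj A {w \<in> A. \<iota> w \<in> r} (F a))) = scale z (push \<iota> W (H a))"
      using cs[of "{w \<in> A. \<iota> w \<in> r}"] h h' unfolding cs'_def by auto
    ultimately show ?thesis by simp
  qed
  moreover have "depth ?c = Suc d" by (simp add: cons_circuit_def)
  ultimately show ?case by (intro exI[of _ ?c]) simp
qed

section \<open>Prefix parities\<close>

text \<open>\<open>P i\<close> carries the physical mode of site \<open>i\<close> and \<open>B e\<close> is the qubit of edge \<open>e\<close>; \<open>U i\<close> and \<open>V i\<close> are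
  ancillas of site \<open>i\<close>.\<close>

datatype wire = P nat | B "nat set" | U nat | V nat

lemma reach_eq:
  assumes "reach W d F G" "\<And>a x. G a x = G' a x" "d = d'"
  shows "reach W d' F G'"
proof -
  have "G = G'" using assms(2) by (simp add: fun_eq_iff)
  then show ?thesis using assms by simp
qed

definition occ :: "nat set \<Rightarrow> wire set \<Rightarrow> nat set" where
  "occ K x = {k \<in> K. P k \<in> x}"

lemma in_occ [simp]: "k \<in> occ K x \<longleftrightarrow> k \<in> K \<and> P k \<in> x"
  by (simp add: occ_def)

lemma flips_image: "flips ((\<lambda>l. (f l, g l)) ` L) x = g ` {l \<in> L. f l \<in> x}"
  by (auto simp: flips_def)

lemma in_image_ctr [simp]:
  "P k \<in> P ` X \<longleftrightarrow> k \<in> X" "U k \<in> U ` X \<longleftrightarrow> k \<in> X" "V k \<in> V ` X \<longleftrightarrow> k \<in> X" "B e \<in> B ` Y \<longleftrightarrow> e \<in> Y"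
  "P k \<notin> B ` Y" "P k \<notin> U ` X" "P k \<notin> V ` X" "B e \<notin> P ` X" "B e \<notin> U ` X" "B e \<notin> V ` X"
  "U k \<notin> P ` X" "U k \<notin> B ` Y" "U k \<notin> V ` X" "V k \<notin> P ` X" "V k \<notin> B ` Y" "V k \<notin> U ` X"
  by auto

lemma register_eq:
  assumes "X \<subseteq> K"
  shows "x \<inter> U ` K = U ` X \<longleftrightarrow> {l \<in> K. U l \<in> x} = X"
proof
  assume e: "x \<inter> U ` K = U ` X"
  have "l \<in> K \<Longrightarrow> U l \<in> x \<longleftrightarrow> U l \<in> U ` X" for l unfolding e[symmetric] by simp
  then show "{l \<in> K. U l \<in> x} = X" using assms by auto
qed auto

text \<open>Hadamard gates turn qubits in the state 0 into the uniform superposition: only the empty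
  set contributes to the sum, and the amplitude stops depending on these qubits.\<close>

lemma hs_clean:
  assumes "finite A" "\<And>z. \<psi> z \<noteq> 0 \<Longrightarrow> z \<inter> A = {}"
  shows "hs A \<psi> = (\<lambda>x. \<psi> (x - A))"
proof
  fix x
  have "psign (x \<inter> y) * \<psi> (x - A \<union> y) = (if y = {} then \<psi> (x - A) else 0)" if "y \<in> Pow A" for y
  proof (cases "y = {}")
    case False
    then have "\<psi> (x - A \<union> y) = 0" using assms(2)[of "x - A \<union> y"] that by blast
    then show ?thesis using False by simp
  qed simp
  then have "hs A \<psi> x = (\<Sum>y\<in>Pow A. if y = {} then \<psi> (x - A) else 0)"
    unfolding hs_def by (intro sum.cong) auto
  then show "hs A \<psi> x = \<psi> (x - A)" using assms(1) by (simp add: sum.delta)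
qed

text \<open>If the other qubits determine the content \<open>w\<close> of the register, only one
  term of the sum survives, and \<open>w\<close> reappears as a phase that is linear in the register
  bits.\<close>

lemma hs_definite:
  assumes "finite A" "\<And>y. y \<subseteq> A \<Longrightarrow> \<psi> (x - A \<union> y) \<noteq> 0 \<Longrightarrow> y = w" "w \<subseteq> A"
  shows "hs A \<psi> x = psign (x \<inter> w) * \<psi> (x - A \<union> w)"
proof -
  have "hs A \<psi> x = (\<Sum>y\<in>Pow A. if y = w then psign (x \<inter> w) * \<psi> (x - A \<union> w) else 0)"
    unfolding hs_def using assms(2) by (intro sum.cong) auto
  then show ?thesis using assms(1,3) by (simp add: sum.delta)
qed

lemma disjoint_pairs_image:
  assumes "inj_on f L" "inj_on g L" "\<And>k l. k \<in> L \<Longrightarrow> l \<in> L \<Longrightarrow> f k \<noteq> g l"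
  shows "disjoint_pairs ((\<lambda>l. (f l, g l)) ` L)"
  using assms unfolding disjoint_pairs_def inj_on_def by (auto; metis)

text \<open>The sites split into chains, the classes of equal \<open>g\<close>. Prefixes are taken
  inside a chain, so all chains are treated in parallel. In the application, \<open>g\<close> is the
  part of the new position formed by the binary digits above the current one.\<close>

locale chain =
  fixes K :: "nat set" and g :: "nat \<Rightarrow> nat"
  assumes fin: "finite K"
begin

definition pre :: "nat \<Rightarrow> nat set" where
  "pre l = {k \<in> K. k < l \<and> g k = g l}"

definition prev :: "nat \<Rightarrow> nat" where
  "prev l = Max (pre l)"

definition succs :: "nat set" where
  "succs = {l \<in> K. pre l \<noteq> {}}"

definition par :: "nat set \<Rightarrow> nat set \<Rightarrow> nat set" where
  "par A s = {l \<in> K. odd (card (s \<inter> A \<inter> pre l))}"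

text \<open>All check bits vanish iff \<open>u\<close> satisfies the recursion
  \<open>par_rec\<close> of the prefix parities. Each check bit involves at most two register bits
  and one occupation, so the whole system is tested in constant depth, although its solution is a
  long-range quantity.\<close>

definition chk :: "nat set \<Rightarrow> nat set \<Rightarrow> nat set \<Rightarrow> nat set" where
  "chk A u s = {l \<in> K. (l \<in> u) \<noteq> ((l \<in> succs \<and> prev l \<in> u) \<noteq> (l \<in> succs \<and> prev l \<in> A \<and> prev l \<in> s))}"

lemma finite_pre [simp]: "finite (pre l)"
  using fin by (simp add: pre_def)

lemma prev_in: "l \<in> succs \<Longrightarrow> prev l \<in> pre l"
  unfolding prev_def succs_def by (simp add: Max_in)

lemma prev_props: "l \<in> succs \<Longrightarrow> prev l \<in> K \<and> prev l < l \<and> g (prev l) = g l"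
  using prev_in by (force simp: pre_def)

lemma pre_prev: "l \<in> succs \<Longrightarrow> pre l = insert (prev l) (pre (prev l))"
proof -
  assume l: "l \<in> succs"
  have "k \<le> prev l" if "k \<in> pre l" for k unfolding prev_def using that by simp
  then show ?thesis using prev_props[OF l] by (force simp: pre_def)
qed

lemma prev_notin [simp]: "k \<notin> pre k"
  by (simp add: pre_def)

lemma inj_prev: "inj_on prev succs"
proof -
  have *: "\<not> l < l'" if l: "l \<in> succs" "l' \<in> succs" "prev l = prev l'" for l l'
  proof
    assume "l < l'"
    moreover have "l \<in> K" using l by (simp add: succs_def)
    moreover have "g l = g l'" using prev_props[OF l(1)] prev_props[OF l(2)] l(3) by simp
    ultimately have "l \<in> pre l'" by (simp add: pre_def)
    then have "l \<le> prev l'" unfolding prev_def by simp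
    then show False using prev_props[OF l(1)] l(3) by simp
  qed
  show ?thesis
    by (rule inj_onI) (metis * linorder_neqE_nat)
qed

lemma par_rec:
  assumes "l \<in> K"
  shows "l \<in> par A s \<longleftrightarrow> l \<in> succs \<and> ((prev l \<in> par A s) \<noteq> (prev l \<in> A \<and> prev l \<in> s))"
proof (cases "l \<in> succs")
  case True
  have "s \<inter> A \<inter> insert k X = (if k \<in> s \<inter> A then insert k (s \<inter> A \<inter> X) else s \<inter> A \<inter> X)" for k X by auto
  then have "card (s \<inter> A \<inter> pre l) = (if prev l \<in> s \<inter> A then 1 else 0) + card (s \<inter> A \<inter> pre (prev l))"
    unfolding pre_prev[OF True] by simp
  then show ?thesis using True assms prev_props[OF True] by (auto simp: par_def)
qed (use assms in \<open>auto simp: succs_def par_def\<close>)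

text \<open>The system is triangular along every chain, hence uniquely solvable for every right-hand
  side. The deviation \<open>c\<close> from the wanted parities depends on the outcome
  \<open>r\<close> alone and not on the occupations, so it can be corrected by X gates known
  classically.\<close>

lemma chk_solve:
  assumes r: "r \<subseteq> K"
  shows "\<exists>c\<subseteq>K. \<forall>u s. chk A u s = r \<longleftrightarrow> u \<inter> K = par A s \<ominus> c"
proof -
  \<comment> \<open>The parity of the outcomes up to and including \<open>l\<close> in its chain,
    which solves the recursion with \<open>r\<close> as inhomogeneity.\<close>
  define c where "c = {l \<in> K. odd (card (r \<inter> insert l (pre l)))}"
  have crec: "l \<in> c \<longleftrightarrow> (l \<in> r) \<noteq> (l \<in> succs \<and> prev l \<in> c)" if l: "l \<in> K" for l
  proof -
    have i: "r \<inter> insert k X = (if k \<in> r then insert k (r \<inter> X) else r \<inter> X)" for k X by auto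
    have "card (r \<inter> insert l (pre l)) = (if l \<in> r then 1 else 0) + card (r \<inter> pre l)"
      by (simp add: i)
    moreover have "odd (card (r \<inter> pre l)) \<longleftrightarrow> l \<in> succs \<and> prev l \<in> c"
    proof (cases "l \<in> succs")
      case True
      show ?thesis unfolding pre_prev[OF True] using True prev_props[OF True] by (simp add: c_def)
    qed (use l in \<open>simp add: succs_def\<close>)
    ultimately show ?thesis using l by (auto simp: c_def)
  qed
  have "chk A u s = r \<longleftrightarrow> u \<inter> K = par A s \<ominus> c" for u s
  proof
    assume e: "chk A u s = r"
    have "l \<in> K \<Longrightarrow> l \<in> u \<longleftrightarrow> (l \<in> par A s) \<noteq> (l \<in> c)" for l
    proof (induction l rule: less_induct)
      case (less l)
      have "l \<in> r \<longleftrightarrow> (l \<in> u) \<noteq> ((l \<in> succs \<and> prev l \<in> u) \<noteq> (l \<in> succs \<and> prev l \<in> A \<and> prev l \<in> s))"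
        using less.prems unfolding e[symmetric] by (simp add: chk_def)
      moreover have "l \<in> succs \<Longrightarrow> prev l \<in> u \<longleftrightarrow> (prev l \<in> par A s) \<noteq> (prev l \<in> c)"
        using less.IH prev_props by blast
      ultimately show ?case using par_rec[OF less.prems, of A s] crec[OF less.prems] by blast
    qed
    then show "u \<inter> K = par A s \<ominus> c" by (auto simp: par_def c_def)
  next
    assume e: "u \<inter> K = par A s \<ominus> c"
    have u: "l \<in> K \<Longrightarrow> l \<in> u \<longleftrightarrow> (l \<in> par A s) \<noteq> (l \<in> c)" for l
      using e by (metis IntD1 IntI in_sdiff)
    have "l \<in> chk A u s \<longleftrightarrow> l \<in> r" if l: "l \<in> K" for l
    proof -
      have "l \<in> succs \<Longrightarrow> prev l \<in> u \<longleftrightarrow> (prev l \<in> par A s) \<noteq> (prev l \<in> c)"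
        using u prev_props by blast
      then show ?thesis using par_rec[OF l, of A s] crec[OF l] u[OF l] l unfolding chk_def by blast
    qed
    then show "chk A u s = r" using r by (auto simp: chk_def)
  qed
  moreover have "c \<subseteq> K" by (auto simp: c_def)
  ultimately show ?thesis by blast
qed

text \<open>Count the pairs of a site \<open>l\<close> of \<open>r\<close> and an occupied site
  \<open>k\<close> of \<open>A\<close> before it by \<open>k\<close> instead of by \<open>l\<close>.
  So the sign left behind by measuring the parity register in the conjugate basis is a product of Z
  operators on site qubits, known from the outcome.\<close>

lemma par_linear:
  assumes "finite s" "r \<subseteq> K"
  shows "psign (r \<inter> par A s) = psign (s \<inter> {k \<in> A. odd (card {l \<in> r. k \<in> pre l})})"
proof -
  have fr: "finite r" using assms fin finite_subset by blast
  have sg: "psign (X \<inter> C) = (\<Prod>l\<in>X. if l \<in> C then - 1 else 1)" if "finite X" for X C :: "nat set"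
    using that by (simp add: prod.If_cases psign_def)
  have "psign (r \<inter> par A s) = (\<Prod>l\<in>r. if l \<in> par A s then - 1 else 1)" by (rule sg[OF fr])
  also have "\<dots> = (\<Prod>l\<in>r. psign (s \<inter> A \<inter> pre l))"
    using assms by (intro prod.cong) (auto simp: par_def psign_def minus_one_power_iff)
  also have "\<dots> = psign (Sigma r (\<lambda>l. s \<inter> A \<inter> pre l))"
    using fr by (simp add: psign_Sigma)
  also have "\<dots> = psign ((\<lambda>(l, k). (k, l)) ` Sigma r (\<lambda>l. s \<inter> A \<inter> pre l))"
    by (rule psign_image[symmetric]) (auto simp: inj_on_def)
  also have "(\<lambda>(l, k). (k, l)) ` Sigma r (\<lambda>l. s \<inter> A \<inter> pre l) = Sigma (s \<inter> A) (\<lambda>k. {l \<in> r. k \<in> pre l})"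
    by force
  also have "psign \<dots> = (\<Prod>k\<in>s \<inter> A. psign {l \<in> r. k \<in> pre l})"
    using assms fr by (intro psign_Sigma) auto
  also have "\<dots> = (\<Prod>k\<in>s \<inter> A. if k \<in> {k. odd (card {l \<in> r. k \<in> pre l})} then - 1 else 1)"
    by (intro prod.cong) (auto simp: psign_def minus_one_power_iff)
  also have "\<dots> = psign (s \<inter> A \<inter> {k. odd (card {l \<in> r. k \<in> pre l})})"
    by (rule sg[symmetric]) (use assms in auto)
  also have "s \<inter> A \<inter> {k. odd (card {l \<in> r. k \<in> pre l})} = s \<inter> {k \<in> A. odd (card {l \<in> r. k \<in> pre l})}" by auto
  finally show ?thesis .
qed

lemma reach_check:
  assumes W: "P ` K \<union> U ` K \<union> V ` K \<subseteq> W" and A: "A \<subseteq> K"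
    and clean: "\<And>a x. F a x \<noteq> 0 \<Longrightarrow> x \<inter> (U ` K \<union> V ` K) = {}"
  shows "reach W 4 F (\<lambda>a x. F a ((x - U ` K) \<ominus> V ` chk A {l \<in> K. U l \<in> x} (occ K x)))"
proof -
  \<comment> \<open>The check bit of \<open>l\<close> is accumulated in \<open>V l\<close> by three
    layers of CNOTs: from its own register bit, from that of its predecessor, and from the
    occupation of the predecessor if it lies in \<open>A\<close>. Injectivity of \<open>prev\<close>
    makes the pairs of a layer disjoint.\<close>
  define R1 where "R1 = (\<lambda>l. (U l, V l)) ` K"
  define R2 where "R2 = (\<lambda>l. (U (prev l), V l)) ` succs"
  define R3 where "R3 = (\<lambda>l. (P (prev l), V l)) ` {l \<in> succs. prev l \<in> A}"
  have sK: "succs \<subseteq> K" by (auto simp: succs_def)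
  then have fs: "finite succs" using fin finite_subset by blast
  have pK: "prev ` succs \<subseteq> K" using prev_props by auto
  have ip: "inj_on (\<lambda>l. U (prev l)) succs" "inj_on (\<lambda>l. P (prev l)) {l \<in> succs. prev l \<in> A}"
    using inj_prev by (auto simp: inj_on_def)
  have d: "disjoint_pairs R1" "disjoint_pairs R2" "disjoint_pairs R3"
    unfolding R1_def R2_def R3_def
    by (intro disjoint_pairs_image ip; auto simp: inj_on_def)+
  have f: "finite R1" "finite R2" "finite R3" unfolding R1_def R2_def R3_def using fin fs by auto
  have w: "fst ` R1 \<union> snd ` R1 \<subseteq> W" "fst ` R2 \<union> snd ` R2 \<subseteq> W" "fst ` R3 \<union> snd ` R3 \<subseteq> W"
    unfolding R1_def R2_def R3_def using W sK pK by (auto simp: image_subset_iff)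
  have G1: "hs (U ` K) (F a) = (\<lambda>x. F a (x - U ` K))" for a
    by (rule hs_clean) (use fin clean in auto)
  have "reach W (1 + (1 + (1 + 1))) F (\<lambda>a. cnots R3 (cnots R2 (cnots R1 (hs (U ` K) (F a)))))"
  proof (rule reach_trans)
    show "reach W 1 F (\<lambda>a. hs (U ` K) (F a))" by (rule reach_hs) (use W fin in auto)
    show "reach W (1 + (1 + 1)) (\<lambda>a. hs (U ` K) (F a)) (\<lambda>a. cnots R3 (cnots R2 (cnots R1 (hs (U ` K) (F a)))))"
      by (rule reach_trans[OF reach_cnots[OF f(1) d(1) w(1)]],
          rule reach_trans[OF reach_cnots[OF f(2) d(2) w(2)]], rule reach_cnots[OF f(3) d(3) w(3)])
  qed
  moreover have "cnots R3 (cnots R2 (cnots R1 (hs (U ` K) (F a)))) x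
    = F a ((x - U ` K) \<ominus> V ` chk A {l \<in> K. U l \<in> x} (occ K x))" for a x
  proof -
    \<comment> \<open>Amplitudes are pulled back, so the layer executed last is the first to act on
      the argument.\<close>
    define y where "y = x \<ominus> flips R3 x"
    define z where "z = y \<ominus> flips R2 y"
    have f3: "flips R3 x = V ` {l \<in> {l \<in> succs. prev l \<in> A}. P (prev l) \<in> x}" unfolding R3_def by (rule flips_image)
    have f2: "flips R2 y = V ` {l \<in> succs. U (prev l) \<in> x}"
      unfolding R2_def by (simp add: flips_image y_def f3)
    have f1: "flips R1 z = V ` {l \<in> K. U l \<in> x}"
    proof -
      have "U l \<in> z \<longleftrightarrow> U l \<in> x" for l unfolding z_def f2 unfolding y_def f3 by auto
      then show ?thesis unfolding R1_def flips_image by simp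
    qed
    have "cnots R3 (cnots R2 (cnots R1 (hs (U ` K) (F a)))) x = F a ((z \<ominus> flips R1 z) - U ` K)"
      unfolding cnots_def y_def z_def G1 ..
    also have "(z \<ominus> flips R1 z) - U ` K = (x - U ` K) \<ominus> V ` chk A {l \<in> K. U l \<in> x} (occ K x)"
    proof (rule set_eqI)
      fix w
      show "w \<in> (z \<ominus> flips R1 z) - U ` K \<longleftrightarrow> w \<in> (x - U ` K) \<ominus> V ` chk A {l \<in> K. U l \<in> x} (occ K x)"
      proof (cases w)
        case (V l)
        have "l \<in> succs \<Longrightarrow> prev l \<in> K" "l \<in> succs \<Longrightarrow> l \<in> K" using pK sK by auto
        then show ?thesis unfolding f1 unfolding z_def f2 unfolding y_def f3 V by (simp add: chk_def) blast
      qed (unfold f1, unfold z_def f2, unfold y_def f3, auto)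
    qed
    finally show ?thesis .
  qed
  ultimately show ?thesis by (rule reach_eq) simp
qed

text \<open>The prefix parities are prepared in constant depth: the register \<open>U\<close> starts in the uniform
  superposition, the parities of consecutive prefixes are measured, and the unique solution of the
  resulting linear system is shifted to the desired one.  The register is removed again by a
  measurement in the conjugate basis, whose random sign is linear in the occupations.\<close>

lemma reach_prefix_phase:
  assumes W: "P ` K \<union> U ` K \<union> V ` K \<subseteq> W" and A: "A \<subseteq> K" and T: "T \<subseteq> K"
    and clean: "\<And>a x. F a x \<noteq> 0 \<Longrightarrow> x \<inter> (U ` K \<union> V ` K) = {}"
  shows "reach W 11 F (\<lambda>a x. psign (par A (occ K x) \<inter> T \<inter> occ K x) * F a x)"
proof -
  \<comment> \<open>In \<open>G6\<close> the register \<open>U\<close> holds the prefix parities and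
    \<open>V\<close> is clear again. In \<open>G7\<close>, CZ gates between \<open>U l\<close> and
    \<open>P l\<close> for \<open>l\<close> in \<open>T\<close> have added the phase; what remains
    is to remove the register.\<close>
  define G6 where "G6 a x = (if x \<inter> V ` K = {} \<and> x \<inter> U ` K = U ` par A (occ K x) then F a (x - U ` K) else 0)" for a x
  define G7 where "G7 a x = psign (par A (occ K x) \<inter> T \<inter> occ K x) * G6 a x" for a x
  define H where "H a x = psign (par A (occ K x) \<inter> T \<inter> occ K x) * F a x" for a x
  have fo: "finite (occ K x)" for x using fin by (simp add: occ_def)
  have pK: "par A s \<subseteq> K" for s by (auto simp: par_def)
  \<comment> \<open>For the outcome \<open>r\<close> of the conjugate measurement, X gates on
    \<open>r\<close> reset \<open>U\<close>, and Z gates on the sites \<open>z\<close> given by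
    \<open>par_linear\<close> cancel the sign.\<close>
  have last: "reach W 2 (\<lambda>a. proj (U ` K) r (hs (U ` K) (G7 a))) H" if r: "r \<subseteq> U ` K" for r
  proof -
    obtain r' where r': "r' \<subseteq> K" "r = U ` r'" using r by (auto simp: subset_image_iff)
    define z where "z = {k \<in> A. odd (card {l \<in> r'. k \<in> pre l})}"
    have zK: "z \<subseteq> K" using A by (auto simp: z_def)
    have "reach W (1 + 1) (\<lambda>a. proj (U ` K) r (hs (U ` K) (G7 a)))
       (\<lambda>a. zs (P ` z) (xs r (proj (U ` K) r (hs (U ` K) (G7 a)))))"
      by (rule reach_trans[OF reach_xs reach_zs])
         (use r W fin zK finite_subset[OF r] finite_subset[OF zK] in auto)
    moreover have "zs (P ` z) (xs r (proj (U ` K) r (hs (U ` K) (G7 a)))) x = H a x" for a x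
    proof -
      have G8: "hs (U ` K) (G7 a) y = psign (y \<inter> U ` par A (occ K y)) *
          (psign (par A (occ K y) \<inter> T \<inter> occ K y) * F a (y - U ` K))" for y
      proof -
        have o: "occ K (y - U ` K \<union> w) = occ K y" if "w \<subseteq> U ` K" for w using that by (auto simp: occ_def)
        have "hs (U ` K) (G7 a) y = psign (y \<inter> U ` par A (occ K y)) * G7 a (y - U ` K \<union> U ` par A (occ K y))"
        proof (rule hs_definite)
          fix w assume w: "w \<subseteq> U ` K" "G7 a (y - U ` K \<union> w) \<noteq> 0"
          then have "(y - U ` K \<union> w) \<inter> U ` K = U ` par A (occ K y)"
            using o[OF w(1)] by (auto simp: G7_def G6_def split: if_splits)
          then show "w = U ` par A (occ K y)" using w(1) by auto
        qed (use fin pK in auto)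
        moreover have "G7 a (y - U ` K \<union> U ` par A (occ K y)) =
            psign (par A (occ K y) \<inter> T \<inter> occ K y) * F a (y - U ` K)"
        proof -
          have p: "U ` par A (occ K y) \<subseteq> U ` K" using pK by auto
          have e: "(y - U ` K \<union> U ` par A (occ K y)) - U ` K = y - U ` K"
            "(y - U ` K \<union> U ` par A (occ K y)) \<inter> U ` K = U ` par A (occ K y)"
            "(y - U ` K \<union> U ` par A (occ K y)) \<inter> V ` K = y \<inter> V ` K" using p by auto
          have "F a (y - U ` K) = 0" if "y \<inter> V ` K \<noteq> {}"
            using clean[of a "y - U ` K"] that by auto
          then show ?thesis unfolding G7_def G6_def o[OF p] e by auto
        qed
        ultimately show ?thesis by simp
      qed
      have o: "occ K (x \<ominus> r) = occ K x" using r by (auto simp: occ_def)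
      have X: "xs r (proj (U ` K) r (hs (U ` K) (G7 a))) x = psign (r' \<inter> par A (occ K x)) * H a x"
      proof (cases "x \<inter> U ` K = {}")
        case True
        have e: "(x \<ominus> r) \<inter> U ` K = r" "(x \<ominus> r) - U ` K = x"
        proof -
          have "w \<notin> x" if "w \<in> U ` K" for w using True that by blast
          then show "(x \<ominus> r) \<inter> U ` K = r" "(x \<ominus> r) - U ` K = x" using r by auto
        qed
        have "(x \<ominus> r) \<inter> U ` par A (occ K x) = U ` (r' \<inter> par A (occ K x))"
        proof -
          have "U l \<notin> x" if "l \<in> K" for l using True imageI[OF that, of U] by blast
          then show ?thesis using r' pK[of "occ K x"] by auto
        qed
        then have "psign ((x \<ominus> r) \<inter> U ` par A (occ K x)) = psign (r' \<inter> par A (occ K x))"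
          by (simp add: psign_image inj_on_def)
        then show ?thesis unfolding xs_def proj_def G8 o by (simp add: e H_def)
      next
        case False
        then have "(x \<ominus> r) \<inter> U ` K \<noteq> r" using r by auto
        moreover have "F a x = 0" using clean False by blast
        ultimately show ?thesis by (simp add: xs_def proj_def H_def)
      qed
      have "x \<inter> P ` z = P ` (occ K x \<inter> z)" using zK by auto
      then have "psign (x \<inter> P ` z) = psign (occ K x \<inter> z)" by (simp add: psign_image inj_on_def)
      also have "\<dots> = psign (r' \<inter> par A (occ K x))"
        unfolding z_def by (rule par_linear[OF fo r'(1), symmetric])
      finally show ?thesis unfolding zs_def X by simp
    qed
    ultimately show ?thesis by (rule reach_eq) simp
  qed
  have mid: "reach W (1 + (1 + Suc 2)) G6 H"
  proof -
    define R where "R = (\<lambda>l. (U l, P l)) ` T"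
    have fT: "finite T" using T fin finite_subset by blast
    have "reach W 1 G6 (\<lambda>a. czs R (G6 a))"
    proof (rule reach_czs)
      show "finite R" "disjoint_pairs R"
        unfolding R_def using fT by (auto intro!: disjoint_pairs_image simp: inj_on_def)
      have "U ` T \<subseteq> W" "P ` T \<subseteq> W" using T W by blast+
      then show "fst ` R \<union> snd ` R \<subseteq> W" unfolding R_def by (simp add: image_image)
    qed
    moreover have "czs R (G6 a) x = G7 a x" for a x
    proof (cases "G6 a x = 0")
      case False
      then have e: "x \<inter> U ` K = U ` par A (occ K x)" by (auto simp: G6_def split: if_splits)
      have u: "U l \<in> x \<longleftrightarrow> l \<in> par A (occ K x)" if "l \<in> K" for l
        using e that unfolding register_eq[OF pK] by blast
      have "{p \<in> R. fst p \<in> x \<and> snd p \<in> x} = (\<lambda>l. (U l, P l)) ` (par A (occ K x) \<inter> T \<inter> occ K x)"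
      proof (rule set_eqI)
        fix p
        show "p \<in> {p \<in> R. fst p \<in> x \<and> snd p \<in> x} \<longleftrightarrow> p \<in> (\<lambda>l. (U l, P l)) ` (par A (occ K x) \<inter> T \<inter> occ K x)"
          (is "?L \<longleftrightarrow> ?R")
        proof
          assume ?L
          then obtain l where l: "l \<in> T" "p = (U l, P l)" "U l \<in> x" "P l \<in> x" by (auto simp: R_def)
          have lK: "l \<in> K" by (rule subsetD[OF T l(1)])
          have "l \<in> par A (occ K x) \<inter> T \<inter> occ K x" using l(1,3,4) u[OF lK] lK by simp
          then show ?R unfolding l(2) by (rule imageI)
        next
          assume ?R
          then obtain l where l: "l \<in> T" "p = (U l, P l)" "l \<in> par A (occ K x)" "l \<in> occ K x" by blast
          have lK: "l \<in> K" by (rule subsetD[OF T l(1)])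
          show ?L unfolding l(2) R_def using l(1,3,4) u[OF lK] by simp
        qed
      qed
      moreover have "inj_on (\<lambda>l. (U l, P l)) (par A (occ K x) \<inter> T \<inter> occ K x)" by (simp add: inj_on_def)
      ultimately have "psign {p \<in> R. fst p \<in> x \<and> snd p \<in> x} = psign (par A (occ K x) \<inter> T \<inter> occ K x)"
        by (simp only: psign_image)
      then show ?thesis unfolding czs_def G7_def by (simp only:)
    qed (simp add: czs_def G7_def)
    ultimately have a: "reach W 1 G6 G7" by (rule reach_eq) simp
    have b: "reach W 1 G7 (\<lambda>a. hs (U ` K) (G7 a))"
      by (rule reach_hs) (use fin W in auto)
    have c: "reach W (Suc 2) (\<lambda>a. hs (U ` K) (G7 a)) H"
      by (rule reach.meas[of "U ` K"]) (use W last in auto)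
    show ?thesis by (rule reach_trans[OF a reach_trans[OF b c]])
  qed
  \<comment> \<open>The 11 layers: 4 for the checks, the measurement of \<open>V\<close>, X
    corrections, CZ gates, Hadamard gates, the measurement of \<open>U\<close>, X and then Z
    corrections.\<close>
  have "reach W (4 + Suc (1 + (1 + (1 + Suc 2)))) F H"
  proof (rule reach_trans[OF reach_check[OF W A clean]], simp)
    show "reach W (Suc (1 + (1 + (1 + Suc 2)))) (\<lambda>a x. F a ((x - U ` K) \<ominus> V ` chk A {l \<in> K. U l \<in> x} (occ K x))) H"
    proof (rule reach.meas[of "V ` K"])
      show "V ` K \<subseteq> W" using W by auto
      fix r assume r: "r \<subseteq> V ` K"
      then obtain r' where r': "r' \<subseteq> K" "r = V ` r'" by (auto simp: subset_image_iff)
      from chk_solve[OF r'(1), of A]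
      obtain c where c: "c \<subseteq> K" and c2: "\<forall>u s. chk A u s = r' \<longleftrightarrow> u \<inter> K = par A s \<ominus> c"
        by (elim exE conjE) (rule that)
      let ?G = "\<lambda>a. proj (V ` K) r (\<lambda>x. F a ((x - U ` K) \<ominus> V ` chk A {l \<in> K. U l \<in> x} (occ K x)))"
      have "xs (U ` c \<union> r) (?G a) x = G6 a x" for a x
      proof -
        define y where "y = x \<ominus> (U ` c \<union> r)"
        have o: "occ K y = occ K x" using r' by (auto simp: y_def)
        have "y \<inter> V ` K = (x \<inter> V ` K) \<ominus> r" unfolding y_def sdiff_Int using r by auto
        then have v: "y \<inter> V ` K = r \<longleftrightarrow> x \<inter> V ` K = {}" by (metis sdiff_empty(2) sdiff_self(1,3))
        have u: "{l \<in> K. U l \<in> y} = {l \<in> K. U l \<in> x} \<ominus> c" unfolding y_def using r' c by auto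
        have "chk A {l \<in> K. U l \<in> y} (occ K y) = r' \<longleftrightarrow> ({l \<in> K. U l \<in> x} \<ominus> c) \<inter> K = par A (occ K x) \<ominus> c"
          by (simp only: c2[rule_format] u o)
        also have "({l \<in> K. U l \<in> x} \<ominus> c) \<inter> K = {l \<in> K. U l \<in> x} \<ominus> c" using c by auto
        also have "{l \<in> K. U l \<in> x} \<ominus> c = par A (occ K x) \<ominus> c \<longleftrightarrow> {l \<in> K. U l \<in> x} = par A (occ K x)"
          by (rule sdiff_right_cancel)
        also have "\<dots> \<longleftrightarrow> x \<inter> U ` K = U ` par A (occ K x)"
          by (rule register_eq[OF pK, symmetric])
        finally have k: "chk A {l \<in> K. U l \<in> y} (occ K y) = r' \<longleftrightarrow> x \<inter> U ` K = U ` par A (occ K x)" .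
        have "xs (U ` c \<union> r) (?G a) x = (if x \<inter> V ` K = {} then F a ((y - U ` K) \<ominus> V ` chk A {l \<in> K. U l \<in> y} (occ K y)) else 0)"
          by (simp only: xs_def proj_def y_def[symmetric] v)
        also have "\<dots> = G6 a x"
        proof (cases "x \<inter> V ` K = {}")
          case True
          have ck: "chk A {l \<in> K. U l \<in> y} (occ K y) \<subseteq> K" by (auto simp: chk_def)
          show ?thesis
          proof (cases "chk A {l \<in> K. U l \<in> y} (occ K y) = r'")
            case eq: True
            have "(y - U ` K) \<ominus> V ` r' = x - U ` K" unfolding y_def using r' subsetD[OF c] by auto
            then show ?thesis using True eq k by (simp add: G6_def)
          next
            case neq: False
            have "((y - U ` K) \<ominus> V ` chk A {l \<in> K. U l \<in> y} (occ K y)) \<inter> V ` K \<noteq> {}"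
            proof -
              obtain l where l: "l \<in> K" "(l \<in> chk A {l \<in> K. U l \<in> y} (occ K y)) \<noteq> (l \<in> r')"
                using neq ck r'(1) by blast
              have "V l \<in> y \<longleftrightarrow> l \<in> r'" unfolding y_def using True l r' by auto
              then have "V l \<in> ((y - U ` K) \<ominus> V ` chk A {l \<in> K. U l \<in> y} (occ K y))" using l(2) by auto
              then show ?thesis using l by blast
            qed
            then have "F a ((y - U ` K) \<ominus> V ` chk A {l \<in> K. U l \<in> y} (occ K y)) = 0"
              using clean by blast
            then show ?thesis using True neq k by (simp add: G6_def)
          qed
        qed (simp add: G6_def)
        finally show ?thesis .
      qed
      then have e: "(\<lambda>a. xs (U ` c \<union> r) (?G a)) = G6" by (simp add: fun_eq_iff)
      have "reach W 1 ?G (\<lambda>a. xs (U ` c \<union> r) (?G a))"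
      proof (rule reach_xs)
        show "finite (U ` c \<union> r)" using finite_subset[OF c fin] finite_subset[OF r] fin by auto
        show "U ` c \<union> r \<subseteq> W" using image_mono[OF c, of U] r W by blast
      qed
      then have "reach W 1 ?G G6" unfolding e .
      then show "reach W (1 + (1 + (1 + Suc 2))) ?G H" by (rule reach_trans[OF _ mid])
    qed
  qed
  then show ?thesis unfolding H_def by simp
qed

end

section \<open>Reordering signs\<close>

text \<open>The inversions that remain when the lowest \<open>d\<close> binary digits of the new
  positions are ignored. For \<open>d = 0\<close> these are the usual ones, and their parity is the
  sign of reordering the fermions in \<open>S\<close>.\<close>

definition invs :: "(nat \<Rightarrow> nat) \<Rightarrow> nat \<Rightarrow> nat set \<Rightarrow> (nat \<times> nat) set" where
  "invs \<sigma> d S = {(k, l). k \<in> S \<and> l \<in> S \<and> k < l \<and> \<sigma> k div 2 ^ d > \<sigma> l div 2 ^ d}"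

abbreviation invsign :: "(nat \<Rightarrow> nat) \<Rightarrow> nat set \<Rightarrow> complex" where
  "invsign \<sigma> S \<equiv> psign (invs \<sigma> 0 S)"

lemma finite_invs [simp]: "finite S \<Longrightarrow> finite (invs \<sigma> d S)"
  by (rule finite_subset[of _ "S \<times> S"]) (auto simp: invs_def)

lemma half_less: "b < (a :: nat) \<longleftrightarrow> b div 2 < a div 2 \<or> (a div 2 = b div 2 \<and> odd a \<and> even b)"
  by (cases "even a"; cases "even b") (auto elim!: evenE oddE)

text \<open>A pair is inverted at exactly one binary digit: the highest at which the values differ.\<close>

lemma invs_step:
  fixes \<sigma> :: "nat \<Rightarrow> nat" and d :: nat
  assumes "finite K" "S \<subseteq> K"
  defines "A \<equiv> {k \<in> K. odd (\<sigma> k div 2 ^ d)}" and "T \<equiv> {k \<in> K. even (\<sigma> k div 2 ^ d)}"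
  shows "psign (invs \<sigma> d S) = psign (chain.par K (\<lambda>k. \<sigma> k div 2 ^ Suc d) A S \<inter> T \<inter> S) * psign (invs \<sigma> (Suc d) S)"
proof -
  interpret chain K "\<lambda>k. \<sigma> k div 2 ^ Suc d" by standard (rule assms(1))
  have fS: "finite S" using assms(1,2) finite_subset by blast
  define Y where "Y = (\<lambda>(l, k). (k, l)) ` Sigma (T \<inter> S) (\<lambda>l. S \<inter> A \<inter> pre l)"
  have d2: "n div 2 ^ Suc d = n div 2 ^ d div 2" for n :: nat
    by (simp only: power_Suc2 div_mult2_eq)
  have "invs \<sigma> d S = Y \<union> invs \<sigma> (Suc d) S"
  proof (rule set_eqI)
    fix p :: "nat \<times> nat"
    obtain k l where p: "p = (k, l)" by (cases p)
    have Y: "p \<in> Y \<longleftrightarrow> l \<in> T \<and> l \<in> S \<and> k \<in> S \<and> k \<in> A \<and> k \<in> pre l" by (auto simp: Y_def p)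
    show "p \<in> invs \<sigma> d S \<longleftrightarrow> p \<in> Y \<union> invs \<sigma> (Suc d) S"
      unfolding Un_iff Y using assms(2) half_less[of "\<sigma> l div 2 ^ d" "\<sigma> k div 2 ^ d"]
      unfolding p invs_def pre_def unfolding d2 A_def T_def by auto
  qed
  moreover have "Y \<inter> invs \<sigma> (Suc d) S = {}"
    unfolding Y_def invs_def pre_def by auto
  moreover have "finite Y" unfolding Y_def using fS by (intro finite_imageI finite_SigmaI) auto
  ultimately have "psign (invs \<sigma> d S) = psign Y * psign (invs \<sigma> (Suc d) S)"
    using fS by (simp add: psign_Un_disjoint)
  moreover have "psign Y = psign (par A S \<inter> T \<inter> S)"
  proof -
    have "psign Y = psign (Sigma (T \<inter> S) (\<lambda>l. S \<inter> A \<inter> pre l))"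
      unfolding Y_def by (rule psign_image) (auto simp: inj_on_def)
    also have "\<dots> = (\<Prod>l\<in>T \<inter> S. psign (S \<inter> A \<inter> pre l))" using fS by (intro psign_Sigma) auto
    also have "\<dots> = (\<Prod>l\<in>T \<inter> S. if l \<in> par A S then - 1 else 1)"
      unfolding par_def using assms(2) by (intro prod.cong) (auto simp: T_def psign_def minus_one_power_iff)
    also have "\<dots> = psign (T \<inter> S \<inter> par A S)" using fS by (simp add: prod.If_cases psign_def)
    finally show ?thesis by (simp add: Int_ac)
  qed
  ultimately show ?thesis by simp
qed

text \<open>With all \<open>L\<close> digits ignored, every quotient is 0 and nothing is inverted.
  The digits are then restored from the highest down, at the price of one prefix phase each.\<close>

lemma reach_invsign:
  assumes fin: "finite K" and W: "P ` K \<union> U ` K \<union> V ` K \<subseteq> W"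
    and clean: "\<And>a x. F a x \<noteq> 0 \<Longrightarrow> x \<inter> (U ` K \<union> V ` K) = {}"
    and L: "\<And>k. k \<in> K \<Longrightarrow> \<sigma> k < 2 ^ L"
  shows "reach W (L * 11) F (\<lambda>a x. invsign \<sigma> (occ K x) * F a x)"
proof -
  have "reach W (L * 11) (\<lambda>a x. psign (invs \<sigma> L (occ K x)) * F a x) (\<lambda>a x. psign (invs \<sigma> 0 (occ K x)) * F a x)"
  proof (rule reach_down)
    fix d
    interpret chain K "\<lambda>k. \<sigma> k div 2 ^ Suc d" by standard (rule fin)
    let ?A = "{k \<in> K. odd (\<sigma> k div 2 ^ d)}" and ?T = "{k \<in> K. even (\<sigma> k div 2 ^ d)}"
    have "reach W 11 (\<lambda>a x. psign (invs \<sigma> (Suc d) (occ K x)) * F a x)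
      (\<lambda>a x. psign (par ?A (occ K x) \<inter> ?T \<inter> occ K x) * (psign (invs \<sigma> (Suc d) (occ K x)) * F a x))"
      by (rule reach_prefix_phase[OF W]) (use clean in auto)
    moreover have "psign (par ?A (occ K x) \<inter> ?T \<inter> occ K x) * (psign (invs \<sigma> (Suc d) (occ K x)) * z)
        = psign (invs \<sigma> d (occ K x)) * z" for x z
    proof -
      have "occ K x \<subseteq> K" by auto
      from invs_step[OF fin this, of \<sigma> d] show ?thesis by (simp only: mult.assoc)
    qed
    ultimately show "reach W 11 (\<lambda>a x. psign (invs \<sigma> (Suc d) (occ K x)) * F a x) (\<lambda>a x. psign (invs \<sigma> d (occ K x)) * F a x)"
      by (simp only:)
  qed
  moreover have "invs \<sigma> L (occ K x) = {}" for x using L by (auto simp: invs_def)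
  ultimately show ?thesis by simp
qed

section \<open>Majorana bilinears of the edges\<close>

abbreviation lo :: "nat set \<Rightarrow> nat" where "lo e \<equiv> Min e"
abbreviation hi :: "nat set \<Rightarrow> nat" where "hi e \<equiv> Max e"

definition inner :: "nat set \<Rightarrow> nat set" where
  "inner e = {lo e<..<hi e}"

text \<open>The bilinear \<open>T e\<close> on amplitudes. In contrast to the hopping term it is a
  Pauli operator and an involution, so products of such operators stay Pauli operators.\<close>

definition flip :: "nat set \<Rightarrow> nat ket \<Rightarrow> nat ket" where
  "flip e \<psi> = (\<lambda>S. psign (S \<inter> inner e) * \<psi> (S \<ominus> e))"

definition edge :: "nat set \<Rightarrow> bool" where
  "edge e \<longleftrightarrow> (\<exists>i j. i < j \<and> e = {i, j})"

lemma edge_eq: "edge e \<Longrightarrow> e = {lo e, hi e}"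
  and edge_less: "edge e \<Longrightarrow> lo e < hi e"
  by (auto simp: edge_def)

lemma edge_finite: "edge e \<Longrightarrow> finite e"
  by (auto simp: edge_def)

lemma in_edge: "edge e \<Longrightarrow> i \<in> e \<longleftrightarrow> i = lo e \<or> i = hi e"
  using edge_eq by blast

lemma finite_inner [simp]: "finite (S \<inter> inner e)" "finite (inner e \<inter> S)" "finite (inner e)"
  by (auto simp: inner_def)

lemma flip_scale: "flip e (scale c \<psi>) = scale c (flip e \<psi>)"
  by (auto simp: flip_def scale_def)

lemma psign_pair:
  assumes "edge e"
  shows "psign (e \<inter> X) = (if (lo e \<in> X) \<noteq> (hi e \<in> X) then - 1 else 1)"
proof -
  have "e \<inter> X = (if lo e \<in> X then {lo e} else {}) \<union> (if hi e \<in> X then {hi e} else {})"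
    using in_edge[OF assms] by auto
  then show ?thesis using edge_less[OF assms] by (auto simp: psign_def)
qed

lemma flip_flip:
  assumes "edge e"
  shows "flip e (flip e \<psi>) = \<psi>"
proof
  fix S
  have "(S \<ominus> e) \<inter> inner e = S \<inter> inner e" using in_edge[OF assms] by (auto simp: inner_def)
  then show "flip e (flip e \<psi>) S = \<psi> S" by (simp add: flip_def)
qed

text \<open>Up to a phase, \<open>T e\<close> is the product of a Majorana operator of one kind at
  \<open>lo e\<close> and one of the other kind at \<open>hi e\<close>. Two such products
  anticommute iff they share exactly one factor; a lower end meeting an upper end costs no
  sign.\<close>

definition kap :: "nat set \<Rightarrow> nat set \<Rightarrow> complex" where
  "kap e f = (if (lo e = lo f) \<noteq> (hi e = hi f) then - 1 else 1)"

lemma flip_commute: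
  assumes "edge e" "edge f"
  shows "flip e (flip f \<psi>) = scale (kap e f) (flip f (flip e \<psi>))"
proof
  fix S
  \<comment> \<open>The pure order statement behind the commutation sign: the parity of the ends of
    one edge inside the other interval changes under exchange of the edges only through coinciding
    ends of the same kind.\<close>
  have n: "((k < i \<and> i < l) \<noteq> (k < j \<and> j < l)) \<longleftrightarrow>
      (((i = k) \<noteq> (j = l)) \<noteq> ((i < k \<and> k < j) \<noteq> (i < l \<and> l < j)))" if "i < j" "k < l" for i j k l :: nat
    using that by linarith
  have p: "psign (e \<inter> inner f) = kap e f * psign (f \<inter> inner e)"
    using n[OF edge_less[OF assms(1)] edge_less[OF assms(2)]]
    unfolding psign_pair[OF assms(1)] psign_pair[OF assms(2)] kap_def inner_def by auto
  have q: "psign ((S \<ominus> g) \<inter> inner h) = psign (S \<inter> inner h) * psign (g \<inter> inner h)" for g h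
    unfolding sdiff_Int by (rule psign_sdiff) auto
  have "flip e (flip f \<psi>) S = psign (S \<inter> inner e) * (psign (S \<inter> inner f) * psign (e \<inter> inner f) * \<psi> (S \<ominus> e \<ominus> f))"
    by (simp add: flip_def q)
  moreover have "flip f (flip e \<psi>) S = psign (S \<inter> inner f) * (psign (S \<inter> inner e) * psign (f \<inter> inner e) * \<psi> (S \<ominus> f \<ominus> e))"
    by (simp add: flip_def q)
  moreover have "S \<ominus> f \<ominus> e = S \<ominus> e \<ominus> f" by auto
  ultimately show "flip e (flip f \<psi>) S = scale (kap e f) (flip f (flip e \<psi>)) S"
    by (simp add: scale_def p)
qed

abbreviation flips_of :: "nat set list \<Rightarrow> nat ket \<Rightarrow> nat ket" where
  "flips_of fs \<psi> \<equiv> foldr flip fs \<psi>"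

lemma flips_of_scale: "flips_of fs (scale c \<psi>) = scale c (flips_of fs \<psi>)"
  by (induction fs) (auto simp: flip_scale)

lemma flips_of_past:
  assumes "edge e" "\<forall>f\<in>set fs. edge f"
  shows "flips_of fs (flip e \<psi>) = scale (prod_list (map (kap e) fs)) (flip e (flips_of fs \<psi>))"
  using assms(2)
proof (induction fs)
  case (Cons f fs)
  have k: "kap f e = kap e f" by (auto simp: kap_def)
  have "flips_of (f # fs) (flip e \<psi>) = scale (prod_list (map (kap e) fs)) (flip f (flip e (flips_of fs \<psi>)))"
    using Cons by (simp add: flip_scale)
  also have "flip f (flip e (flips_of fs \<psi>)) = scale (kap e f) (flip e (flip f (flips_of fs \<psi>)))"
    using flip_commute[of f e] Cons.prems assms(1) by (simp add: k)
  finally show ?case by (simp add: scale_scale mult.commute)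
qed simp

text \<open>The boundary modulo 2 of the edges: the vertices of odd degree, which are the sites
  whose occupation the product of bilinears flips.\<close>

definition bdry :: "nat set list \<Rightarrow> nat set" where
  "bdry fs = foldr (\<ominus>) fs {}"

lemma bdry_simps [simp]: "bdry [] = {}" "bdry (f # fs) = f \<ominus> bdry fs"
  by (auto simp: bdry_def)

lemma bdry_append: "bdry (fs @ gs) = bdry fs \<ominus> bdry gs"
  by (induction fs) (auto simp: sdiff_assoc)

text \<open>A product of Pauli operators is again one, with X part \<open>bdry fs\<close> and Z part
  \<open>Z\<close>. That \<open>\<epsilon>\<close> and \<open>Z\<close> are the same for all states
  is what allows this operator to be undone once the edge qubits have been measured.\<close>

lemma flips_of_pauli:
  assumes "\<forall>f\<in>set fs. edge f"
  shows "\<exists>\<epsilon> Z. \<epsilon> \<noteq> 0 \<and> finite Z \<and> (\<forall>\<psi> S. flips_of fs \<psi> S = \<epsilon> * psign (S \<inter> Z) * \<psi> (S \<ominus> bdry fs))"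
  using assms
proof (induction fs)
  case Nil
  show ?case by (intro exI[of _ 1] exI[of _ "{}"]) simp
next
  case (Cons f fs)
  then obtain \<epsilon> Z where Z: "\<epsilon> \<noteq> 0" "finite Z" "\<And>\<psi> S. flips_of fs \<psi> S = \<epsilon> * psign (S \<inter> Z) * \<psi> (S \<ominus> bdry fs)"
    by auto
  have "flips_of (f # fs) \<psi> S = \<epsilon> * psign (f \<inter> Z) * psign (S \<inter> (inner f \<ominus> Z)) * \<psi> (S \<ominus> bdry (f # fs))" for \<psi> S
  proof -
    have "psign ((S \<ominus> f) \<inter> Z) = psign (S \<inter> Z) * psign (f \<inter> Z)"
      unfolding sdiff_Int by (rule psign_sdiff) (use Z in auto)
    moreover have "psign (S \<inter> (inner f \<ominus> Z)) = psign (S \<inter> inner f) * psign (S \<inter> Z)"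
      unfolding sdiff_Int by (rule psign_sdiff) (use Z in auto)
    ultimately show ?thesis by (simp add: flip_def Z(3) sdiff_assoc)
  qed
  moreover have "\<epsilon> * psign (f \<inter> Z) \<noteq> 0" using Z by simp
  moreover have "finite (inner f \<ominus> Z)" using Z by simp
  ultimately show ?case by blast
qed

section \<open>Colored graphs\<close>

locale colored =
  fixes N :: nat and E :: "nat set set" and \<chi> :: nat and col :: "nat set \<Rightarrow> nat"
  assumes graph: "simple_graph {1..N} E" and proper: "proper_edge_coloring E \<chi> col"
begin

definition K :: "nat set" where "K = {1..N}"

lemma finite_K [simp]: "finite K"
  by (simp add: K_def)

abbreviation Ec :: "nat \<Rightarrow> nat set set" where "Ec \<equiv> color_class E col"

lemma edgeE: "e \<in> E \<Longrightarrow> edge e"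
proof -
  assume "e \<in> E"
  then have "card e = 2" using graph by (auto simp: simple_graph_def)
  then obtain i j where "e = {i, j}" "i \<noteq> j" by (auto simp: card_2_iff)
  then show "edge e" unfolding edge_def by (metis insert_commute linorder_neqE_nat)
qed

lemma edge_K: "e \<in> E \<Longrightarrow> e \<subseteq> K"
  using graph by (auto simp: simple_graph_def K_def)

lemma lo_hi_in: "e \<in> E \<Longrightarrow> lo e \<in> e" "e \<in> E \<Longrightarrow> hi e \<in> e"
  using in_edge edgeE by blast+

lemma lo_hi_K: "e \<in> E \<Longrightarrow> lo e \<in> K" "e \<in> E \<Longrightarrow> hi e \<in> K"
  using lo_hi_in edge_K by blast+

lemma lo_hi_neq: "e \<in> E \<Longrightarrow> lo e \<noteq> hi e"
  using edge_less[OF edgeE] by fastforce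

lemma finite_E: "finite E"
  by (rule finite_subset[of _ "Pow K"]) (use edge_K in auto)

lemma in_Ec: "e \<in> Ec \<alpha> \<longleftrightarrow> e \<in> E \<and> col e = \<alpha>"
  by (simp add: color_class_def)

lemma Ec_E: "Ec \<alpha> \<subseteq> E"
  by (auto simp: in_Ec)

lemma Ec_in: "e \<in> Ec \<alpha> \<Longrightarrow> e \<in> E"
  by (simp add: in_Ec)

lemma finite_Ec [simp]: "finite (Ec \<alpha>)"
  using finite_E Ec_E finite_subset by blast

lemma col_range: "e \<in> E \<Longrightarrow> 1 \<le> col e \<and> col e \<le> \<chi>"
  using proper by (auto simp: proper_edge_coloring_def)

lemma matching: "e \<in> Ec \<alpha> \<Longrightarrow> f \<in> Ec \<alpha> \<Longrightarrow> i \<in> e \<Longrightarrow> i \<in> f \<Longrightarrow> e = f"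
  using proper unfolding proper_edge_coloring_def in_Ec by blast

lemma inj_lo: "inj_on Min (Ec \<alpha>)"
  by (rule inj_onI) (metis Ec_E lo_hi_in(1) matching subsetD)

lemma inj_hi: "inj_on Max (Ec \<alpha>)"
  by (rule inj_onI) (metis Ec_E lo_hi_in(2) matching subsetD)

lemma lo_neq_hi:
  assumes "e \<in> Ec \<alpha>" "f \<in> Ec \<alpha>"
  shows "lo e \<noteq> hi f"
proof
  assume h: "lo e = hi f"
  have E: "e \<in> E" "f \<in> E" using assms Ec_E by auto
  have "lo e \<in> f" unfolding h by (rule lo_hi_in(2)[OF E(2)])
  then have "e = f" by (rule matching[OF assms lo_hi_in(1)[OF E(1)]])
  then show False using lo_hi_neq[OF E(1)] h by simp
qed

text \<open>The order inside a color is arbitrary: the edges are disjoint, so their bilinears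
  commute, and so do their hopping terms.\<close>

definition cl :: "nat \<Rightarrow> nat set list" where
  "cl \<alpha> = (SOME es. distinct es \<and> set es = Ec \<alpha>)"

lemma cl: "distinct (cl \<alpha>)" "set (cl \<alpha>) = Ec \<alpha>"
proof -
  have "\<exists>es. distinct es \<and> set es = Ec \<alpha>" using finite_distinct_list[OF finite_Ec] by blast
  then have "distinct (cl \<alpha>) \<and> set (cl \<alpha>) = Ec \<alpha>" unfolding cl_def by (rule someI_ex)
  then show "distinct (cl \<alpha>)" "set (cl \<alpha>) = Ec \<alpha>" by auto
qed

text \<open>Fixes the order of the factors of \<open>T b\<close>: by color, with the lowest color
  leftmost and so applied last. Encoding the next lower color then amounts to multiplication from
  the left.\<close>

definition above :: "nat \<Rightarrow> nat set list" where
  "above k = concat (map cl [Suc k..<Suc \<chi>])"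

lemma above_Suc: "k < \<chi> \<Longrightarrow> above k = cl (Suc k) @ above (Suc k)"
  unfolding above_def by (subst upt_conv_Cons) auto

lemma above_top: "\<chi> \<le> k \<Longrightarrow> above k = []"
  unfolding above_def by simp

lemma set_above: "set (above k) = {e \<in> E. k < col e}"
proof -
  have "{Suc k..<Suc \<chi>} = {k<..\<chi>}" by auto
  then have "set (above k) = (\<Union>\<alpha>\<in>{k<..\<chi>}. Ec \<alpha>)"
    unfolding above_def by (simp add: cl del: upt_Suc)
  then show ?thesis using col_range by (auto simp: in_Ec)
qed

lemma set_above0: "set (above 0) = E"
proof -
  have "col e \<noteq> 0" if "e \<in> E" for e using col_range[OF that] by simp
  then show ?thesis unfolding set_above by auto
qed

lemma distinct_above: "distinct (above k)"
proof (induction "\<chi> - k" arbitrary: k)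
  case 0
  then show ?case by (simp add: above_top)
next
  case (Suc n)
  then have "distinct (above (Suc k))" by (intro Suc.hyps(1)) simp
  moreover have "set (cl (Suc k)) \<inter> set (above (Suc k)) = {}" unfolding cl(2) set_above in_Ec[abs_def] by (auto simp: in_Ec)
  ultimately show ?case using Suc.hyps(2) cl by (simp add: above_Suc)
qed

lemma edges_above: "f \<in> set (filter Q (above k)) \<Longrightarrow> edge f"
  using set_above edgeE by auto

abbreviation sel :: "nat set set \<Rightarrow> nat \<Rightarrow> nat set list" where
  "sel b k \<equiv> filter (\<lambda>e. e \<in> b) (above k)"

text \<open>The end \<open>q e\<close> of an edge \<open>e\<close> of color \<open>k\<close> contributes a sign when the bilinear of \<open>e\<close> is moved past
  those of the edges in \<open>b\<close> of later colors, iff \<open>q e \<in> late q k b\<close>.\<close>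

definition late :: "(nat set \<Rightarrow> nat) \<Rightarrow> nat \<Rightarrow> nat set set \<Rightarrow> nat set" where
  "late q k b = {i. odd (card {f \<in> E. f \<in> b \<and> k < col f \<and> q f = i})}"

lemma split_above:
  assumes e: "e \<in> E"
  shows "\<exists>ps qs. above 0 = ps @ e # qs @ above (col e) \<and> set qs \<subseteq> Ec (col e)"
proof -
  have c: "1 \<le> col e" "col e \<le> \<chi>" using col_range[OF e] by auto
  have "e \<in> set (cl (col e))" using e cl by (simp add: in_Ec)
  then obtain p q where pq: "cl (col e) = p @ e # q" by (meson split_list)
  have "[Suc 0..<Suc \<chi>] = [Suc 0..<col e] @ [col e..<Suc \<chi>]"
    using c by (metis One_nat_def le_SucI upt_add_eq_append le_iff_add)
  also have "[col e..<Suc \<chi>] = col e # [Suc (col e)..<Suc \<chi>]"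
    using c by (intro upt_conv_Cons) simp
  finally have "above 0 = concat (map cl [Suc 0..<col e]) @ cl (col e) @ above (col e)"
    unfolding above_def by (simp del: upt_Suc)
  moreover have "set q \<subseteq> Ec (col e)" using cl(2)[of "col e"] pq by auto
  ultimately show ?thesis using pq by (intro exI[of _ "concat (map cl [Suc 0..<col e]) @ p"] exI[of _ q]) simp
qed

text \<open>The extra \<open>T e\<close> stands to the right of the whole product and is moved to
  its own place. It passes the rest of its color, which is disjoint from it, without sign, and the
  later colors with one sign per shared lower end and per shared upper end. At its place it either
  cancels its twin or is newly inserted.\<close>

lemma flips_absorb:
  assumes e: "e \<in> E"
  shows "flips_of (sel b 0) (flip e \<psi>) =
    scale ((if lo e \<in> late Min (col e) b then - 1 else 1) * (if hi e \<in> late Max (col e) b then - 1 else 1))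
      (flips_of (sel (b \<ominus> {e}) 0) \<psi>)"
proof -
  obtain ps qs where s: "above 0 = ps @ e # qs @ above (col e)" and qs: "set qs \<subseteq> Ec (col e)"
    using split_above[OF e] by blast
  define post where "post = qs @ above (col e)"
  have s': "above 0 = ps @ e # post" using s by (simp add: post_def)
  have d: "distinct (ps @ e # post)" using distinct_above[of 0] unfolding s' .
  have nb: "filter (\<lambda>f. f \<in> b \<ominus> {e}) xs = filter (\<lambda>f. f \<in> b) xs" if "e \<notin> set xs" for xs
    using that by (intro filter_cong) auto
  have ed: "edge f" if "f \<in> set post" for f
    using that s' set_above0 edgeE by (metis Un_iff list.set_intros(2) set_append)
  have ee: "edge e" using e by (rule edgeE)
  define fs where "fs = filter (\<lambda>f. f \<in> b) post"
  have dfs: "distinct fs" using d by (simp add: fs_def)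
  have k: "prod_list (map (kap e) fs) = (if lo e \<in> late Min (col e) b then - 1 else 1) * (if hi e \<in> late Max (col e) b then - 1 else 1)"
  proof -
    \<comment> \<open>Properness of the coloring: another edge of the color of \<open>e\<close>
      shares no end with it, so only strictly later colors can contribute a sign.\<close>
    have setp: "f \<in> set post \<longleftrightarrow> f \<in> E \<and> col e < col f" if "lo f = lo e \<or> hi f = hi e" "f \<noteq> e" for f
    proof -
      have "f \<notin> Ec (col e)"
      proof
        assume f: "f \<in> Ec (col e)"
        have "e \<in> Ec (col e)" using e by (simp add: in_Ec)
        then show False using f that inj_lo[of "col e"] inj_hi[of "col e"] by (auto dest: inj_onD)
      qed
      then show ?thesis using qs set_above[of "col e"] by (auto simp: post_def)
    qed
    have ne: "e \<notin> set fs" using d by (auto simp: fs_def)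
    have l: "{f \<in> set fs. lo f = lo e} = {f \<in> E. f \<in> b \<and> col e < col f \<and> lo f = lo e}"
      using setp ne by (auto simp: fs_def)
    have h: "{f \<in> set fs. hi f = hi e} = {f \<in> E. f \<in> b \<and> col e < col f \<and> hi f = hi e}"
      using setp ne by (auto simp: fs_def)
    have "prod_list (map (kap e) fs) = (\<Prod>f\<in>set fs. kap e f)"
      using dfs by (simp add: prod.distinct_set_conv_list)
    also have "\<dots> = (\<Prod>f\<in>set fs. (if lo f = lo e then - 1 else 1) * (if hi f = hi e then - 1 else 1))"
      by (intro prod.cong) (auto simp: kap_def)
    also have "\<dots> = psign {f \<in> set fs. lo f = lo e} * psign {f \<in> set fs. hi f = hi e}"
      by (simp add: prod.distrib prod.If_cases psign_def Collect_conj_eq Int_commute)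
    finally show ?thesis unfolding l h by (simp add: late_def psign_def minus_one_power_iff)
  qed
  have "flips_of (sel b 0) (flip e \<psi>) = flips_of (filter (\<lambda>f. f \<in> b) ps)
      (flips_of (if e \<in> b then [e] else []) (flips_of fs (flip e \<psi>)))"
    by (simp add: s' fs_def)
  also have "flips_of fs (flip e \<psi>) = scale (prod_list (map (kap e) fs)) (flip e (flips_of fs \<psi>))"
    by (rule flips_of_past[OF ee]) (use ed in \<open>auto simp: fs_def\<close>)
  also have "flips_of (filter (\<lambda>f. f \<in> b) ps) (flips_of (if e \<in> b then [e] else []) \<dots>)
     = scale (prod_list (map (kap e) fs)) (flips_of (filter (\<lambda>f. f \<in> b) ps)
         (flips_of (if e \<in> b then [e] else []) (flip e (flips_of fs \<psi>))))"
    by (simp only: flips_of_scale)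
  also have "flips_of (if e \<in> b then [e] else []) (flip e (flips_of fs \<psi>)) = flips_of (if e \<in> b then [] else [e]) (flips_of fs \<psi>)"
    by (simp add: flip_flip[OF ee])
  also have "flips_of (filter (\<lambda>f. f \<in> b) ps) (flips_of (if e \<in> b then [] else [e]) (flips_of fs \<psi>)) = flips_of (sel (b \<ominus> {e}) 0) \<psi>"
  proof -
    have "filter (\<lambda>f. f \<in> b \<ominus> {e}) (ps @ e # post) = filter (\<lambda>f. f \<in> b) ps @ (if e \<in> b then [] else [e]) @ fs"
      using d nb[of ps] nb[of post] by (simp add: fs_def)
    then show ?thesis unfolding s' by simp
  qed
  finally show ?thesis unfolding k .
qed

lemma bdry_sel_toggle:
  assumes e: "e \<in> E"
  shows "bdry (sel (b \<ominus> {e}) 0) = bdry (sel b 0) \<ominus> e"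
proof -
  obtain ps qs where s: "above 0 = ps @ e # qs" using split_above[OF e] by blast
  have d: "distinct (ps @ e # qs)" using distinct_above[of 0] unfolding s .
  have nb: "filter (\<lambda>f. f \<in> b \<ominus> {e}) xs = filter (\<lambda>f. f \<in> b) xs" if "e \<notin> set xs" for xs
    using that by (intro filter_cong) auto
  have n: "filter (\<lambda>f. f \<in> b \<ominus> {e}) ps = filter (\<lambda>f. f \<in> b) ps" "filter (\<lambda>f. f \<in> b \<ominus> {e}) qs = filter (\<lambda>f. f \<in> b) qs"
    by (rule nb, use d in simp)+
  show ?thesis unfolding s filter_append filter.simps bdry_append n
    by (cases "e \<in> b") (simp_all add: sdiff_ac)
qed

text \<open>Since \<open>q\<close> is injective on a color class, at most one edge of the class
  contributes at each site. Adding a color therefore toggles one bit per selected edge, which is a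
  layer of CNOTs controlled by the edge qubits.\<close>

lemma late_step:
  assumes "inj_on q (Ec (Suc k))"
  shows "late q k b = late q (Suc k) b \<ominus> q ` {f \<in> Ec (Suc k). f \<in> b}"
proof (rule set_eqI)
  fix i
  let ?A = "{f \<in> E. f \<in> b \<and> Suc k < col f \<and> q f = i}" and ?B = "{f \<in> Ec (Suc k). f \<in> b \<and> q f = i}"
  have u: "{f \<in> E. f \<in> b \<and> k < col f \<and> q f = i} = ?A \<union> ?B" by (auto simp: in_Ec)
  have c: "card {f \<in> E. f \<in> b \<and> k < col f \<and> q f = i} = card ?A + card ?B"
    unfolding u by (rule card_Un_disjoint) (use finite_E in \<open>auto simp: in_Ec\<close>)
  have "odd (card ?B) \<longleftrightarrow> i \<in> q ` {f \<in> Ec (Suc k). f \<in> b}"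
  proof (cases "?B = {}")
    case True
    then have "i \<notin> q ` {f \<in> Ec (Suc k). f \<in> b}" by blast
    moreover have "card ?B = 0" by (simp only: True card.empty)
    ultimately show ?thesis by presburger
  next
    case False
    then obtain f where f: "f \<in> ?B" by blast
    then have "?B = {f}" using assms by (auto dest: inj_onD)
    then have "card ?B = 1" by (simp only: card.insert card.empty finite.emptyI) simp
    moreover have "i \<in> q ` {f \<in> Ec (Suc k). f \<in> b}" using f by blast
    ultimately show ?thesis by presburger
  qed
  then show "i \<in> late q k b \<longleftrightarrow> i \<in> late q (Suc k) b \<ominus> q ` {f \<in> Ec (Suc k). f \<in> b}"
    unfolding late_def by (simp add: c)
qed

lemma late_top: "\<chi> \<le> k \<Longrightarrow> late q k b = {}"
proof -
  assume "\<chi> \<le> k"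
  then have "{f \<in> E. f \<in> b \<and> k < col f \<and> q f = i} = {}" for i using col_range by fastforce
  then show ?thesis unfolding late_def by (simp only: card.empty) simp
qed

lemma Ec_boundary: "\<Union>{e \<in> Ec \<alpha>. e \<in> b} = Min ` {e \<in> Ec \<alpha>. e \<in> b} \<ominus> Max ` {e \<in> Ec \<alpha>. e \<in> b}"
proof (rule set_eqI)
  fix i
  have "i \<in> \<Union>{e \<in> Ec \<alpha>. e \<in> b} \<longleftrightarrow> i \<in> Min ` {e \<in> Ec \<alpha>. e \<in> b} \<or> i \<in> Max ` {e \<in> Ec \<alpha>. e \<in> b}"
    using in_edge edgeE Ec_E by blast
  moreover have "\<not> (i \<in> Min ` {e \<in> Ec \<alpha>. e \<in> b} \<and> i \<in> Max ` {e \<in> Ec \<alpha>. e \<in> b})"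
    using lo_neq_hi by auto
  ultimately show "i \<in> \<Union>{e \<in> Ec \<alpha>. e \<in> b} \<longleftrightarrow>
      i \<in> Min ` {e \<in> Ec \<alpha>. e \<in> b} \<ominus> Max ` {e \<in> Ec \<alpha>. e \<in> b}"
    unfolding in_sdiff by argo
qed

lemma bdry_cl: "set fs \<subseteq> Ec \<alpha> \<Longrightarrow> distinct fs \<Longrightarrow> bdry fs = \<Union>(set fs)"
proof (induction fs)
  case (Cons f fs)
  have "f \<inter> \<Union>(set fs) = {}" using Cons.prems matching by fastforce
  then show ?case using Cons by (auto simp: sdiff_def)
qed simp

text \<open>Each edge adds its lower end to one parity and its upper end to the other. The boundary
  of \<open>b\<close> can thus be added to the site qubits by the same color by color CNOTs that
  update \<open>U\<close> and \<open>V\<close>; this gives \<open>conv_stage\<close>.\<close>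

lemma bdry_above: "bdry (sel b k) = late Min k b \<ominus> late Max k b"
proof (induction "\<chi> - k" arbitrary: k)
  case 0
  then show ?case by (simp add: above_top late_top)
next
  case (Suc n)
  then have k: "k < \<chi>" and IH: "bdry (sel b (Suc k)) = late Min (Suc k) b \<ominus> late Max (Suc k) b" by auto
  have "bdry (filter (\<lambda>e. e \<in> b) (cl (Suc k))) = \<Union>{e \<in> Ec (Suc k). e \<in> b}"
    using bdry_cl[of "filter (\<lambda>e. e \<in> b) (cl (Suc k))" "Suc k"] cl by simp
  then show ?case
    unfolding late_step[of Min k b, OF inj_lo] late_step[of Max k b, OF inj_hi] using k
    by (simp add: above_Suc bdry_append IH Ec_boundary sdiff_ac)
qed

subsection \<open>Adjacent orderings\<close>

text \<open>Twice the site number, except that an upper end of the color moves to the odd number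
  right after the lower end of its edge. Matched sites become adjacent, and the factor 2 makes room
  without renumbering the others.\<close>

definition rank :: "nat \<Rightarrow> nat \<Rightarrow> nat" where
  "rank \<alpha> k = (if k \<in> Max ` Ec \<alpha> then Suc (2 * lo (the_inv_into (Ec \<alpha>) Max k)) else 2 * k)"

lemma rank_hi: "e \<in> Ec \<alpha> \<Longrightarrow> rank \<alpha> (hi e) = Suc (2 * lo e)"
  by (simp add: rank_def the_inv_into_f_f[OF inj_hi])

lemma rank_lo: "e \<in> Ec \<alpha> \<Longrightarrow> rank \<alpha> (lo e) = 2 * lo e"
  using lo_neq_hi by (auto simp: rank_def)

lemma rank_other:
  assumes "e \<in> Ec \<alpha>" "l \<notin> e"
  shows "rank \<alpha> l \<noteq> 2 * lo e \<and> rank \<alpha> l \<noteq> Suc (2 * lo e)"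
proof (cases "l \<in> Max ` Ec \<alpha>")
  case True
  then obtain f where f: "f \<in> Ec \<alpha>" "l = hi f" by blast
  then have "f \<noteq> e" using assms lo_hi_in Ec_E by blast
  then have "lo f \<noteq> lo e" using inj_lo f assms by (auto dest: inj_onD)
  then show ?thesis using f rank_hi by simp
next
  case False
  then have "l \<noteq> lo e" using assms lo_hi_in Ec_E by blast
  then show ?thesis using False by (simp add: rank_def)
qed

lemma rank_bound: "k \<in> K \<Longrightarrow> rank \<alpha> k \<le> 2 * N + 1"
proof (cases "k \<in> Max ` Ec \<alpha>")
  case True
  then obtain f where f: "f \<in> Ec \<alpha>" "k = hi f" by blast
  then have "lo f \<le> N" using lo_hi_K(1)[of f] Ec_E by (auto simp: K_def)
  then show ?thesis using f rank_hi by simp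
qed (auto simp: rank_def K_def)

definition crossed :: "nat \<Rightarrow> nat \<Rightarrow> nat set \<Rightarrow> nat set" where
  "crossed \<alpha> x R = {l \<in> R. (l < x \<and> rank \<alpha> x < rank \<alpha> l) \<or> (x < l \<and> rank \<alpha> l < rank \<alpha> x)}"

lemma invsign_insert:
  assumes "finite R" "x \<notin> R"
  shows "invsign (rank \<alpha>) (insert x R) = invsign (rank \<alpha>) R * psign (crossed \<alpha> x R)"
proof -
  let ?C = "(\<lambda>l. if l < x then (l, x) else (x, l)) ` crossed \<alpha> x R"
  have "invs (rank \<alpha>) 0 (insert x R) = invs (rank \<alpha>) 0 R \<union> ?C"
  proof (rule set_eqI)
    fix p :: "nat \<times> nat"
    obtain k l where p: "p = (k, l)" by (cases p)
    have "p \<in> ?C \<longleftrightarrow> (l = x \<and> k \<in> R \<and> k < x \<and> rank \<alpha> x < rank \<alpha> k) \<or> (k = x \<and> l \<in> R \<and> x < l \<and> rank \<alpha> l < rank \<alpha> x)"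
    proof
      assume "p \<in> ?C"
      then obtain m where "m \<in> crossed \<alpha> x R" "p = (if m < x then (m, x) else (x, m))" by blast
      then show "(l = x \<and> k \<in> R \<and> k < x \<and> rank \<alpha> x < rank \<alpha> k) \<or> (k = x \<and> l \<in> R \<and> x < l \<and> rank \<alpha> l < rank \<alpha> x)"
        unfolding p crossed_def by (cases "m < x") auto
    next
      assume "(l = x \<and> k \<in> R \<and> k < x \<and> rank \<alpha> x < rank \<alpha> k) \<or> (k = x \<and> l \<in> R \<and> x < l \<and> rank \<alpha> l < rank \<alpha> x)"
      then show "p \<in> ?C"
      proof (elim disjE conjE)
        assume "l = x" "k \<in> R" "k < x" "rank \<alpha> x < rank \<alpha> k"
        then show ?thesis unfolding p by (intro image_eqI[of _ _ k]) (auto simp: crossed_def)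
      next
        assume "k = x" "l \<in> R" "x < l" "rank \<alpha> l < rank \<alpha> x"
        then show ?thesis unfolding p by (intro image_eqI[of _ _ l]) (auto simp: crossed_def)
      qed
    qed
    then show "p \<in> invs (rank \<alpha>) 0 (insert x R) \<longleftrightarrow> p \<in> invs (rank \<alpha>) 0 R \<union> ?C"
      unfolding Un_iff unfolding p invs_def using assms(2) by auto
  qed
  moreover have "invs (rank \<alpha>) 0 R \<inter> ?C = {}" using assms(2) by (auto simp: invs_def crossed_def)
  moreover have "psign ?C = psign (crossed \<alpha> x R)" by (rule psign_image) (auto simp: inj_on_def)
  moreover have "finite ?C" using assms(1) by (simp add: crossed_def)
  ultimately show ?thesis using assms(1) by (simp add: psign_Un_disjoint)
qed

text \<open>Exactly the occupied modes strictly between its two end points change their order relative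
  to an edge of the color.\<close>

lemma invsign_flip:
  assumes e: "e \<in> Ec \<alpha>" and fS: "finite S"
  shows "invsign (rank \<alpha>) (S \<ominus> e) = psign (S \<inter> inner e) * invsign (rank \<alpha>) S"
proof -
  have ee: "edge e" "lo e < hi e" using e edgeE edge_less Ec_E by blast+
  define R where "R = S - e"
  have R: "finite R" "lo e \<notin> R" "hi e \<notin> R" using fS in_edge[OF ee(1)] by (auto simp: R_def)
  define d where "d = invsign (rank \<alpha>) R"
  define ci where "ci = psign (crossed \<alpha> (lo e) R)"
  define cj where "cj = psign (crossed \<alpha> (hi e) R)"
  have "crossed \<alpha> (lo e) R \<ominus> crossed \<alpha> (hi e) R = R \<inter> inner e"
  proof (rule set_eqI)
    fix l
    have "rank \<alpha> l \<noteq> 2 * lo e \<and> rank \<alpha> l \<noteq> Suc (2 * lo e) \<and> l \<noteq> lo e \<and> l \<noteq> hi e" if "l \<in> R"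
      using rank_other[OF e] that in_edge[OF ee(1)] by (auto simp: R_def)
    then show "l \<in> crossed \<alpha> (lo e) R \<ominus> crossed \<alpha> (hi e) R \<longleftrightarrow> l \<in> R \<inter> inner e"
      unfolding in_sdiff crossed_def mem_Collect_eq rank_lo[OF e] rank_hi[OF e] inner_def using ee(2) by auto
  qed
  moreover have "R \<inter> inner e = S \<inter> inner e" using in_edge[OF ee(1)] by (auto simp: R_def inner_def)
  ultimately have p: "psign (S \<inter> inner e) = ci * cj"
    unfolding ci_def cj_def using R psign_sdiff[of "crossed \<alpha> (lo e) R" "crossed \<alpha> (hi e) R"]
    by (simp add: crossed_def)
  have c1: "ci = 1 \<or> ci = - 1" "cj = 1 \<or> cj = - 1" unfolding ci_def cj_def by (rule psign_cases)+
  have v1: "invsign (rank \<alpha>) (insert (lo e) R) = d * ci"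
    using R by (simp add: invsign_insert d_def ci_def)
  have v2: "invsign (rank \<alpha>) (insert (hi e) R) = d * cj"
    using R by (simp add: invsign_insert d_def cj_def)
  \<comment> \<open>The ends keep their own order, \<open>2 * lo e < Suc (2 * lo e)\<close>, so the
    pair of ends never counts as an inversion.\<close>
  have "crossed \<alpha> (lo e) (insert (hi e) R) = crossed \<alpha> (lo e) R"
    unfolding crossed_def using ee(2) rank_lo[OF e] rank_hi[OF e] by auto
  then have v3: "invsign (rank \<alpha>) (insert (lo e) (insert (hi e) R)) = d * cj * ci"
    using R ee(2) by (simp add: invsign_insert v2 ci_def)
  have i: "x \<in> e \<longleftrightarrow> x = lo e \<or> x = hi e" for x by (rule in_edge[OF ee(1)])
  consider "lo e \<in> S" "hi e \<in> S" | "lo e \<in> S" "hi e \<notin> S" | "lo e \<notin> S" "hi e \<in> S" | "lo e \<notin> S" "hi e \<notin> S" by blast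
  then show ?thesis
  proof cases
    case 1
    have s1: "S = insert (lo e) (insert (hi e) R)"
    proof (rule set_eqI)
      fix x show "x \<in> S \<longleftrightarrow> x \<in> insert (lo e) (insert (hi e) R)" using 1 i[of x] unfolding R_def by auto
    qed
    have s2: "S \<ominus> e = R"
    proof (rule set_eqI)
      fix x show "x \<in> S \<ominus> e \<longleftrightarrow> x \<in> R" using 1 i[of x] unfolding R_def in_sdiff by auto
    qed
    have a: "invsign (rank \<alpha>) (S \<ominus> e) = d" unfolding s2 by (rule d_def[symmetric])
    have "invsign (rank \<alpha>) S = d * cj * ci" unfolding s1 by (rule v3)
    then show ?thesis unfolding p a using c1 by (elim disjE) simp_all
  next
    case 2
    have s1: "S = insert (lo e) R"
    proof (rule set_eqI)
      fix x show "x \<in> S \<longleftrightarrow> x \<in> insert (lo e) R" using 2 i[of x] unfolding R_def by auto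
    qed
    have s2: "S \<ominus> e = insert (hi e) R"
    proof (rule set_eqI)
      fix x show "x \<in> S \<ominus> e \<longleftrightarrow> x \<in> insert (hi e) R" using 2 i[of x] unfolding R_def in_sdiff by auto
    qed
    have a: "invsign (rank \<alpha>) (S \<ominus> e) = d * cj" unfolding s2 by (rule v2)
    have "invsign (rank \<alpha>) S = d * ci" unfolding s1 by (rule v1)
    then show ?thesis unfolding p a using c1 by (elim disjE) simp_all
  next
    case 3
    have s1: "S = insert (hi e) R"
    proof (rule set_eqI)
      fix x show "x \<in> S \<longleftrightarrow> x \<in> insert (hi e) R" using 3 i[of x] unfolding R_def by auto
    qed
    have s2: "S \<ominus> e = insert (lo e) R"
    proof (rule set_eqI)
      fix x show "x \<in> S \<ominus> e \<longleftrightarrow> x \<in> insert (lo e) R" using 3 i[of x] unfolding R_def in_sdiff by auto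
    qed
    have a: "invsign (rank \<alpha>) (S \<ominus> e) = d * ci" unfolding s2 by (rule v1)
    have "invsign (rank \<alpha>) S = d * cj" unfolding s1 by (rule v2)
    then show ?thesis unfolding p a using c1 by (elim disjE) simp_all
  next
    case 4
    have s1: "S = R"
    proof (rule set_eqI)
      fix x show "x \<in> S \<longleftrightarrow> x \<in> R" using 4 i[of x] unfolding R_def by auto
    qed
    have s2: "S \<ominus> e = insert (lo e) (insert (hi e) R)"
    proof (rule set_eqI)
      fix x show "x \<in> S \<ominus> e \<longleftrightarrow> x \<in> insert (lo e) (insert (hi e) R)" using 4 i[of x] unfolding R_def in_sdiff by auto
    qed
    have a: "invsign (rank \<alpha>) (S \<ominus> e) = d * cj * ci" unfolding s2 by (rule v3)
    have "invsign (rank \<alpha>) S = d" unfolding s1 by (rule d_def[symmetric])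
    then show ?thesis unfolding p a using c1 by (elim disjE) simp_all
  qed
qed

text \<open>Conjugation by the reordering sign strips the Z strings of the whole color at once,
  leaving plain bit flips on the boundary. The signs between successive factors cancel, so two
  applications serve any number of edges.\<close>

lemma flips_of_color:
  assumes "set fs \<subseteq> Ec \<alpha>" "finite S"
  shows "flips_of fs \<psi> S = invsign (rank \<alpha>) S * invsign (rank \<alpha>) (S \<ominus> bdry fs) * \<psi> (S \<ominus> bdry fs)"
  using assms
proof (induction fs arbitrary: S)
  case (Cons f fs)
  have f: "f \<in> Ec \<alpha>" "finite f" using Cons.prems edgeE edge_finite Ec_E by auto
  have "flips_of (f # fs) \<psi> S = psign (S \<inter> inner f) * flips_of fs \<psi> (S \<ominus> f)"
    by (simp add: flip_def[of f])
  also have "\<dots> = psign (S \<inter> inner f) *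
     (invsign (rank \<alpha>) (S \<ominus> f) * invsign (rank \<alpha>) (S \<ominus> f \<ominus> bdry fs) * \<psi> (S \<ominus> f \<ominus> bdry fs))"
    using Cons f by simp
  finally show ?case using Cons.prems by (simp add: invsign_flip[OF f(1)] sdiff_assoc)
qed simp

end

section \<open>Images of symmetric differences\<close>

lemma inj_on_image_sdiff:
  assumes "inj_on f C" "X \<subseteq> C" "Y \<subseteq> C"
  shows "f ` (X \<ominus> Y) = f ` X \<ominus> f ` Y"
proof -
  have d: "A \<ominus> A' = (A - A') \<union> (A' - A)" for A A' :: "'b set" by auto
  have d': "A \<ominus> A' = (A - A') \<union> (A' - A)" for A A' :: "'a set" by auto
  have "f ` (X - Y) = f ` X - f ` Y" "f ` (Y - X) = f ` Y - f ` X"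
    using assms by (intro inj_on_image_set_diff[OF assms(1)]; blast)+
  then show ?thesis unfolding d d' image_Un by simp
qed

lemma image_sdiff: "inj f \<Longrightarrow> f ` (X \<ominus> Y) = f ` X \<ominus> f ` Y"
  by (rule inj_on_image_sdiff) auto

lemma sdiff_subset_iff: "A \<subseteq> C \<Longrightarrow> x \<ominus> A \<subseteq> C \<longleftrightarrow> x \<subseteq> C"
  unfolding sdiff_def by blast

section \<open>Controlled rotations\<close>

text \<open>The matrix exp(-i \<theta> X) on \<open>b\<close>, controlled by
  \<open>p\<close>.\<close>

definition crot :: "real \<Rightarrow> 'w \<Rightarrow> 'w \<Rightarrow> 'w gate" where
  "crot \<theta> p b = ({p, b}, \<lambda>x y. if p \<in> x
     then (if y = x then of_real (cos \<theta>) else if y = x \<ominus> {b} then - \<i> * of_real (sin \<theta>) else 0)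
     else (if y = x then 1 else 0))"

lemma app_crot:
  assumes "p \<noteq> b"
  shows "app (crot \<theta> p b) \<psi> x =
    (if p \<in> x then of_real (cos \<theta>) * \<psi> x - \<i> * of_real (sin \<theta>) * \<psi> (x \<ominus> {b}) else \<psi> x)"
proof -
  let ?S = "{p, b}"
  let ?y = "x \<inter> ?S"
  have f: "finite (Pow ?S)" by simp
  have m: "?y \<in> Pow ?S" "?y \<ominus> {b} \<in> Pow ?S" by auto
  have s: "(x - ?S) \<union> ?y = x" "(x - ?S) \<union> (?y \<ominus> {b}) = x \<ominus> {b}" by auto
  have "?y \<ominus> {b} \<noteq> ?y" by auto
  then have "app (crot \<theta> p b) \<psi> x = (\<Sum>y\<in>Pow ?S.
      (if y = ?y then (if p \<in> x then of_real (cos \<theta>) else 1) * \<psi> ((x - ?S) \<union> ?y) else 0) +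
      (if y = ?y \<ominus> {b} then (if p \<in> x then - \<i> * of_real (sin \<theta>) else 0) * \<psi> ((x - ?S) \<union> (?y \<ominus> {b})) else 0))"
    unfolding app_def crot_def fst_conv snd_conv by (intro sum.cong) auto
  also have "\<dots> = (if p \<in> x then of_real (cos \<theta>) else 1) * \<psi> x +
      (if p \<in> x then - \<i> * of_real (sin \<theta>) else 0) * \<psi> (x \<ominus> {b})"
    unfolding sum.distrib sum.delta[OF f] by (simp only: m if_True s)
  finally show ?thesis by simp
qed

lemma unitary_crot:
  assumes "p \<noteq> b"
  shows "unitary_mat (fst (crot \<theta> p b)) (snd (crot \<theta> p b))"
  unfolding unitary_mat_def
proof (intro ballI)
  let ?S = "{p, b}" and ?U = "snd (crot \<theta> p b)"
  fix x y assume "x \<in> Pow (fst (crot \<theta> p b))" "y \<in> Pow (fst (crot \<theta> p b))"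
  then have xy: "x \<subseteq> ?S" "y \<subseteq> ?S" by (auto simp: crot_def)
  have f: "finite (Pow ?S)" by simp
  define c where "c = (if p \<in> x then complex_of_real (cos \<theta>) else 1)"
  define s where "s = (if p \<in> x then - \<i> * complex_of_real (sin \<theta>) else 0)"
  have xb: "x \<noteq> x \<ominus> {b}" by auto
  have col: "?U z x = (if z = x then c else 0) + (if z = x \<ominus> {b} then s else 0)" for z
  proof -
    have "x = z \<ominus> {b} \<longleftrightarrow> z = x \<ominus> {b}" by auto
    moreover have "p \<in> x \<ominus> {b} \<longleftrightarrow> p \<in> x" using assms by auto
    ultimately show ?thesis using xb by (auto simp: crot_def c_def s_def)
  qed
  have fst: "fst (crot \<theta> p b) = ?S" by (simp add: crot_def)
  have n: "cnj c * c + cnj s * s = 1"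
  proof -
    have "complex_of_real (cos \<theta>) * complex_of_real (cos \<theta>) + complex_of_real (sin \<theta>) * complex_of_real (sin \<theta>) = 1"
      by (metis of_real_1 of_real_add of_real_mult power2_eq_square sin_cos_squared_add2)
    then show ?thesis by (simp add: c_def s_def algebra_simps)
  qed
  have mx: "x \<in> Pow ?S" "x \<ominus> {b} \<in> Pow ?S" using xy by auto
  have "(\<Sum>z\<in>Pow (fst (crot \<theta> p b)). cnj (?U z x) * ?U z y) =
     (\<Sum>z\<in>Pow ?S. (if z = x then cnj c * ?U x y else 0) + (if z = x \<ominus> {b} then cnj s * ?U (x \<ominus> {b}) y else 0))"
    unfolding fst using xb by (intro sum.cong) (auto simp: col)
  also have "\<dots> = cnj c * ?U x y + cnj s * ?U (x \<ominus> {b}) y"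
    unfolding sum.distrib sum.delta[OF f] by (simp only: mx if_True)
  also have "\<dots> = (if x = y then 1 else 0)"
  proof -
    have p: "p \<in> x \<ominus> {b} \<longleftrightarrow> p \<in> x" using assms by auto
    have bb: "x \<ominus> {b} \<ominus> {b} = x" by simp
    consider "y = x" | "y = x \<ominus> {b}" | "y \<noteq> x" "y \<noteq> x \<ominus> {b}" by blast
    then show ?thesis
    proof cases
      case 1
      then show ?thesis using n col[of x] col[of "x \<ominus> {b}"] xb by simp
    next
      case 2
      have "?U x (x \<ominus> {b}) = s" "?U (x \<ominus> {b}) (x \<ominus> {b}) = c"
        using xb p by (auto simp: crot_def s_def c_def)
      moreover have "cnj c * s + cnj s * c = 0" by (simp add: c_def s_def)
      ultimately show ?thesis using 2 xb by simp
    next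
      case 3
      then have "?U x y = 0" "?U (x \<ominus> {b}) y = 0" unfolding crot_def snd_conv bb by auto
      then show ?thesis using 3 by simp
    qed
  qed
  finally show "(\<Sum>z\<in>Pow (fst (crot \<theta> p b)). cnj (?U z x) * ?U z y) = (if x = y then 1 else 0)" .
qed

lemma cnots_cnots:
  assumes "fst ` R \<inter> snd ` R = {}"
  shows "cnots R (cnots R \<phi>) = \<phi>"
proof
  fix x
  have "flips R (x \<ominus> flips R x) = flips R x" using assms by (force simp: flips_def)
  then show "cnots R (cnots R \<phi>) x = \<phi> x" by (simp add: cnots_def)
qed

lemma czs_czs: "czs R (czs R \<phi>) = \<phi>"
  by (simp add: czs_def)

text \<open>The exponential of -i \<theta> times the hopping term of \<open>e\<close> with
  coefficient 1: that term squares to the projection onto unequal occupations, whence the cosine and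
  sine there and the identity elsewhere.\<close>

definition rot :: "real \<Rightarrow> nat set \<Rightarrow> nat ket \<Rightarrow> nat ket" where
  "rot \<theta> e \<psi> = (\<lambda>S. if (lo e \<in> S) \<noteq> (hi e \<in> S)
     then of_real (cos \<theta>) * \<psi> S - \<i> * of_real (sin \<theta>) * flip e \<psi> S else \<psi> S)"

context colored
begin

section \<open>The encoding\<close>

definition W :: "wire set" where
  "W = P ` K \<union> B ` E \<union> U ` K \<union> V ` K"

definition bs :: "wire set \<Rightarrow> nat set set" where
  "bs x = {e \<in> E. B e \<in> x}"

lemma in_bs [simp]: "e \<in> bs x \<longleftrightarrow> e \<in> E \<and> B e \<in> x"
  by (simp add: bs_def)

text \<open>The edges of colors above \<open>k\<close> are encoded: the basis state \<open>b\<close> of the edge qubits comes with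
  the state \<open>\<psi>\<close> to which the bilinears of the edges in \<open>b\<close> have been applied.\<close>

definition enc :: "nat \<Rightarrow> nat ket \<Rightarrow> wire ket" where
  "enc k \<psi> = (\<lambda>x. if x \<subseteq> P ` K \<union> B ` {e \<in> E. k < col e}
     then flips_of (sel (bs x) k) \<psi> (occ K x) else 0)"

text \<open>The encoded state in terms of the true occupation numbers, during the conversion to them.\<close>

definition conv :: "nat \<Rightarrow> nat \<Rightarrow> nat ket \<Rightarrow> wire ket" where
  "conv j l \<psi> = (\<lambda>x. if x \<subseteq> P ` K \<union> B ` E
     then flips_of (sel (bs x) 0) \<psi> (occ K x \<ominus> (late Min j (bs x) \<ominus> late Max l (bs x))) else 0)"

text \<open>The registers \<open>U\<close> and \<open>V\<close> hold, for every site, the signs with which an edge of color \<open>j\<close> (resp.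
  \<open>l\<close>) at this site passes the later ones.\<close>

definition stage :: "nat \<Rightarrow> nat \<Rightarrow> nat ket \<Rightarrow> wire ket" where
  "stage j l \<psi> = (\<lambda>x. if x \<subseteq> W \<and> {i \<in> K. U i \<in> x} = late Min j (bs x) \<and> {i \<in> K. V i \<in> x} = late Max l (bs x)
     then flips_of (sel (bs x) 0) \<psi> (occ K x \<ominus> bdry (sel (bs x) 0)) else 0)"

abbreviation ends :: "(nat \<Rightarrow> wire) \<Rightarrow> (nat set \<Rightarrow> nat) \<Rightarrow> nat \<Rightarrow> (wire \<times> wire) set" where
  "ends c q \<alpha> \<equiv> (\<lambda>e. (B e, c (q e))) ` Ec \<alpha>"

definition act :: "nat \<Rightarrow> wire set \<Rightarrow> nat set set" where
  "act \<alpha> x = {e \<in> Ec \<alpha>. B e \<in> x}"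

lemma in_act [simp]: "e \<in> act \<alpha> x \<longleftrightarrow> e \<in> Ec \<alpha> \<and> B e \<in> x"
  by (simp add: act_def)

definition reg :: "(nat \<Rightarrow> wire) \<Rightarrow> bool" where
  "reg c \<longleftrightarrow> c = P \<or> c = U \<or> c = V"

lemma regs [simp]: "reg P" "reg U" "reg V"
  by (auto simp: reg_def)

lemma reg_props: "reg c \<Longrightarrow> c i \<noteq> B e" "reg c \<Longrightarrow> inj c" "reg c \<Longrightarrow> c ` K \<subseteq> W"
  by (auto simp: reg_def inj_def W_def)

lemma cnots_ends:
  assumes "reg c"
  shows "cnots (ends c q \<alpha>) \<phi> x = \<phi> (x \<ominus> c ` q ` act \<alpha> x)"
proof -
  have "flips (ends c q \<alpha>) x = c ` q ` act \<alpha> x"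
    unfolding flips_image act_def by (simp add: image_image)
  then show ?thesis by (simp add: cnots_def)
qed

lemma act_shift: "reg c \<Longrightarrow> act \<alpha> (x \<ominus> c ` X) = act \<alpha> x"
  by (auto simp: reg_def)

lemma ends_ok:
  assumes c: "reg c" and q: "q = Min \<or> q = Max"
  shows "finite (ends c q \<alpha>)" "disjoint_pairs (ends c q \<alpha>)" "fst ` ends c q \<alpha> \<union> snd ` ends c q \<alpha> \<subseteq> W"
    "fst ` ends c q \<alpha> \<inter> snd ` ends c q \<alpha> = {}"
    "disjoint_pairs ((\<lambda>e. (c (q e), B e)) ` Ec \<alpha>)"
    "fst ` (\<lambda>e. (c (q e), B e)) ` Ec \<alpha> \<union> snd ` (\<lambda>e. (c (q e), B e)) ` Ec \<alpha> \<subseteq> W"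
proof -
  have q': "inj_on q (Ec \<alpha>)" using q inj_lo inj_hi by blast
  have qK: "q e \<in> K" if "e \<in> Ec \<alpha>" for e using q lo_hi_K[of e] that Ec_E by auto
  have cq: "inj_on (\<lambda>e. c (q e)) (Ec \<alpha>)"
    using comp_inj_on[OF q' inj_on_subset[OF reg_props(2)[OF c] subset_UNIV]] by (simp add: comp_def)
  have b: "inj_on B (Ec \<alpha>)" by (simp add: inj_on_def)
  show "finite (ends c q \<alpha>)" by simp
  show "disjoint_pairs (ends c q \<alpha>)"
    by (rule disjoint_pairs_image[OF b cq]) (use reg_props(1)[OF c] in metis)
  show "disjoint_pairs ((\<lambda>e. (c (q e), B e)) ` Ec \<alpha>)"
    by (rule disjoint_pairs_image[OF cq b]) (use reg_props(1)[OF c] in metis)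
  have w: "c (q e) \<in> W" "B e \<in> W" if "e \<in> Ec \<alpha>" for e
    using reg_props(3)[OF c] qK[OF that] that Ec_E by (auto simp: W_def)
  then show "fst ` ends c q \<alpha> \<union> snd ` ends c q \<alpha> \<subseteq> W"
    "fst ` (\<lambda>e. (c (q e), B e)) ` Ec \<alpha> \<union> snd ` (\<lambda>e. (c (q e), B e)) ` Ec \<alpha> \<subseteq> W" by auto
  show "fst ` ends c q \<alpha> \<inter> snd ` ends c q \<alpha> = {}" using reg_props(1)[OF c] by (auto; metis)
qed

lemma reach_ends:
  assumes "reg c" "q = Min \<or> q = Max"
  shows "reach W 1 F (\<lambda>a. cnots (ends c q \<alpha>) (F a))"
  using ends_ok[OF assms] by (intro reach_cnots)

lemma finite_W: "finite W"
  using finite_E by (simp add: W_def)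

lemma occ_shift: "X \<subseteq> K \<Longrightarrow> occ K (x \<ominus> P ` X) = occ K x \<ominus> X"
  by auto

lemma ends_K: "q = Min \<or> q = Max \<Longrightarrow> q ` act \<alpha> x \<subseteq> K"
proof
  fix i assume "q = Min \<or> q = Max" "i \<in> q ` act \<alpha> x"
  then show "i \<in> K" using lo_hi_K Ec_in by auto
qed

text \<open>Hadamard gates on the edge qubits of the new color create the superposition over its
  subsets; CNOTs from every edge qubit to both ends, between two reordering signs, apply the
  controlled bilinears. The layers are 1 + 11 L + 2 + 11 L.\<close>

lemma reach_enc_step:
  assumes k: "k < \<chi>" and L: "\<And>i. i \<in> K \<Longrightarrow> rank (Suc k) i < 2 ^ L"
  shows "reach W (22 * L + 3) (enc (Suc k)) (enc k)"
proof -
  let ?\<alpha> = "Suc k"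
  define G1 where "G1 \<psi> x = enc ?\<alpha> \<psi> (x - B ` Ec ?\<alpha>)" for \<psi> x
  define G2 where "G2 \<psi> x = invsign (rank ?\<alpha>) (occ K x) * G1 \<psi> x" for \<psi> x
  define G4 where "G4 \<psi> = cnots (ends P Max ?\<alpha>) (cnots (ends P Min ?\<alpha>) (G2 \<psi>))" for \<psi>
  have PUV: "P ` K \<union> U ` K \<union> V ` K \<subseteq> W" by (auto simp: W_def)
  have c0: "x \<subseteq> P ` K \<union> B ` {e \<in> E. ?\<alpha> < col e}" if "enc ?\<alpha> \<psi> x \<noteq> 0" for \<psi> x
    using that by (auto simp: enc_def split: if_splits)
  have "hs (B ` Ec ?\<alpha>) (enc ?\<alpha> \<psi>) = G1 \<psi>" for \<psi>
    unfolding G1_def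
  proof (rule hs_clean)
    fix z assume "enc ?\<alpha> \<psi> z \<noteq> 0"
    from c0[OF this] show "z \<inter> B ` Ec ?\<alpha> = {}" by (auto simp: in_Ec)
  qed simp
  then have r1: "reach W 1 (enc ?\<alpha>) G1"
    using reach_hs[of "B ` Ec ?\<alpha>" W "enc ?\<alpha>"] Ec_E by (force simp: W_def)
  have c1: "x \<inter> (U ` K \<union> V ` K) = {}" if "G1 \<psi> x \<noteq> 0" for \<psi> x
    using c0[OF that[unfolded G1_def]] by blast
  have r2: "reach W (L * 11) G1 G2"
    unfolding G2_def by (intro reach_invsign[OF _ PUV c1 L]) auto
  have r4: "reach W (1 + 1) G2 G4"
    unfolding G4_def by (intro reach_trans[OF reach_ends reach_ends]) auto
  have G4: "G4 \<psi> x = G2 \<psi> (x \<ominus> P ` \<Union>(act ?\<alpha> x))" for \<psi> x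
  proof -
    have "G4 \<psi> x = G2 \<psi> (x \<ominus> P ` Max ` act ?\<alpha> x \<ominus> P ` Min ` act ?\<alpha> x)"
      unfolding G4_def by (simp only: cnots_ends regs act_shift)
    also have "x \<ominus> P ` Max ` act ?\<alpha> x \<ominus> P ` Min ` act ?\<alpha> x = x \<ominus> P ` (Min ` act ?\<alpha> x \<ominus> Max ` act ?\<alpha> x)"
      by (simp add: image_sdiff inj_def sdiff_ac)
    also have "Min ` act ?\<alpha> x \<ominus> Max ` act ?\<alpha> x = \<Union>(act ?\<alpha> x)"
      using Ec_boundary[of ?\<alpha> "{e. B e \<in> x}"] by (simp add: act_def)
    finally show ?thesis .
  qed
  have XK: "\<Union>(act ?\<alpha> x) \<subseteq> K" for x using edge_K Ec_E by fastforce
  have c4: "x \<inter> (U ` K \<union> V ` K) = {}" if "G4 \<psi> x \<noteq> 0" for \<psi> x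
  proof -
    have "G1 \<psi> (x \<ominus> P ` \<Union>(act ?\<alpha> x)) \<noteq> 0" using that by (simp add: G4 G2_def)
    from c1[OF this] show ?thesis by auto
  qed
  have "reach W (L * 11) G4 (\<lambda>\<psi> x. invsign (rank ?\<alpha>) (occ K x) * G4 \<psi> x)"
    by (intro reach_invsign[OF _ PUV c4 L]) auto
  moreover have "invsign (rank ?\<alpha>) (occ K x) * G4 \<psi> x = enc k \<psi> x" for \<psi> x
  proof -
    define X where "X = \<Union>(act ?\<alpha> x)"
    define y where "y = (x \<ominus> P ` X) - B ` Ec ?\<alpha>"
    have o: "occ K y = occ K x \<ominus> X" "occ K (x \<ominus> P ` X) = occ K x \<ominus> X"
      using subsetD[OF XK[of x]] unfolding y_def by (auto simp del: Union_iff simp: X_def[symmetric])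
    have s: "sel (bs y) ?\<alpha> = sel (bs x) ?\<alpha>"
    proof (rule filter_cong[OF refl])
      fix e assume "e \<in> set (above ?\<alpha>)"
      then show "e \<in> bs y \<longleftrightarrow> e \<in> bs x" unfolding set_above by (auto simp: y_def in_Ec)
    qed
    have dom: "y \<subseteq> P ` K \<union> B ` {e \<in> E. ?\<alpha> < col e} \<longleftrightarrow> x \<subseteq> P ` K \<union> B ` {e \<in> E. k < col e}"
    proof -
      have Be: "B e \<in> y \<longleftrightarrow> B e \<in> x \<and> e \<notin> Ec ?\<alpha>" for e unfolding y_def by auto
      have Pi: "P i \<in> y \<longleftrightarrow> (P i \<in> x) \<noteq> (i \<in> X)" and Ui: "U i \<in> y \<longleftrightarrow> U i \<in> x" and Vi: "V i \<in> y \<longleftrightarrow> V i \<in> x" for i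
        unfolding y_def by auto
      have in_dom: "z \<subseteq> P ` K \<union> B ` F \<longleftrightarrow> (\<forall>i. P i \<in> z \<longrightarrow> i \<in> K) \<and> (\<forall>e. B e \<in> z \<longrightarrow> e \<in> F) \<and> (\<forall>i. U i \<notin> z) \<and> (\<forall>i. V i \<notin> z)" for z F
      proof
        assume r: "(\<forall>i. P i \<in> z \<longrightarrow> i \<in> K) \<and> (\<forall>e. B e \<in> z \<longrightarrow> e \<in> F) \<and> (\<forall>i. U i \<notin> z) \<and> (\<forall>i. V i \<notin> z)"
        show "z \<subseteq> P ` K \<union> B ` F"
        proof
          fix w assume "w \<in> z"
          with r show "w \<in> P ` K \<union> B ` F" by (cases w) auto
        qed
      qed auto
      have "X \<subseteq> K" unfolding X_def by (rule XK)
      then have 1: "(\<forall>i. P i \<in> y \<longrightarrow> i \<in> K) \<longleftrightarrow> (\<forall>i. P i \<in> x \<longrightarrow> i \<in> K)" unfolding Pi by blast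
      have 2: "(\<forall>e. B e \<in> y \<longrightarrow> e \<in> {e \<in> E. ?\<alpha> < col e}) \<longleftrightarrow> (\<forall>e. B e \<in> x \<longrightarrow> e \<in> {e \<in> E. k < col e})"
      proof -
        have "(B e \<in> y \<longrightarrow> e \<in> {e \<in> E. ?\<alpha> < col e}) \<longleftrightarrow> (B e \<in> x \<longrightarrow> e \<in> {e \<in> E. k < col e})" for e
          unfolding Be in_Ec by auto
        then show ?thesis by (simp only:)
      qed
      show ?thesis unfolding in_dom 1 2 Ui Vi ..
    qed
    show ?thesis
    proof (cases "x \<subseteq> P ` K \<union> B ` {e \<in> E. k < col e}")
      case True
      have b: "bdry (filter (\<lambda>e. e \<in> bs x) (cl ?\<alpha>)) = X"
      proof -
        have "set (filter (\<lambda>e. e \<in> bs x) (cl ?\<alpha>)) = act ?\<alpha> x" using Ec_in by (auto simp: cl)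
        moreover have "bdry (filter (\<lambda>e. e \<in> bs x) (cl ?\<alpha>)) = \<Union>(set (filter (\<lambda>e. e \<in> bs x) (cl ?\<alpha>)))"
          by (rule bdry_cl) (auto simp: cl)
        ultimately show ?thesis unfolding X_def by (simp only:)
      qed
      have fo: "finite (occ K x)" by (simp add: occ_def)
      have "enc k \<psi> x = flips_of (filter (\<lambda>e. e \<in> bs x) (cl ?\<alpha>)) (flips_of (sel (bs x) ?\<alpha>) \<psi>) (occ K x)"
        using True k by (simp add: enc_def above_Suc)
      also have "\<dots> = invsign (rank ?\<alpha>) (occ K x) * invsign (rank ?\<alpha>) (occ K x \<ominus> X) * flips_of (sel (bs x) ?\<alpha>) \<psi> (occ K x \<ominus> X)"
      proof -
        have "set (filter (\<lambda>e. e \<in> bs x) (cl ?\<alpha>)) \<subseteq> Ec ?\<alpha>" by (auto simp: cl)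
        from flips_of_color[OF this fo] show ?thesis unfolding b .
      qed
      also have "flips_of (sel (bs x) ?\<alpha>) \<psi> (occ K x \<ominus> X) = enc ?\<alpha> \<psi> y"
      proof -
        have "y \<subseteq> P ` K \<union> B ` {e \<in> E. ?\<alpha> < col e}" using True dom by blast
        then show ?thesis unfolding enc_def s o by (simp only: if_True)
      qed
      finally show ?thesis by (simp add: G4 G2_def G1_def o(2) flip: X_def y_def)
    next
      case False
      then have "enc ?\<alpha> \<psi> y = 0" using dom by (simp add: enc_def)
      then have "G4 \<psi> x = 0" by (simp add: G4 G2_def G1_def flip: X_def y_def)
      then show ?thesis using False by (simp add: enc_def)
    qed
  qed
  ultimately have r5: "reach W (L * 11) G4 (enc k)" by (rule reach_eq) simp
  show ?thesis
    by (rule reach_eq[OF reach_trans[OF r1 reach_trans[OF r2 reach_trans[OF r4 r5]]] refl]) simp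
qed

lemma reach_enc:
  assumes "\<And>\<alpha> i. i \<in> K \<Longrightarrow> rank \<alpha> i < 2 ^ L"
  shows "reach W (\<chi> * (22 * L + 3)) (enc \<chi>) (enc 0)"
  by (rule reach_down[where F = enc]) (use assms reach_enc_step in auto)

section \<open>Conversion of the site qubits to true occupations\<close>

lemma bs_shift: "reg c \<Longrightarrow> bs (x \<ominus> c ` X) = bs x"
  by (auto simp: reg_def)

lemma act_bs: "act \<alpha> x = {e \<in> Ec \<alpha>. e \<in> bs x}"
  using Ec_in by auto

lemma conv_step:
  "cnots (ends P Min (Suc k)) (conv (Suc k) l \<psi>) = conv k l \<psi>"
  "cnots (ends P Max (Suc k)) (conv j (Suc k) \<psi>) = conv j k \<psi>"
proof -
  have d: "x \<ominus> P ` q ` act (Suc k) x \<subseteq> P ` K \<union> B ` E \<longleftrightarrow> x \<subseteq> P ` K \<union> B ` E" if "q = Min \<or> q = Max" for x q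
  proof -
    have "P ` q ` act (Suc k) x \<subseteq> P ` K" using ends_K[OF that] by blast
    then show ?thesis by (rule sdiff_subset_iff[OF subset_trans[OF _ Un_upper1]])
  qed
  show "cnots (ends P Min (Suc k)) (conv (Suc k) l \<psi>) = conv k l \<psi>"
  proof
    fix x
    have "late Min k (bs x) = late Min (Suc k) (bs x) \<ominus> Min ` act (Suc k) x"
      unfolding act_bs by (rule late_step[OF inj_lo])
    then have "occ K x \<ominus> Min ` act (Suc k) x \<ominus> (late Min (Suc k) (bs x) \<ominus> late Max l (bs x))
       = occ K x \<ominus> (late Min k (bs x) \<ominus> late Max l (bs x))" by (simp add: sdiff_ac)
    then show "cnots (ends P Min (Suc k)) (conv (Suc k) l \<psi>) x = conv k l \<psi> x"
      unfolding cnots_ends[OF regs(1)] conv_def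
      by (simp only: d disj_ac simp_thms bs_shift regs occ_shift[OF ends_K[of Min]])
  qed
  show "cnots (ends P Max (Suc k)) (conv j (Suc k) \<psi>) = conv j k \<psi>"
  proof
    fix x
    have "late Max k (bs x) = late Max (Suc k) (bs x) \<ominus> Max ` act (Suc k) x"
      unfolding act_bs by (rule late_step[OF inj_hi])
    then have "occ K x \<ominus> Max ` act (Suc k) x \<ominus> (late Min j (bs x) \<ominus> late Max (Suc k) (bs x))
       = occ K x \<ominus> (late Min j (bs x) \<ominus> late Max k (bs x))" by (simp add: sdiff_ac)
    then show "cnots (ends P Max (Suc k)) (conv j (Suc k) \<psi>) x = conv j k \<psi> x"
      unfolding cnots_ends[OF regs(1)] conv_def
      by (simp only: d disj_ac simp_thms bs_shift regs occ_shift[OF ends_K[of Max]])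
  qed
qed

lemma enc_conv: "enc 0 = conv \<chi> \<chi>"
proof -
  have "{e \<in> E. 0 < col e} = E" using col_range by fastforce
  moreover have "late q \<chi> b = {}" for q b by (rule late_top) simp
  ultimately show ?thesis unfolding enc_def conv_def by (intro ext) simp
qed

lemma conv_stage: "conv 0 0 = stage \<chi> \<chi>"
proof (intro ext)
  fix \<psi> x
  have "x \<subseteq> P ` K \<union> B ` E \<longleftrightarrow> x \<subseteq> W \<and> {i \<in> K. U i \<in> x} = {} \<and> {i \<in> K. V i \<in> x} = {}"
    unfolding W_def by blast
  then show "conv 0 0 \<psi> x = stage \<chi> \<chi> \<psi> x"
    unfolding conv_def stage_def bdry_above by (simp only: late_top[OF order_refl])
qed

lemma reach_conv: "reach W (\<chi> * 2) (enc 0) (stage \<chi> \<chi>)"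
proof -
  have "reach W (\<chi> * 2) (conv \<chi> \<chi>) (conv 0 0)"
  proof (rule reach_down)
    fix k
    have a: "reach W 1 (conv (Suc k) (Suc k)) (conv k (Suc k))"
      using reach_ends[of P Min "conv (Suc k) (Suc k)" "Suc k"] by (simp add: conv_step)
    have b: "reach W 1 (conv k (Suc k)) (conv k k)"
      using reach_ends[of P Max "conv k (Suc k)" "Suc k"] by (simp add: conv_step)
    show "reach W 2 (conv (Suc k) (Suc k)) (conv k k)" using reach_trans[OF a b] by (simp add: numeral_2_eq_2)
  qed
  then show ?thesis by (simp only: enc_conv conv_stage)
qed

section \<open>One step of the evolution\<close>

abbreviation sg :: "bool \<Rightarrow> complex" where
  "sg p \<equiv> (if p then - 1 else 1)"

text \<open>\<open>R\<close> is the occupation after \<open>T b\<close> and \<open>S\<close> the one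
  before. As \<open>T b\<close> is a Pauli operator, the test of \<open>rot\<close> is evaluated at
  \<open>S\<close>, which is why the site qubits are converted to show \<open>S\<close>.\<close>

lemma flips_of_rot:
  assumes e: "e \<in> E" and S: "R \<ominus> bdry (sel b 0) = S"
  shows "flips_of (sel b 0) (rot \<theta> e \<psi>) R = (if (lo e \<in> S) \<noteq> (hi e \<in> S)
     then of_real (cos \<theta>) * flips_of (sel b 0) \<psi> R - \<i> * of_real (sin \<theta>) *
       (sg (lo e \<in> late Min (col e) b) * sg (hi e \<in> late Max (col e) b) * flips_of (sel (b \<ominus> {e}) 0) \<psi> R)
     else flips_of (sel b 0) \<psi> R)"
proof -
  obtain \<epsilon> Z where p: "\<And>\<psi> S. flips_of (sel b 0) \<psi> S = \<epsilon> * psign (S \<inter> Z) * \<psi> (S \<ominus> bdry (sel b 0))"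
    using flips_of_pauli[of "sel b 0"] edges_above by metis
  have "sg (lo e \<in> late Min (col e) b) * sg (hi e \<in> late Max (col e) b) * flips_of (sel (b \<ominus> {e}) 0) \<psi> R
    = flips_of (sel b 0) (flip e \<psi>) R"
    unfolding flips_absorb[OF e] scale_def ..
  then show ?thesis unfolding p S by (auto simp: rot_def algebra_simps)
qed

text \<open>Toggling \<open>e\<close> changes the boundary of \<open>b\<close> by \<open>e\<close>,
  and flipping the two end qubits compensates this, so \<open>R\<close> stays fixed. The rotation
  thus couples \<open>x\<close> to one partner only, with signs that stand in the registers at the
  ends of \<open>e\<close>.\<close>

lemma stage_rot:
  assumes e: "e \<in> E"
  shows "stage (col e) (col e) (rot \<theta> e \<psi>) x = (if (P (lo e) \<in> x) \<noteq> (P (hi e) \<in> x)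
     then of_real (cos \<theta>) * stage (col e) (col e) \<psi> x - \<i> * of_real (sin \<theta>) *
       (sg (U (lo e) \<in> x) * sg (V (hi e) \<in> x) * stage (col e) (col e) \<psi> (x \<ominus> {B e} \<ominus> P ` e))
     else stage (col e) (col e) \<psi> x)"
proof -
  let ?c = "col e"
  let ?C = "\<lambda>x. x \<subseteq> W \<and> {i \<in> K. U i \<in> x} = late Min ?c (bs x) \<and> {i \<in> K. V i \<in> x} = late Max ?c (bs x)"
  define y where "y = x \<ominus> {B e} \<ominus> P ` e"
  have sub: "{B e} \<subseteq> W" "P ` e \<subseteq> W" using e edge_K[OF e] by (auto simp: W_def)
  have yW: "y \<subseteq> W \<longleftrightarrow> x \<subseteq> W"
    unfolding y_def by (simp only: sdiff_subset_iff[OF sub(2)] sdiff_subset_iff[OF sub(1)])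
  have bsy: "bs y = bs x \<ominus> {e}" using e by (auto simp: y_def)
  \<comment> \<open>Only colors strictly above that of \<open>e\<close> enter, so toggling
    \<open>e\<close> leaves the register contents valid.\<close>
  have ly: "late q ?c (bs y) = late q ?c (bs x)" for q
  proof -
    have "{f \<in> E. f \<in> bs y \<and> ?c < col f \<and> q f = i} = {f \<in> E. f \<in> bs x \<and> ?c < col f \<and> q f = i}" for i
      unfolding bsy by auto
    then show ?thesis by (simp only: late_def)
  qed
  have uy: "{i \<in> K. U i \<in> y} = {i \<in> K. U i \<in> x}" "{i \<in> K. V i \<in> y} = {i \<in> K. V i \<in> x}" by (auto simp: y_def)
  have Cy: "?C y \<longleftrightarrow> ?C x" by (simp only: yW ly uy)
  show ?thesis
  proof (cases "?C x")
    case False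
    then have "stage ?c ?c \<phi> x = 0" "stage ?c ?c \<phi> y = 0" for \<phi>
      unfolding stage_def using Cy by (simp_all only: if_False)
    then show ?thesis unfolding y_def[symmetric] by simp
  next
    case True
    define R where "R = occ K x \<ominus> bdry (sel (bs x) 0)"
    have RS: "R \<ominus> bdry (sel (bs x) 0) = occ K x" by (simp add: R_def)
    have oy: "occ K y = occ K x \<ominus> e" using edge_K[OF e] by (auto simp: y_def)
    have "occ K y \<ominus> bdry (sel (bs y) 0) = R"
      unfolding bsy bdry_sel_toggle[OF e] oy R_def by (simp add: sdiff_ac)
    then have sy: "stage ?c ?c \<psi> y = flips_of (sel (bs x \<ominus> {e}) 0) \<psi> R"
      unfolding stage_def using True Cy by (simp only: if_True simp_thms bsy)
    have sx: "stage ?c ?c \<phi> x = flips_of (sel (bs x) 0) \<phi> R" for \<phi>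
      unfolding stage_def using True by (simp only: if_True simp_thms R_def)
    have l: "lo e \<in> late Min ?c (bs x) \<longleftrightarrow> U (lo e) \<in> x" "hi e \<in> late Max ?c (bs x) \<longleftrightarrow> V (hi e) \<in> x"
      using True lo_hi_K[OF e] by blast+
    have o: "lo e \<in> occ K x \<longleftrightarrow> P (lo e) \<in> x" "hi e \<in> occ K x \<longleftrightarrow> P (hi e) \<in> x"
      using lo_hi_K[OF e] by simp_all
    show ?thesis unfolding y_def[symmetric] sx sy flips_of_rot[OF e RS] l o ..
  qed
qed

text \<open>A change of basis for one color. The CZ gates absorb the signs held in \<open>U\<close>
  and \<open>V\<close>; the CNOTs from the edge qubit make toggling it carry along the flips at both
  ends; the last CNOT writes the parity of the ends into \<open>P (hi e)\<close>. After it, every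
  rotation is a gate on \<open>P (hi e)\<close> and \<open>B e\<close> alone.\<close>

definition prepare :: "nat \<Rightarrow> wire ket \<Rightarrow> wire ket" where
  "prepare \<alpha> \<phi> = cnots ((\<lambda>e. (P (lo e), P (hi e))) ` Ec \<alpha>)
     (cnots (ends P Max \<alpha>) (cnots (ends P Min \<alpha>)
       (czs ((\<lambda>e. (V (hi e), B e)) ` Ec \<alpha>) (czs ((\<lambda>e. (U (lo e), B e)) ` Ec \<alpha>) \<phi>))))"

definition unprepare :: "nat \<Rightarrow> wire ket \<Rightarrow> wire ket" where
  "unprepare \<alpha> \<phi> = czs ((\<lambda>e. (U (lo e), B e)) ` Ec \<alpha>) (czs ((\<lambda>e. (V (hi e), B e)) ` Ec \<alpha>)
     (cnots (ends P Min \<alpha>) (cnots (ends P Max \<alpha>)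
       (cnots ((\<lambda>e. (P (lo e), P (hi e))) ` Ec \<alpha>) \<phi>))))"

lemma pair_ok:
  "finite ((\<lambda>e. (P (lo e), P (hi e))) ` Ec \<alpha>)"
  "disjoint_pairs ((\<lambda>e. (P (lo e), P (hi e))) ` Ec \<alpha>)"
  "fst ` (\<lambda>e. (P (lo e), P (hi e))) ` Ec \<alpha> \<union> snd ` (\<lambda>e. (P (lo e), P (hi e))) ` Ec \<alpha> \<subseteq> W"
  "fst ` (\<lambda>e. (P (lo e), P (hi e))) ` Ec \<alpha> \<inter> snd ` (\<lambda>e. (P (lo e), P (hi e))) ` Ec \<alpha> = {}"
proof -
  show "finite ((\<lambda>e. (P (lo e), P (hi e))) ` Ec \<alpha>)" by simp
  have i: "inj_on (\<lambda>e. P (lo e)) (Ec \<alpha>)" "inj_on (\<lambda>e. P (hi e)) (Ec \<alpha>)"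
    using inj_lo inj_hi by (auto simp: inj_on_def)
  show "disjoint_pairs ((\<lambda>e. (P (lo e), P (hi e))) ` Ec \<alpha>)"
    by (rule disjoint_pairs_image[OF i]) (use lo_neq_hi in auto)
  have "P (lo e) \<in> W \<and> P (hi e) \<in> W" if "e \<in> Ec \<alpha>" for e
    using lo_hi_K[OF Ec_in[OF that]] by (auto simp: W_def)
  then show "fst ` (\<lambda>e. (P (lo e), P (hi e))) ` Ec \<alpha> \<union> snd ` (\<lambda>e. (P (lo e), P (hi e))) ` Ec \<alpha> \<subseteq> W" by auto
  show "fst ` (\<lambda>e. (P (lo e), P (hi e))) ` Ec \<alpha> \<inter> snd ` (\<lambda>e. (P (lo e), P (hi e))) ` Ec \<alpha> = {}"
    using lo_neq_hi by auto
qed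

lemma reach_prepare: "reach W 5 F (\<lambda>a. prepare \<alpha> (F a))"
  unfolding prepare_def
  by (rule reach_eq[OF reach_trans[OF reach_czs reach_trans[OF reach_czs
        reach_trans[OF reach_ends reach_trans[OF reach_ends reach_cnots]]]] refl])
     (use pair_ok ends_ok[of U Min \<alpha>] ends_ok[of V Max \<alpha>] in auto)

lemma reach_unprepare: "reach W 5 F (\<lambda>a. unprepare \<alpha> (F a))"
  unfolding unprepare_def
  by (rule reach_eq[OF reach_trans[OF reach_cnots reach_trans[OF reach_ends
        reach_trans[OF reach_ends reach_trans[OF reach_czs reach_czs]]]] refl])
     (use pair_ok ends_ok[of U Min \<alpha>] ends_ok[of V Max \<alpha>] in auto)

lemma unprepare_prepare: "unprepare \<alpha> (prepare \<alpha> \<phi>) = \<phi>"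
  unfolding unprepare_def prepare_def
  by (simp only: cnots_cnots[OF pair_ok(4)] cnots_cnots[OF ends_ok(4)[OF regs(1)]] czs_czs simp_thms)

text \<open>The basis state at which \<open>prepare\<close> reads the amplitude for
  \<open>x\<close>: all CNOT layers combined into one shift, the CZ layers being collected in
  \<open>sgn_of\<close>.\<close>

definition read :: "nat \<Rightarrow> wire set \<Rightarrow> wire set" where
  "read \<alpha> x = x \<ominus> P ` (Max ` {e \<in> Ec \<alpha>. P (lo e) \<in> x} \<ominus> Max ` act \<alpha> x \<ominus> Min ` act \<alpha> x)"

definition sgn_of :: "nat \<Rightarrow> wire set \<Rightarrow> complex" where
  "sgn_of \<alpha> x = psign {e \<in> Ec \<alpha>. U (lo e) \<in> x \<and> B e \<in> x} * psign {e \<in> Ec \<alpha>. V (hi e) \<in> x \<and> B e \<in> x}"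

lemma prepare_eq: "prepare \<alpha> \<phi> x = sgn_of \<alpha> x * \<phi> (read \<alpha> x)"
proof -
  have c: "psign {p \<in> (\<lambda>e. (f e, B e)) ` Ec \<alpha>. fst p \<in> y \<and> snd p \<in> y} = psign {e \<in> Ec \<alpha>. f e \<in> y \<and> B e \<in> y}" for f y
  proof -
    have "{p \<in> (\<lambda>e. (f e, B e)) ` Ec \<alpha>. fst p \<in> y \<and> snd p \<in> y} = (\<lambda>e. (f e, B e)) ` {e \<in> Ec \<alpha>. f e \<in> y \<and> B e \<in> y}" by auto
    moreover have "inj_on (\<lambda>e. (f e, B e)) {e \<in> Ec \<alpha>. f e \<in> y \<and> B e \<in> y}" by (simp add: inj_on_def)
    ultimately show ?thesis by (simp only: psign_image)
  qed
  define y where "y = x \<ominus> P ` Max ` {e \<in> Ec \<alpha>. P (lo e) \<in> x}"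
  have ay: "act \<alpha> y = act \<alpha> x" unfolding y_def by (rule act_shift) simp
  have r: "read \<alpha> x = y \<ominus> P ` Max ` act \<alpha> y \<ominus> P ` Min ` act \<alpha> y"
    unfolding read_def y_def ay[unfolded y_def] by (simp add: image_sdiff inj_def sdiff_assoc)
  have m: "U i \<in> read \<alpha> x \<longleftrightarrow> U i \<in> x" "V i \<in> read \<alpha> x \<longleftrightarrow> V i \<in> x" "B e \<in> read \<alpha> x \<longleftrightarrow> B e \<in> x" for i e
    by (simp_all add: read_def)
  have f: "flips ((\<lambda>e. (P (lo e), P (hi e))) ` Ec \<alpha>) x = P ` Max ` {e \<in> Ec \<alpha>. P (lo e) \<in> x}"
    unfolding flips_image by (simp add: image_image)
  have "prepare \<alpha> \<phi> x = czs ((\<lambda>e. (V (hi e), B e)) ` Ec \<alpha>) (czs ((\<lambda>e. (U (lo e), B e)) ` Ec \<alpha>) \<phi>) (read \<alpha> x)"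
    unfolding prepare_def cnots_def[of "(\<lambda>e. (P (lo e), P (hi e))) ` Ec \<alpha>"] f
    unfolding y_def[symmetric] cnots_ends[OF regs(1)] act_shift[OF regs(1)] r ..
  then show ?thesis unfolding czs_def c by (simp add: sgn_of_def m)
qed

lemma read_edge:
  assumes e: "e \<in> Ec \<alpha>"
  shows "P (lo e) \<in> read \<alpha> x \<longleftrightarrow> (P (lo e) \<in> x) \<noteq> (B e \<in> x)"
    and "P (hi e) \<in> read \<alpha> x \<longleftrightarrow> ((P (hi e) \<in> x) \<noteq> (P (lo e) \<in> x)) \<noteq> (B e \<in> x)"
    and "read \<alpha> (x \<ominus> {B e}) = read \<alpha> x \<ominus> {B e} \<ominus> P ` e"
proof -
  have lo: "lo e \<in> Min ` Z \<longleftrightarrow> e \<in> Z" "lo e \<notin> Max ` Z" if "Z \<subseteq> Ec \<alpha>" for Z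
    using inj_on_image_mem_iff[OF inj_lo e that] lo_neq_hi e that by auto
  have hi: "hi e \<in> Max ` Z \<longleftrightarrow> e \<in> Z" "hi e \<notin> Min ` Z" if "Z \<subseteq> Ec \<alpha>" for Z
  proof -
    show "hi e \<in> Max ` Z \<longleftrightarrow> e \<in> Z" by (rule inj_on_image_mem_iff[OF inj_hi e that])
    show "hi e \<notin> Min ` Z"
    proof
      assume "hi e \<in> Min ` Z"
      then obtain f where f: "f \<in> Z" "hi e = lo f" by blast
      then show False using lo_neq_hi[OF subsetD[OF that f(1)] e] by simp
    qed
  qed
  let ?Y = "{e \<in> Ec \<alpha>. P (lo e) \<in> x}"
  have sub: "act \<alpha> x \<subseteq> Ec \<alpha>" "?Y \<subseteq> Ec \<alpha>" by auto
  show "P (lo e) \<in> read \<alpha> x \<longleftrightarrow> (P (lo e) \<in> x) \<noteq> (B e \<in> x)"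
    using lo[OF sub(1)] lo[OF sub(2)] e by (simp add: read_def)
  show "P (hi e) \<in> read \<alpha> x \<longleftrightarrow> ((P (hi e) \<in> x) \<noteq> (P (lo e) \<in> x)) \<noteq> (B e \<in> x)"
    using hi[OF sub(1)] hi[OF sub(2)] e by (auto simp: read_def)
  have a: "act \<alpha> (x \<ominus> {B e}) = act \<alpha> x \<ominus> {e}" using e by auto
  have i: "q ` (act \<alpha> x \<ominus> {e}) = q ` act \<alpha> x \<ominus> {q e}" if "inj_on q (Ec \<alpha>)" for q :: "nat set \<Rightarrow> nat"
    using inj_on_image_sdiff[OF that sub(1), of "{e}"] e by simp
  have ee: "P ` e = P ` ({lo e} \<ominus> {hi e})"
  proof -
    have E: "e \<in> E" using e by (rule Ec_in)
    have "{lo e} \<ominus> {hi e} = {lo e, hi e}" using lo_hi_neq[OF E] by auto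
    then show ?thesis using edge_eq[OF edgeE[OF E]] by simp
  qed
  have Y: "{f \<in> Ec \<alpha>. P (lo f) \<in> x \<ominus> {B e}} = ?Y" by auto
  show "read \<alpha> (x \<ominus> {B e}) = read \<alpha> x \<ominus> {B e} \<ominus> P ` e"
    unfolding read_def Y a i[OF inj_lo] i[OF inj_hi] ee by (simp add: image_sdiff inj_def sdiff_ac)
qed

lemma sgn_of_toggle:
  assumes e: "e \<in> Ec \<alpha>"
  shows "sgn_of \<alpha> (x \<ominus> {B e}) = sgn_of \<alpha> x * (sg (U (lo e) \<in> x) * sg (V (hi e) \<in> x))"
proof -
  have *: "psign {f \<in> Ec \<alpha>. g f \<in> x \<ominus> {B e} \<and> B f \<in> x \<ominus> {B e}} = psign {f \<in> Ec \<alpha>. g f \<in> x \<and> B f \<in> x} * sg (g e \<in> x)"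
    if "\<And>f. g f \<noteq> B e" for g
  proof -
    have "{f \<in> Ec \<alpha>. g f \<in> x \<ominus> {B e} \<and> B f \<in> x \<ominus> {B e}} =
      {f \<in> Ec \<alpha>. g f \<in> x \<and> B f \<in> x} \<ominus> (if g e \<in> x then {e} else {})"
      using that e by auto
    then show ?thesis by (simp add: psign_sdiff) (simp add: psign_def)
  qed
  have u: "psign {f \<in> Ec \<alpha>. U (lo f) \<in> x \<ominus> {B e} \<and> B f \<in> x \<ominus> {B e}} =
      psign {f \<in> Ec \<alpha>. U (lo f) \<in> x \<and> B f \<in> x} * sg (U (lo e) \<in> x)"
    by (rule *) simp
  have v: "psign {f \<in> Ec \<alpha>. V (hi f) \<in> x \<ominus> {B e} \<and> B f \<in> x \<ominus> {B e}} =
      psign {f \<in> Ec \<alpha>. V (hi f) \<in> x \<and> B f \<in> x} * sg (V (hi e) \<in> x)"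
    by (rule *) simp
  show ?thesis unfolding sgn_of_def u v by (simp only: mult_ac)
qed

lemma crot_stage:
  assumes e: "e \<in> Ec \<alpha>"
  shows "app (crot \<theta> (P (hi e)) (B e)) (prepare \<alpha> (stage \<alpha> \<alpha> \<psi>)) = prepare \<alpha> (stage \<alpha> \<alpha> (rot \<theta> e \<psi>))"
proof
  fix x
  have E: "e \<in> E" "col e = \<alpha>" using e by (auto simp: in_Ec)
  have m: "U i \<in> read \<alpha> x \<longleftrightarrow> U i \<in> x" "V i \<in> read \<alpha> x \<longleftrightarrow> V i \<in> x" for i
    by (simp_all add: read_def)
  have odd: "(P (lo e) \<in> read \<alpha> x) \<noteq> (P (hi e) \<in> read \<alpha> x) \<longleftrightarrow> P (hi e) \<in> x"
    unfolding read_edge[OF e] by blast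
  show "app (crot \<theta> (P (hi e)) (B e)) (prepare \<alpha> (stage \<alpha> \<alpha> \<psi>)) x = prepare \<alpha> (stage \<alpha> \<alpha> (rot \<theta> e \<psi>)) x"
    unfolding app_crot[of "P (hi e)" "B e", simplified] prepare_eq sgn_of_toggle[OF e] read_edge(3)[OF e]
      stage_rot[OF E(1), of _ _ "read \<alpha> x", unfolded E(2)] odd m
    by (simp add: algebra_simps)
qed

definition rots :: "(nat set \<Rightarrow> real) \<Rightarrow> nat \<Rightarrow> nat ket \<Rightarrow> nat ket" where
  "rots \<theta> \<alpha> = fold (\<lambda>e. rot (\<theta> e) e) (cl \<alpha>)"

lemma reach_rots: "reach W 1 (\<lambda>\<psi>. prepare \<alpha> (stage \<alpha> \<alpha> \<psi>)) (\<lambda>\<psi>. prepare \<alpha> (stage \<alpha> \<alpha> (rots \<theta> \<alpha> \<psi>)))"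
proof -
  let ?g = "\<lambda>e. crot (\<theta> e) (P (hi e)) (B e)"
  have fst: "fst (?g e) = {P (hi e), B e}" for e by (simp add: crot_def)
  have "gates_ok W (map ?g (cl \<alpha>))"
  proof (rule gates_ok_map[OF cl])
    fix e assume e: "e \<in> Ec \<alpha>"
    have "P (hi e) \<in> W" "B e \<in> W" using lo_hi_K[OF Ec_in[OF e]] Ec_in[OF e] by (auto simp: W_def)
    then show "card (fst (?g e)) \<in> {1, 2} \<and> fst (?g e) \<subseteq> W \<and> unitary_mat (fst (?g e)) (snd (?g e))"
      by (intro conjI unitary_crot) (simp_all add: fst)
  next
    fix e f assume "e \<in> Ec \<alpha>" "f \<in> Ec \<alpha>" "e \<noteq> f"
    moreover from this have "hi e \<noteq> hi f" using inj_hi by (auto dest: inj_onD)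
    ultimately show "fst (?g e) \<inter> fst (?g f) = {}" by (auto simp: fst)
  qed
  moreover have "fold app (map ?g es) (prepare \<alpha> (stage \<alpha> \<alpha> \<psi>)) = prepare \<alpha> (stage \<alpha> \<alpha> (fold (\<lambda>e. rot (\<theta> e) e) es \<psi>))"
    if "set es \<subseteq> Ec \<alpha>" for es \<psi>
    using that by (induction es arbitrary: \<psi>) (auto simp: crot_stage)
  then have "fold app (map ?g (cl \<alpha>)) (prepare \<alpha> (stage \<alpha> \<alpha> \<psi>)) = prepare \<alpha> (stage \<alpha> \<alpha> (rots \<theta> \<alpha> \<psi>))" for \<psi>
    unfolding rots_def using cl by blast
  then have "reach W 0 (\<lambda>\<psi>. fold app (map ?g (cl \<alpha>)) (prepare \<alpha> (stage \<alpha> \<alpha> \<psi>)))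
      (\<lambda>\<psi>. prepare \<alpha> (stage \<alpha> \<alpha> (rots \<theta> \<alpha> \<psi>)))"
    by (simp only: reach_refl)
  ultimately show ?thesis using reach.gates by fastforce
qed

lemma stage_step:
  "cnots (ends U Min (Suc k)) (stage (Suc k) l \<psi>) = stage k l \<psi>"
  "cnots (ends V Max (Suc k)) (stage j (Suc k) \<psi>) = stage j k \<psi>"
proof -
  have W: "x \<ominus> c ` q ` act (Suc k) x \<subseteq> W \<longleftrightarrow> x \<subseteq> W" if "reg c" "q = Min \<or> q = Max" for x c q
    using ends_K[OF that(2), of "Suc k" x] reg_props(3)[OF that(1)] by (intro sdiff_subset_iff) blast
  have eq: "A \<ominus> X = L \<longleftrightarrow> A = L \<ominus> X" for A L X :: "nat set" by auto
  show "cnots (ends U Min (Suc k)) (stage (Suc k) l \<psi>) = stage k l \<psi>"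
  proof
    fix x
    let ?X = "Min ` act (Suc k) x"
    have X: "?X \<subseteq> K" by (rule ends_K) simp
    have s: "{i \<in> K. U i \<in> x \<ominus> U ` ?X} = {i \<in> K. U i \<in> x} \<ominus> ?X" "{i \<in> K. V i \<in> x \<ominus> U ` ?X} = {i \<in> K. V i \<in> x}"
      "occ K (x \<ominus> U ` ?X) = occ K x" using subsetD[OF X] by (auto simp del: in_act)
    have l: "late Min k (bs x) = late Min (Suc k) (bs x) \<ominus> ?X"
      unfolding act_bs by (rule late_step[OF inj_lo])
    show "cnots (ends U Min (Suc k)) (stage (Suc k) l \<psi>) x = stage k l \<psi> x"
      unfolding cnots_ends[OF regs(2)] stage_def bs_shift[OF regs(2)] W[OF regs(2) disjI1[OF refl]] s l eq ..
  qed
  show "cnots (ends V Max (Suc k)) (stage j (Suc k) \<psi>) = stage j k \<psi>"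
  proof
    fix x
    let ?X = "Max ` act (Suc k) x"
    have X: "?X \<subseteq> K" by (rule ends_K) simp
    have s: "{i \<in> K. V i \<in> x \<ominus> V ` ?X} = {i \<in> K. V i \<in> x} \<ominus> ?X" "{i \<in> K. U i \<in> x \<ominus> V ` ?X} = {i \<in> K. U i \<in> x}"
      "occ K (x \<ominus> V ` ?X) = occ K x" using subsetD[OF X] by (auto simp del: in_act)
    have l: "late Max k (bs x) = late Max (Suc k) (bs x) \<ominus> ?X"
      unfolding act_bs by (rule late_step[OF inj_hi])
    show "cnots (ends V Max (Suc k)) (stage j (Suc k) \<psi>) x = stage j k \<psi> x"
      unfolding cnots_ends[OF regs(3)] stage_def bs_shift[OF regs(3)] W[OF regs(3) disjI2[OF refl]] s l eq ..
  qed
qed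

lemma stage_back:
  "cnots (ends U Min (Suc k)) (stage k l \<psi>) = stage (Suc k) l \<psi>"
  "cnots (ends V Max (Suc k)) (stage j k \<psi>) = stage j (Suc k) \<psi>"
proof -
  show "cnots (ends U Min (Suc k)) (stage k l \<psi>) = stage (Suc k) l \<psi>"
    unfolding stage_step(1)[symmetric, of k l] by (rule cnots_cnots[OF ends_ok(4)]) auto
  show "cnots (ends V Max (Suc k)) (stage j k \<psi>) = stage j (Suc k) \<psi>"
    unfolding stage_step(2)[symmetric, of j k] by (rule cnots_cnots[OF ends_ok(4)]) auto
qed

text \<open>The layers are 5 + 1 + 5 for the conjugated rotations, and 1 + 1 to add the color just
  treated to \<open>U\<close> and \<open>V\<close>, for which it is now a later color.\<close>

lemma reach_stage:
  "reach W 13 (stage (Suc k) (Suc k)) (\<lambda>\<psi>. stage k k (rots \<theta> (Suc k) \<psi>))"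
proof -
  let ?s = "stage (Suc k) (Suc k)" and ?r = "rots \<theta> (Suc k)"
  have 1: "reach W 5 ?s (\<lambda>\<psi>. prepare (Suc k) (?s \<psi>))" by (rule reach_prepare)
  have 2: "reach W 5 (\<lambda>\<psi>. prepare (Suc k) (?s (?r \<psi>))) (\<lambda>\<psi>. ?s (?r \<psi>))"
    using reach_unprepare[of "\<lambda>\<psi>. prepare (Suc k) (?s (?r \<psi>))" "Suc k"] by (simp only: unprepare_prepare)
  have 3: "reach W 1 (\<lambda>\<psi>. ?s (?r \<psi>)) (\<lambda>\<psi>. stage k (Suc k) (?r \<psi>))"
    using reach_ends[of U Min "\<lambda>\<psi>. ?s (?r \<psi>)" "Suc k"] by (simp only: stage_step regs simp_thms)
  have 4: "reach W 1 (\<lambda>\<psi>. stage k (Suc k) (?r \<psi>)) (\<lambda>\<psi>. stage k k (?r \<psi>))"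
    using reach_ends[of V Max "\<lambda>\<psi>. stage k (Suc k) (?r \<psi>)" "Suc k"] by (simp only: stage_step regs simp_thms)
  show ?thesis
    by (rule reach_eq[OF reach_trans[OF 1 reach_trans[OF reach_rots reach_trans[OF 2 reach_trans[OF 3 4]]]] refl]) simp
qed

definition sweep :: "(nat set \<Rightarrow> real) \<Rightarrow> nat \<Rightarrow> nat ket \<Rightarrow> nat ket" where
  "sweep \<theta> k = foldr (rots \<theta>) [Suc k..<Suc \<chi>]"

text \<open>The Trotter product applies color \<chi> first. The registers, empty at \<chi>,
  therefore only have to gain the treated color each time. At the end they are cleared color by
  color, so the cost per color is 13 + 2.\<close>

lemma reach_sweep: "reach W (\<chi> * 15) (stage \<chi> \<chi>) (\<lambda>\<psi>. stage \<chi> \<chi> (sweep \<theta> 0 \<psi>))"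
proof -
  have "reach W (\<chi> * 13) (\<lambda>\<psi>. stage \<chi> \<chi> (sweep \<theta> \<chi> \<psi>)) (\<lambda>\<psi>. stage 0 0 (sweep \<theta> 0 \<psi>))"
  proof (rule reach_down[where F = "\<lambda>k \<psi>. stage k k (sweep \<theta> k \<psi>)"])
    fix k assume k: "k < \<chi>"
    have "sweep \<theta> k \<psi> = rots \<theta> (Suc k) (sweep \<theta> (Suc k) \<psi>)" for \<psi>
      unfolding sweep_def using k by (subst upt_conv_Cons) auto
    then show "reach W 13 (\<lambda>\<psi>. stage (Suc k) (Suc k) (sweep \<theta> (Suc k) \<psi>)) (\<lambda>\<psi>. stage k k (sweep \<theta> k \<psi>))"
      using reach_reindex[OF reach_stage[of k \<theta>], of "sweep \<theta> (Suc k)"] by simp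
  qed
  moreover have "reach W (\<chi> * 2) (\<lambda>\<psi>. stage 0 0 (sweep \<theta> 0 \<psi>)) (\<lambda>\<psi>. stage \<chi> \<chi> (sweep \<theta> 0 \<psi>))"
  proof (rule reach_iterate[where F = "\<lambda>k \<psi>. stage k k (sweep \<theta> 0 \<psi>)"])
    fix k
    have 1: "reach W 1 (stage k k) (stage (Suc k) k)"
      using reach_ends[of U Min "stage k k" "Suc k"] by (simp only: stage_back regs simp_thms)
    have 2: "reach W 1 (stage (Suc k) k) (stage (Suc k) (Suc k))"
      using reach_ends[of V Max "stage (Suc k) k" "Suc k"] by (simp only: stage_back regs simp_thms)
    show "reach W 2 (\<lambda>\<psi>. stage k k (sweep \<theta> 0 \<psi>)) (\<lambda>\<psi>. stage (Suc k) (Suc k) (sweep \<theta> 0 \<psi>))"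
      using reach_reindex[OF reach_trans[OF 1 2], of "sweep \<theta> 0"] by (simp add: numeral_2_eq_2)
  qed
  moreover have "sweep \<theta> \<chi> \<psi> = \<psi>" for \<psi> by (simp add: sweep_def)
  ultimately show ?thesis using reach_trans by (fastforce simp flip: distrib_left)
qed

lemma enc_top: "enc \<chi> \<psi> x = (if x \<subseteq> P ` K then \<psi> (occ K x) else 0)"
proof -
  have "{e \<in> E. \<chi> < col e} = {}" using col_range by fastforce
  moreover have "sel b \<chi> = []" for b by (simp add: above_top)
  ultimately show ?thesis unfolding enc_def by (simp only: image_empty Un_empty_right foldr.simps id_apply)
qed

text \<open>Measuring the edge qubits leaves a Pauli operator applied to the state, known from the outcome.\<close>

lemma reach_decode: "reach W 3 (stage \<chi> \<chi>) (enc \<chi>)"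
proof -
  have "reach W (Suc 2) (stage \<chi> \<chi>) (enc \<chi>)"
  proof (rule reach.meas[of "B ` E"])
    show "B ` E \<subseteq> W" by (auto simp: W_def)
    fix r assume r: "r \<subseteq> B ` E"
    then obtain b where b: "b \<subseteq> E" "r = B ` b" by (auto simp: subset_image_iff)
    define X where "X = bdry (sel b 0)"
    obtain \<epsilon> Z where Z: "finite Z" "\<And>\<psi> S. flips_of (sel b 0) \<psi> S = \<epsilon> * psign (S \<inter> Z) * \<psi> (S \<ominus> X)"
      using flips_of_pauli[of "sel b 0"] edges_above unfolding X_def by metis
    \<comment> \<open>The site qubits show the occupations before \<open>T b\<close>, so it is the Z
      part that has to be undone; the X gates on \<open>r\<close> reset the edge qubits.\<close>
    let ?F = "\<lambda>\<psi>. zs (P ` (Z \<inter> K)) (xs r (proj (B ` E) r (stage \<chi> \<chi> \<psi>)))"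
    have fr: "finite r" using r finite_E finite_subset by blast
    have r1: "reach W (1 + 1) (\<lambda>\<psi>. proj (B ` E) r (stage \<chi> \<chi> \<psi>)) ?F"
      by (rule reach_trans[OF reach_xs reach_zs]) (use r fr Z in \<open>auto simp: W_def\<close>)
    have "?F \<psi> = scale (\<epsilon> * psign (X \<inter> Z)) (enc \<chi> \<psi>)" for \<psi>
    proof
      fix x
      define y where "y = x \<ominus> r"
      have st: "stage \<chi> \<chi> \<psi> y = (if y \<subseteq> P ` K \<union> B ` E then flips_of (sel (bs y) 0) \<psi> (occ K y \<ominus> bdry (sel (bs y) 0)) else 0)"
        unfolding conv_stage[symmetric] conv_def bdry_above ..
      have oy: "occ K y = occ K x" unfolding y_def b(2) by auto
      have dom: "y \<inter> B ` E = r \<and> y \<subseteq> P ` K \<union> B ` E \<longleftrightarrow> x \<subseteq> P ` K"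
      proof -
        have "y \<inter> B ` E = (x \<inter> B ` E) \<ominus> r" unfolding y_def sdiff_Int using r by auto
        then have 1: "y \<inter> B ` E = r \<longleftrightarrow> x \<inter> B ` E = {}" by (metis sdiff_empty(2) sdiff_self(1,3))
        have "r \<subseteq> P ` K \<union> B ` E" using r by blast
        then have 2: "y \<subseteq> P ` K \<union> B ` E \<longleftrightarrow> x \<subseteq> P ` K \<union> B ` E" unfolding y_def by (rule sdiff_subset_iff)
        show ?thesis unfolding 1 2 by blast
      qed
      show "?F \<psi> x = scale (\<epsilon> * psign (X \<inter> Z)) (enc \<chi> \<psi>) x"
      proof (cases "x \<subseteq> P ` K")
        case True
        then have d: "y \<inter> B ` E = r" "y \<subseteq> P ` K \<union> B ` E" using dom by auto
        have "bs y = b"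
        proof (rule set_eqI)
          fix e
          have "e \<in> bs y \<longleftrightarrow> B e \<in> y \<inter> B ` E" by auto
          then show "e \<in> bs y \<longleftrightarrow> e \<in> b" unfolding d(1) b(2) by simp
        qed
        then have "stage \<chi> \<chi> \<psi> y = flips_of (sel b 0) \<psi> (occ K x \<ominus> X)"
          unfolding st oy X_def using d(2) by simp
        also have "\<dots> = \<epsilon> * psign ((occ K x \<ominus> X) \<inter> Z) * \<psi> (occ K x)" by (simp add: Z(2))
        also have "psign ((occ K x \<ominus> X) \<inter> Z) = psign (occ K x \<inter> Z) * psign (X \<inter> Z)"
          unfolding sdiff_Int by (rule psign_sdiff) (use Z in auto)
        finally have s: "stage \<chi> \<chi> \<psi> y = \<epsilon> * (psign (occ K x \<inter> Z) * psign (X \<inter> Z)) * \<psi> (occ K x)" .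
        have "x \<inter> P ` (Z \<inter> K) = P ` (occ K x \<inter> Z)" by auto
        then have "psign (x \<inter> P ` (Z \<inter> K)) = psign (occ K x \<inter> Z)" by (simp add: psign_image inj_on_def)
        then show ?thesis
          unfolding zs_def xs_def proj_def y_def[symmetric] using d(1) True by (simp add: s enc_top scale_def)
      next
        case False
        then have "\<not> (y \<inter> B ` E = r \<and> y \<subseteq> P ` K \<union> B ` E)" using dom by simp
        then have "proj (B ` E) r (stage \<chi> \<chi> \<psi>) y = 0" unfolding proj_def st by auto
        then show ?thesis unfolding zs_def xs_def y_def[symmetric] scale_def enc_top using False by simp
      qed
    qed
    then have "\<exists>z. ?F \<psi> = scale z (enc \<chi> \<psi>)" for \<psi> by blast
    then have r2: "reach W 0 ?F (enc \<chi>)" by (rule reach.stop)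
    show "reach W 2 (\<lambda>\<psi>. proj (B ` E) r (stage \<chi> \<chi> \<psi>)) (enc \<chi>)"
      by (rule reach_eq[OF reach_trans[OF r1 r2] refl]) simp
  qed
  then show ?thesis by (simp add: numeral_3_eq_3 numeral_2_eq_2)
qed

text \<open>Per color, 22 L + 3 layers encode and 2 convert the site qubits; each of the
  \<open>M\<close> sweeps takes 15 per color, and decoding takes 3 in all.\<close>

theorem reach_evolution:
  assumes "\<And>\<alpha> i. i \<in> K \<Longrightarrow> rank \<alpha> i < 2 ^ L"
  shows "reach W (\<chi> * (22 * L + 5) + M * (\<chi> * 15) + 3) (enc \<chi>) (\<lambda>\<psi>. enc \<chi> ((sweep \<theta> 0 ^^ M) \<psi>))"
proof -
  let ?s = "sweep \<theta> 0"
  have 1: "reach W (M * (\<chi> * 15)) (\<lambda>\<psi>. stage \<chi> \<chi> ((?s ^^ 0) \<psi>)) (\<lambda>\<psi>. stage \<chi> \<chi> ((?s ^^ M) \<psi>))"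
  proof (rule reach_iterate[where F = "\<lambda>m \<psi>. stage \<chi> \<chi> ((?s ^^ m) \<psi>)"])
    fix m
    show "reach W (\<chi> * 15) (\<lambda>\<psi>. stage \<chi> \<chi> ((?s ^^ m) \<psi>)) (\<lambda>\<psi>. stage \<chi> \<chi> ((?s ^^ Suc m) \<psi>))"
      using reach_reindex[OF reach_sweep[of \<theta>], of "?s ^^ m"] by simp
  qed
  have 1: "reach W (M * (\<chi> * 15)) (stage \<chi> \<chi>) (\<lambda>\<psi>. stage \<chi> \<chi> ((?s ^^ M) \<psi>))" using 1 by simp
  have 2: "reach W 3 (\<lambda>\<psi>. stage \<chi> \<chi> ((?s ^^ M) \<psi>)) (\<lambda>\<psi>. enc \<chi> ((?s ^^ M) \<psi>))"
    by (rule reach_reindex[OF reach_decode])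
  show ?thesis
    by (rule reach_eq[OF reach_trans[OF reach_enc[OF assms] reach_trans[OF reach_conv reach_trans[OF 1 2]]] refl])
       (simp_all add: algebra_simps)
qed

end

section \<open>Exponentials of sums of commuting operators\<close>

definition linear_op :: "('a ket \<Rightarrow> 'a ket) \<Rightarrow> bool" where
  "linear_op A \<longleftrightarrow> (\<forall>\<phi> \<psi>. A (\<lambda>x. \<phi> x + \<psi> x) = (\<lambda>x. A \<phi> x + A \<psi> x)) \<and>
     (\<forall>c \<phi>. A (\<lambda>x. c * \<phi> x) = (\<lambda>x. c * A \<phi> x))"

lemma linear_opD:
  assumes "linear_op A"
  shows "A (\<lambda>x. \<phi> x + \<psi> x) = (\<lambda>x. A \<phi> x + A \<psi> x)" "A (\<lambda>x. c * \<phi> x) = (\<lambda>x. c * A \<phi> x)"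
  using assms by (auto simp: linear_op_def)

lemma linear_op_comb:
  assumes "linear_op A"
  shows "A (\<lambda>x. a * \<phi> x + b * \<psi> x) = (\<lambda>x. a * A \<phi> x + b * A \<psi> x)"
  using linear_opD[OF assms] by simp

lemma linear_op_pow: "linear_op A \<Longrightarrow> linear_op (A ^^ n)"
  by (induction n) (auto simp: linear_op_def)

lemma linear_op_add: "linear_op A \<Longrightarrow> linear_op A' \<Longrightarrow> linear_op (\<lambda>\<psi> x. A \<psi> x + c * A' \<psi> x)"
  by (auto simp: linear_op_def algebra_simps fun_eq_iff)

lemma linear_op_sum_list:
  "(\<And>e. e \<in> set es \<Longrightarrow> linear_op (h e)) \<Longrightarrow> linear_op A \<Longrightarrow>
    linear_op (\<lambda>\<psi> x. A \<psi> x + (\<Sum>e\<leftarrow>es. c e * h e \<psi> x))"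
proof (induction es arbitrary: A)
  case (Cons e es)
  have "linear_op (\<lambda>\<psi> x. (A \<psi> x + c e * h e \<psi> x) + (\<Sum>e\<leftarrow>es. c e * h e \<psi> x))"
    by (rule Cons.IH[OF _ linear_op_add]) (use Cons.prems in auto)
  then show ?case by (simp add: add.assoc)
qed simp

text \<open>The exponential of -i \<theta> h for an \<open>h\<close> whose cube is \<open>h\<close>:
  all even powers from the second on equal the square, all odd powers equal \<open>h\<close>, and
  the series sums to cosine and sine.\<close>

definition rotation :: "('a ket \<Rightarrow> 'a ket) \<Rightarrow> real \<Rightarrow> 'a ket \<Rightarrow> 'a ket" where
  "rotation h \<theta> \<psi> = (\<lambda>x. \<psi> x + (of_real (cos \<theta>) - 1) * h (h \<psi>) x - \<i> * of_real (sin \<theta>) * h \<psi> x)"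

lemma linear_rotation:
  assumes "linear_op h"
  shows "linear_op (rotation h \<theta>)"
  unfolding linear_op_def rotation_def linear_opD[OF assms] by (auto simp: fun_eq_iff algebra_simps)

lemma linear_fold_rotation:
  "(\<And>e. e \<in> set es \<Longrightarrow> linear_op (h e)) \<Longrightarrow> linear_op (fold (\<lambda>e. rotation (h e) (\<theta> e)) es)"
proof (induction es)
  case (Cons e es)
  then have "linear_op (rotation (h e) (\<theta> e))" "linear_op (fold (\<lambda>e. rotation (h e) (\<theta> e)) es)"
    using linear_rotation by auto
  then show ?case by (simp add: linear_op_def)
qed (simp add: linear_op_def)

text \<open>Each summand has eigenvalues 0, 1 and -1 only; splitting a vector into joint eigenvectors
  reduces the exponential series to the scalar one.\<close>

lemma exp_commuting_sums:
  fixes h :: "'e \<Rightarrow> 'a ket \<Rightarrow> 'a ket"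
  assumes "\<And>e. e \<in> set es \<Longrightarrow> linear_op (h e)"
    and "\<And>e \<phi>. e \<in> set es \<Longrightarrow> h e (h e (h e \<phi>)) = h e \<phi>"
    and "\<And>e f \<phi>. e \<in> set es \<Longrightarrow> f \<in> set es \<Longrightarrow> h e (h f \<phi>) = h f (h e \<phi>)"
    and "linear_op A" and "\<And>e \<phi>. e \<in> set es \<Longrightarrow> A (h e \<phi>) = h e (A \<phi>)"
    and "A v = (\<lambda>x. \<mu> * v x)"
  shows "(\<lambda>n. (((\<lambda>\<psi> x. A \<psi> x + (\<Sum>e\<leftarrow>es. (- \<i> * of_real (\<theta> e)) * h e \<psi> x)) ^^ n) v) x / fact n)
    sums (exp \<mu> * fold (\<lambda>e. rotation (h e) (\<theta> e)) es v x)"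
  using assms
proof (induction es arbitrary: A v \<mu>)
  case Nil
  have "(A ^^ n) v = (\<lambda>x. \<mu> ^ n * v x)" for n
  proof (induction n)
    case (Suc n)
    have "(A ^^ Suc n) v = A (\<lambda>x. \<mu> ^ n * v x)" by (simp add: Suc)
    also have "\<dots> = (\<lambda>x. \<mu> ^ n * (\<mu> * v x))" using linear_opD(2)[OF Nil(4)] Nil(6) by simp
    finally show ?case by (simp add: ac_simps)
  qed simp
  moreover have "(\<lambda>n. \<mu> ^ n / fact n * v x) sums (exp \<mu> * v x)"
    using sums_mult2[OF exp_converges[of \<mu>], of "v x"] by (simp add: scaleR_conv_of_real divide_inverse mult.commute)
  ultimately show ?case by simp
next
  case (Cons e es)
  let ?c = "- \<i> * of_real (\<theta> e)"
  let ?T = "\<lambda>\<psi> x. A \<psi> x + (\<Sum>e\<leftarrow>e # es. (- \<i> * of_real (\<theta> e)) * h e \<psi> x)"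
  let ?F = "fold (\<lambda>e. rotation (h e) (\<theta> e)) es"
  \<comment> \<open>The first operator is moved into \<open>A\<close>. On an eigenvector of
    \<open>h e\<close> with eigenvalue l, the eigenvalue of \<open>A'\<close> is \<mu> - i \<theta>
    l, and the induction hypothesis applies to each component separately.\<close>
  define A' where "A' \<psi> x = A \<psi> x + ?c * h e \<psi> x" for \<psi> x
  have he: "linear_op (h e)" "\<And>\<phi>. h e (h e (h e \<phi>)) = h e \<phi>" "\<And>\<phi>. A (h e \<phi>) = h e (A \<phi>)"
    using Cons.prems by auto
  have lA': "linear_op A'" unfolding A'_def[abs_def] by (rule linear_op_add[OF Cons.prems(4) he(1)])
  have T: "?T = (\<lambda>\<psi> x. A' \<psi> x + (\<Sum>e\<leftarrow>es. (- \<i> * of_real (\<theta> e)) * h e \<psi> x))"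
    by (simp add: A'_def fun_eq_iff algebra_simps)
  have comm: "A' (h f \<phi>) = h f (A' \<phi>)" if f: "f \<in> set es" for f \<phi>
  proof -
    have "h f (\<lambda>x. 1 * A \<phi> x + ?c * h e \<phi> x) = (\<lambda>x. 1 * h f (A \<phi>) x + ?c * h f (h e \<phi>) x)"
      by (rule linear_op_comb) (use Cons.prems(1) f in auto)
    moreover have "h f (h e \<phi>) = h e (h f \<phi>)" "h f (A \<phi>) = A (h f \<phi>)"
      using Cons.prems(3,5) f by auto
    ultimately show ?thesis by (simp add: A'_def[abs_def])
  qed
  have IH: "(\<lambda>n. ((?T ^^ n) w) x / fact n) sums (exp \<kappa> * ?F w x)" if "A' w = (\<lambda>x. \<kappa> * w x)" for w \<kappa>
    unfolding T by (rule Cons.IH) (use Cons.prems lA' comm that in auto)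
  have eig: "A' w = (\<lambda>x. (\<mu> + ?c * l) * w x)" if "A w = (\<lambda>x. \<mu> * w x)" "h e w = (\<lambda>x. l * w x)" for w l
    using that by (simp add: A'_def[abs_def] algebra_simps)
  define p where "p = h e (h e v)"
  define q where "q = h e v"
  have hp: "h e p = q" "h e q = p" using he(2) by (simp_all add: p_def q_def)
  have Aq: "A q = (\<lambda>x. \<mu> * q x)"
    unfolding q_def he(3) Cons.prems(6) by (simp add: linear_opD(2)[OF he(1)])
  have Ap: "A p = (\<lambda>x. \<mu> * p x)"
    unfolding hp(2)[symmetric] he(3) Aq by (simp add: linear_opD(2)[OF he(1)])
  \<comment> \<open>The components of \<open>v\<close> with eigenvalues 0, 1 and -1 of
    \<open>h e\<close>.\<close>
  define v0 where "v0 = (\<lambda>x. 1 * v x + (- 1) * p x)"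
  define vp where "vp = (\<lambda>x. (1/2) * p x + (1/2) * q x)"
  define vm where "vm = (\<lambda>x. (1/2) * p x + (- 1/2) * q x)"
  have c: "A (\<lambda>x. a * \<phi> x + b * \<psi> x) = (\<lambda>x. a * A \<phi> x + b * A \<psi> x)"
    "h e (\<lambda>x. a * \<phi> x + b * \<psi> x) = (\<lambda>x. a * h e \<phi> x + b * h e \<psi> x)" for a b \<phi> \<psi>
    using linear_op_comb[OF Cons.prems(4)] linear_op_comb[OF he(1)] by blast+
  have e0: "A' v0 = (\<lambda>x. (\<mu> + ?c * 0) * v0 x)"
    by (rule eig) (unfold v0_def c hp Cons.prems(6) Ap, simp_all add: q_def[symmetric] algebra_simps)
  have ep: "A' vp = (\<lambda>x. (\<mu> + ?c * 1) * vp x)"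
    by (rule eig) (unfold vp_def c hp Aq Ap, simp_all add: algebra_simps)
  have em: "A' vm = (\<lambda>x. (\<mu> + ?c * (- 1)) * vm x)"
    by (rule eig) (unfold vm_def c hp Aq Ap, simp_all add: algebra_simps)
  have vsum: "v = (\<lambda>x. v0 x + (vp x + vm x))" by (simp add: v0_def vp_def vm_def fun_eq_iff)
  have lT: "linear_op ?T" by (rule linear_op_sum_list) (use Cons.prems in auto)
  have split: "((?T ^^ n) v) x = ((?T ^^ n) v0) x + (((?T ^^ n) vp) x + ((?T ^^ n) vm) x)" for n
  proof -
    have "(?T ^^ n) v = (?T ^^ n) (\<lambda>x. v0 x + (vp x + vm x))" using vsum by (rule arg_cong)
    also have "\<dots> = (\<lambda>x. ((?T ^^ n) v0) x + (((?T ^^ n) vp) x + ((?T ^^ n) vm) x))"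
      unfolding linear_opD(1)[OF linear_op_pow[OF lT]] ..
    finally show ?thesis by (rule fun_cong)
  qed
  have S: "(\<lambda>n. ((?T ^^ n) v) x / fact n) sums
     (exp (\<mu> + ?c * 0) * ?F v0 x + (exp (\<mu> + ?c * 1) * ?F vp x + exp (\<mu> + ?c * (- 1)) * ?F vm x))"
    unfolding split add_divide_distrib by (intro sums_add IH e0 ep em)
  have lF: "linear_op ?F" by (rule linear_fold_rotation) (use Cons.prems in auto)
  have cisp: "exp ?c = of_real (cos (\<theta> e)) - \<i> * of_real (sin (\<theta> e))" "exp (- ?c) = of_real (cos (\<theta> e)) + \<i> * of_real (sin (\<theta> e))"
    using cis_conv_exp[of "- \<theta> e"] cis_conv_exp[of "\<theta> e"] by (simp_all add: complex_eq_iff)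
  have "rotation (h e) (\<theta> e) v = (\<lambda>x. v0 x + (exp ?c * vp x + exp (- ?c) * vm x))"
    unfolding rotation_def q_def[symmetric] hp(2) cisp v0_def vp_def vm_def
    by (auto simp: fun_eq_iff field_simps)
  then have "exp \<mu> * fold (\<lambda>e. rotation (h e) (\<theta> e)) (e # es) v x
     = exp \<mu> * ?F (\<lambda>x. v0 x + (exp ?c * vp x + exp (- ?c) * vm x)) x" by simp
  also have "\<dots> = exp \<mu> * (?F v0 x + (exp ?c * ?F vp x + exp (- ?c) * ?F vm x))"
    by (simp only: linear_opD[OF lF])
  also have "\<dots> = exp (\<mu> + ?c * 0) * ?F v0 x + (exp (\<mu> + ?c * 1) * ?F vp x + exp (\<mu> + ?c * (- 1)) * ?F vm x)"
    by (simp add: exp_add[symmetric] distrib_left mult.assoc[symmetric] del: mult_minus_left)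
  finally show ?case using S by simp
qed

section \<open>The hopping evolution\<close>

definition hop :: "nat set \<Rightarrow> nat ket \<Rightarrow> nat ket" where
  "hop e \<psi> = (\<lambda>S. if (lo e \<in> S) \<noteq> (hi e \<in> S) then flip e \<psi> S else 0)"

lemma linear_hop: "linear_op (hop e)"
  by (auto simp: linear_op_def hop_def flip_def fun_eq_iff algebra_simps)

lemma hop_hop:
  assumes "edge e"
  shows "hop e (hop e \<psi>) S = (if (lo e \<in> S) \<noteq> (hi e \<in> S) then \<psi> S else 0)"
proof -
  have "(lo e \<in> S \<ominus> e) \<noteq> (hi e \<in> S \<ominus> e) \<longleftrightarrow> (lo e \<in> S) \<noteq> (hi e \<in> S)"
    using in_edge[OF assms] by auto
  moreover have "flip e (flip e \<psi>) S = \<psi> S" by (simp add: flip_flip[OF assms])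
  ultimately show ?thesis by (auto simp: hop_def flip_def)
qed

lemma rotation_hop:
  assumes "edge e"
  shows "rotation (hop e) \<theta> = rot \<theta> e"
proof (intro ext)
  fix \<psi> S
  have "hop e \<psi> S = (if (lo e \<in> S) \<noteq> (hi e \<in> S) then flip e \<psi> S else 0)" by (simp add: hop_def)
  then show "rotation (hop e) \<theta> \<psi> S = rot \<theta> e \<psi> S"
    unfolding rotation_def rot_def hop_hop[OF assms] by (simp add: algebra_simps)
qed

text \<open>The physical amplitudes as a state of all modes with the auxiliary ones in the vacuum:
  occupation sets with an auxiliary mode get amplitude 0.\<close>

definition lift :: "nat \<Rightarrow> nat ket \<Rightarrow> mode ket" where
  "lift N \<psi> = (\<lambda>S. if S \<subseteq> phys_modes N then \<psi> {i. Phys i \<in> S} else 0)"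

lemma phys_image: "phys_modes N = Phys ` {1..N}"
  by (auto simp: phys_modes_def)

lemma lift_image: "s \<subseteq> {1..N} \<Longrightarrow> lift N \<psi> (Phys ` s) = \<psi> s"
  by (auto simp: lift_def phys_image intro!: arg_cong[of _ _ \<psi>])

lemma lift_outside: "\<not> S \<subseteq> phys_modes N \<Longrightarrow> lift N \<psi> S = 0"
  by (simp add: lift_def)

lemma fermi_sign_phys:
  assumes "s \<subseteq> {1..N}" "k \<in> {1..N}"
  shows "fermi_sign \<nu> (Phys k) (Phys ` s) = psign {l \<in> s. l < k}"
proof -
  have eq: "mode_pos \<nu> (Phys l) < mode_pos \<nu> (Phys k) \<longleftrightarrow> l < k" if "l \<in> s" for l
  proof -
    have "1 \<le> l" "1 \<le> k" using assms that by auto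
    then show ?thesis unfolding mode_pos.simps mult_less_cancel2 by auto
  qed
  have "{m \<in> Phys ` s. mode_pos \<nu> m < mode_pos \<nu> (Phys k)} = Phys ` {l \<in> s. l < k}"
    using eq by (auto simp del: mode_pos.simps)
  then show ?thesis by (simp add: fermi_sign_def psign_def card_image inj_on_def)
qed

text \<open>The strings of the two ends cancel on the sites below both and leave the sites strictly
  between. Of the two terms, exactly one acts when the ends are unequally occupied and none
  otherwise, which yields the projection in \<open>hop\<close>.\<close>

lemma hop_modes:
  assumes ij: "i < j" "i \<in> {1..N}" "j \<in> {1..N}"
  shows "create \<nu> (Phys i) (annihilate \<nu> (Phys j) (lift N \<psi>)) S + create \<nu> (Phys j) (annihilate \<nu> (Phys i) (lift N \<psi>)) S
    = lift N (hop {i, j} \<psi>) S"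
proof (cases "S \<subseteq> phys_modes N")
  case False
  have "\<not> insert (Phys j) (S - {Phys i}) \<subseteq> phys_modes N" "\<not> insert (Phys i) (S - {Phys j}) \<subseteq> phys_modes N"
    using False ij by (auto simp: phys_image)
  then show ?thesis using False by (simp add: create_def annihilate_def lift_outside)
next
  case True
  then obtain s where s: "s \<subseteq> {1..N}" "S = Phys ` s" by (auto simp: phys_image subset_image_iff)
  have fin: "finite s" using s(1) finite_subset by blast
  have e: "lo {i, j} = i" "hi {i, j} = j" using ij by auto
  have del: "Phys ` s - {Phys k} = Phys ` (s - {k})" for k by auto
  have sub: "s - {k} \<subseteq> {1..N}" for k using s by auto
  have mem: "Phys k \<in> Phys ` s \<longleftrightarrow> k \<in> s" for k s by auto
  have ins: "lift N \<psi> (insert (Phys k) (Phys ` (s - {l}))) = \<psi> (insert k (s - {l}))" if "k \<in> {1..N}" for k l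
  proof -
    have "insert k (s - {l}) \<subseteq> {1..N}" using s(1) that by auto
    from lift_image[OF this, of \<psi>] show ?thesis by simp
  qed
  have psd: "psign {l \<in> s. l < k} * psign {l \<in> s - {k}. l < m} = psign ({l \<in> s. l < k} \<ominus> {l \<in> s - {k}. l < m})" for k m
    by (rule psign_sdiff[symmetric]) (use fin in auto)
  have L: "lift N (hop {i, j} \<psi>) S = hop {i, j} \<psi> s" unfolding s(2) by (rule lift_image[OF s(1)])
  consider "i \<in> s" "j \<notin> s" | "j \<in> s" "i \<notin> s" | "i \<in> s \<longleftrightarrow> j \<in> s" by blast
  then show ?thesis
  proof cases
    case 1
    have "{l \<in> s. l < i} \<ominus> {l \<in> s - {i}. l < j} = s \<inter> inner {i, j}"
      unfolding inner_def e using ij by auto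
    moreover have "insert j (s - {i}) = s \<ominus> {i, j}" using 1 by auto
    moreover have "Phys j \<notin> Phys ` (s - {i})" using 1 by auto
    ultimately show ?thesis
      unfolding L unfolding s(2) create_def annihilate_def del
      using 1 ij psd[of i j]
      by (simp add: mem ins fermi_sign_phys[OF s(1)] fermi_sign_phys[OF sub] hop_def e flip_def mult.assoc[symmetric])
  next
    case 2
    have "{l \<in> s. l < j} \<ominus> {l \<in> s - {j}. l < i} = s \<inter> inner {i, j}"
      unfolding inner_def e using ij 2 by (auto; metis linorder_neqE_nat)
    moreover have "insert i (s - {j}) = s \<ominus> {i, j}" using 2 by auto
    moreover have "Phys i \<notin> Phys ` (s - {j})" using 2 by auto
    ultimately show ?thesis
      unfolding L unfolding s(2) create_def annihilate_def del
      using 2 ij psd[of j i]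
      by (simp add: mem ins fermi_sign_phys[OF s(1)] fermi_sign_phys[OF sub] hop_def e flip_def mult.assoc[symmetric])
  next
    case 3
    then show ?thesis
      unfolding L unfolding s(2) create_def annihilate_def del using ij by (auto simp: mem hop_def e)
  qed
qed

context colored
begin

text \<open>Distinct edges of a color are disjoint: \<open>kap\<close> is 1, and flipping the ends
  of one edge leaves the test at the other unchanged.\<close>

lemma hop_commute:
  assumes "e \<in> Ec \<alpha>" "f \<in> Ec \<alpha>"
  shows "hop e (hop f \<psi>) = hop f (hop e \<psi>)"
proof (cases "e = f")
  case False
  have ed: "edge e" "edge f" using assms edgeE Ec_in by auto
  have dis: "i \<notin> f" if "i \<in> e" for i using matching[OF assms] that False by blast
  have odd: "(lo g \<in> S \<ominus> g') \<noteq> (hi g \<in> S \<ominus> g') \<longleftrightarrow> (lo g \<in> S) \<noteq> (hi g \<in> S)"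
    if "lo g \<notin> g'" "hi g \<notin> g'" for g g' S using that by auto
  have n: "lo e \<notin> f" "hi e \<notin> f" "lo f \<notin> e" "hi f \<notin> e"
    using dis in_edge[OF ed(1)] in_edge[OF ed(2)] by blast+
  have l: "hop g (hop g' \<psi>) S = (if (lo g \<in> S) \<noteq> (hi g \<in> S) \<and> (lo g' \<in> S) \<noteq> (hi g' \<in> S) then flip g (flip g' \<psi>) S else 0)"
    if "lo g' \<notin> g" "hi g' \<notin> g" for g g' S
    unfolding hop_def using odd[OF that] by (simp add: flip_def)
  have "lo e \<noteq> lo f" "hi e \<noteq> hi f"
    using n in_edge[OF ed(2)] by auto
  then have "flip e (flip f \<psi>) = flip f (flip e \<psi>)"
    using flip_commute[OF ed] by (simp add: kap_def)
  then show ?thesis unfolding fun_eq_iff l[OF n(3,4)] l[OF n(1,2)] by auto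
qed simp

definition hops :: "(nat \<Rightarrow> nat \<Rightarrow> real) \<Rightarrow> nat \<Rightarrow> nat ket \<Rightarrow> nat ket" where
  "hops t \<alpha> \<psi> = (\<lambda>S. \<Sum>e\<leftarrow>cl \<alpha>. of_real (t (lo e) (hi e)) * hop e \<psi> S)"

lemma hopping_lift: "hopping \<nu> t (Ec \<alpha>) (lift N \<psi>) = lift N (hops t \<alpha> \<psi>)"
proof
  fix S
  let ?D = "{(i, j). i < j \<and> {i, j} \<in> Ec \<alpha>}"
  have K': "i \<in> {1..N} \<and> j \<in> {1..N}" if "{i, j} \<in> Ec \<alpha>" for i j
    using edge_K[OF Ec_in[OF that]] by (simp add: K_def)
  have "hopping \<nu> t (Ec \<alpha>) (lift N \<psi>) S = (\<Sum>(i, j)\<in>?D. of_real (t i j) * lift N (hop {i, j} \<psi>) S)"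
    unfolding hopping_def by (intro sum.cong refl) (use hop_modes K' in auto)
  also have "\<dots> = (\<Sum>e\<in>Ec \<alpha>. of_real (t (lo e) (hi e)) * lift N (hop e \<psi>) S)"
  proof (rule sum.reindex_bij_witness[where i = "\<lambda>e. (lo e, hi e)" and j = "\<lambda>(i, j). {i, j}"])
    fix p assume "p \<in> ?D"
    then show "(lo (case p of (i, j) \<Rightarrow> {i, j}), hi (case p of (i, j) \<Rightarrow> {i, j})) = p" by auto
    show "(case p of (i, j) \<Rightarrow> {i, j}) \<in> Ec \<alpha>" using \<open>p \<in> ?D\<close> by auto
    show "of_real (t (lo (case p of (i, j) \<Rightarrow> {i, j})) (hi (case p of (i, j) \<Rightarrow> {i, j}))) *
         lift N (hop (case p of (i, j) \<Rightarrow> {i, j}) \<psi>) S =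
         (case p of (i, j) \<Rightarrow> of_real (t i j) * lift N (hop {i, j} \<psi>) S)"
      using \<open>p \<in> ?D\<close> by auto
  next
    fix e assume e: "e \<in> Ec \<alpha>"
    then have "edge e" using edgeE Ec_in by blast
    then have "{lo e, hi e} = e" "lo e < hi e" using edge_eq edge_less by auto
    then show "(case (lo e, hi e) of (i, j) \<Rightarrow> {i, j}) = e" "(lo e, hi e) \<in> ?D" using e by auto
  qed
  also have "\<dots> = (\<Sum>e\<leftarrow>cl \<alpha>. of_real (t (lo e) (hi e)) * lift N (hop e \<psi>) S)"
    using cl by (simp add: sum.distinct_set_conv_list flip: cl(2))
  also have "\<dots> = lift N (hops t \<alpha> \<psi>) S"
    by (simp add: lift_def hops_def)
  finally show "hopping \<nu> t (Ec \<alpha>) (lift N \<psi>) S = lift N (hops t \<alpha> \<psi>) S" .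
qed

lemma evolve_lift:
  "evolve \<tau> (hopping \<nu> t (Ec \<alpha>)) (lift N \<psi>) = lift N (rots (\<lambda>e. \<tau> * t (lo e) (hi e)) \<alpha> \<psi>)"
proof
  fix S
  let ?\<theta> = "\<lambda>e. \<tau> * t (lo e) (hi e)"
  let ?T = "\<lambda>\<psi> x. 0 + (\<Sum>e\<leftarrow>cl \<alpha>. (- \<i> * of_real (?\<theta> e)) * hop e \<psi> x)"
  have step: "scale (- \<i> * of_real \<tau>) (hopping \<nu> t (Ec \<alpha>) (lift N \<phi>)) = lift N (?T \<phi>)" for \<phi>
  proof -
    have c: "(- \<i> * of_real \<tau>) * (of_real a * z) = (- \<i> * of_real (\<tau> * a)) * z" for a z by simp
    show ?thesis
      unfolding hopping_lift unfolding scale_def lift_def hops_def if_distrib sum_list_const_mult[symmetric] c by (auto simp: fun_eq_iff)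
  qed
  have pow: "((\<lambda>\<psi>. scale (- \<i> * of_real \<tau>) (hopping \<nu> t (Ec \<alpha>) \<psi>)) ^^ n) (lift N \<psi>) = lift N ((?T ^^ n) \<psi>)" for n
    by (induction n) (simp_all only: funpow.simps id_apply comp_def step)
  have ser: "(\<lambda>n. ((?T ^^ n) \<psi>) x / fact n) sums rots ?\<theta> \<alpha> \<psi> x" for x
  proof -
    have "(\<lambda>n. ((?T ^^ n) \<psi>) x / fact n) sums (exp 0 * fold (\<lambda>e. rotation (hop e) (?\<theta> e)) (cl \<alpha>) \<psi> x)"
    \<comment> \<open>Nothing has been split off yet: \<open>A\<close> is 0 with eigenvalue 0, and
      the prefactor is exp 0 = 1.\<close>
    proof (rule exp_commuting_sums[where A = "\<lambda>\<psi> x. 0"])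
      fix e f \<phi> assume e: "e \<in> set (cl \<alpha>)"
      then have e': "e \<in> Ec \<alpha>" "edge e" using cl edgeE Ec_in by auto
      show "hop e (hop e (hop e \<phi>)) = hop e \<phi>"
        by (auto simp: fun_eq_iff hop_hop[OF e'(2)] hop_def[of e \<phi>])
      show "(\<lambda>x. 0) = hop e (\<lambda>x. 0)" by (auto simp: hop_def flip_def fun_eq_iff)
      assume "f \<in> set (cl \<alpha>)"
      then show "hop e (hop f \<phi>) = hop f (hop e \<phi>)" using e' cl hop_commute by simp
    qed (rule linear_hop | simp add: linear_op_def)+
    moreover have "fold (\<lambda>e. rotation (hop e) (?\<theta> e)) es \<phi> = fold (\<lambda>e. rot (?\<theta> e) e) es \<phi>" if "set es \<subseteq> Ec \<alpha>" for es \<phi>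
      using that rotation_hop edgeE Ec_in by (induction es arbitrary: \<phi>) auto
    ultimately show ?thesis by (simp add: rots_def cl)
  qed
  show "evolve \<tau> (hopping \<nu> t (Ec \<alpha>)) (lift N \<psi>) S = lift N (rots ?\<theta> \<alpha> \<psi>) S"
  proof (cases "S \<subseteq> phys_modes N")
    case True
    then have "evolve \<tau> (hopping \<nu> t (Ec \<alpha>)) (lift N \<psi>) S = (\<Sum>n. ((?T ^^ n) \<psi>) {i. Phys i \<in> S} / fact n)"
      unfolding evolve_def op_exp_def pow by (simp add: lift_def)
    also have "\<dots> = rots ?\<theta> \<alpha> \<psi> {i. Phys i \<in> S}" using ser by (rule sums_unique[symmetric])
    finally show ?thesis using True by (simp add: lift_def)
  next
    case False
    then show ?thesis unfolding evolve_def op_exp_def pow by (simp add: lift_outside)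
  qed
qed

lemma trotter_lift:
  "trotter \<nu> t E col \<chi> \<tau> M (lift N \<psi>) = lift N ((sweep (\<lambda>e. \<tau> * t (lo e) (hi e)) 0 ^^ M) \<psi>)"
proof -
  let ?\<theta> = "\<lambda>e. \<tau> * t (lo e) (hi e)"
  have f: "foldr (\<lambda>\<alpha>. evolve \<tau> (hopping \<nu> t (Ec \<alpha>))) as (lift N \<phi>) = lift N (foldr (rots ?\<theta>) as \<phi>)" for as \<phi>
    by (induction as) (simp_all add: evolve_lift)
  have "(foldr (\<lambda>\<alpha>. evolve \<tau> (hopping \<nu> t (Ec \<alpha>))) [1..<Suc \<chi>] ^^ M) (lift N \<psi>) = lift N ((sweep ?\<theta> 0 ^^ M) \<psi>)"
    by (induction M) (simp_all only: funpow.simps id_apply comp_def f sweep_def One_nat_def)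
  then show ?thesis by (simp only: trotter_def)
qed

subsection \<open>Norms\<close>

definition mass :: "nat ket \<Rightarrow> real" where
  "mass \<psi> = (\<Sum>S\<in>Pow K. (cmod (\<psi> S))\<^sup>2)"

text \<open>Pair each \<open>S\<close> with \<open>S \<ominus> e\<close>: on every pair the rotation
  is the identity or a unitary 2 by 2 matrix. The sum over all \<open>S\<close> meets each pair
  twice, hence the factor 2.\<close>

lemma mass_rot:
  assumes e: "e \<in> E"
  shows "mass (rot \<theta> e \<psi>) = mass \<psi>"
proof -
  have ed: "edge e" "e \<subseteq> K" using e edgeE edge_K by auto
  have re: "(\<Sum>S\<in>Pow K. f (S \<ominus> e)) = (\<Sum>S\<in>Pow K. f S)" for f :: "nat set \<Rightarrow> real"
    by (rule sum.reindex_bij_witness[where i = "\<lambda>S. S \<ominus> e" and j = "\<lambda>S. S \<ominus> e"]) (use ed in auto)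
  have dbl: "2 * mass \<phi> = (\<Sum>S\<in>Pow K. (cmod (\<phi> S))\<^sup>2 + (cmod (\<phi> (S \<ominus> e)))\<^sup>2)" for \<phi>
    unfolding sum.distrib re[of "\<lambda>S. (cmod (\<phi> S))\<^sup>2"] by (simp add: mass_def)
  have "(cmod (rot \<theta> e \<psi> S))\<^sup>2 + (cmod (rot \<theta> e \<psi> (S \<ominus> e)))\<^sup>2 = (cmod (\<psi> S))\<^sup>2 + (cmod (\<psi> (S \<ominus> e)))\<^sup>2" for S
  proof -
    have o: "(lo e \<in> S \<ominus> e) \<noteq> (hi e \<in> S \<ominus> e) \<longleftrightarrow> (lo e \<in> S) \<noteq> (hi e \<in> S)"
      using in_edge[OF ed(1)] by auto
    have i: "(S \<ominus> e) \<inter> inner e = S \<inter> inner e" using in_edge[OF ed(1)] by (auto simp: inner_def)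
    define s where "s = psign (S \<inter> inner e)"
    have s: "s = 1 \<or> s = - 1" unfolding s_def by (rule psign_cases)
    have rotn: "(cmod (of_real (cos \<theta>) * a - \<i> * of_real (sin \<theta>) * (s * b)))\<^sup>2 +
        (cmod (of_real (cos \<theta>) * b - \<i> * of_real (sin \<theta>) * (s * a)))\<^sup>2 = (cmod a)\<^sup>2 + (cmod b)\<^sup>2" for a b
    proof -
      have cs: "(cos \<theta>)\<^sup>2 = 1 - (sin \<theta>)\<^sup>2" using sin_cos_squared_add2 by (simp add: cos_squared_eq)
      show ?thesis using s
        by (elim disjE) (simp_all add: cmod_power2 power2_sum power2_diff power_mult_distrib cs algebra_simps)
    qed
    show ?thesis
      unfolding rot_def o flip_def i s_def[symmetric] using rotn by simp
  qed
  then have "2 * mass (rot \<theta> e \<psi>) = 2 * mass \<psi>" unfolding dbl by simp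
  then show ?thesis by simp
qed

lemma mass_sweep: "mass ((sweep \<theta> k ^^ M) \<psi>) = mass \<psi>"
proof -
  have f: "mass (fold (\<lambda>e. rot (\<theta> e) e) es \<phi>) = mass \<phi>" if "set es \<subseteq> E" for es \<phi>
    using that by (induction es arbitrary: \<phi>) (auto simp: mass_rot)
  have r: "mass (rots \<theta> \<alpha> \<phi>) = mass \<phi>" for \<alpha> \<phi>
    unfolding rots_def by (rule f) (use cl Ec_E in auto)
  have "mass (foldr (rots \<theta>) as \<phi>) = mass \<phi>" for as \<phi>
    by (induction as) (auto simp: r)
  then have "mass (sweep \<theta> k \<phi>) = mass \<phi>" for \<phi> by (simp add: sweep_def)
  then show ?thesis by (induction M) auto
qed

section \<open>The qubits\<close>

text \<open>Every color class is a matching and has at most N/2 edges. With \<chi> at most 2 \<nu>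
  this bounds the edge qubits by \<nu> N.\<close>

lemma card_E: "2 * card E \<le> \<chi> * N"
proof -
  have "E = (\<Union>\<alpha>\<in>{1..\<chi>}. Ec \<alpha>)" using col_range by (auto simp: in_Ec)
  then have "card E \<le> (\<Sum>\<alpha>\<in>{1..\<chi>}. card (Ec \<alpha>))"
    using card_UN_le[of "{1..\<chi>}" Ec] by simp
  then have "2 * card E \<le> (\<Sum>\<alpha>\<in>{1..\<chi>}. 2 * card (Ec \<alpha>))" by (simp flip: sum_distrib_left)
  also have "\<dots> \<le> (\<Sum>\<alpha>\<in>{1..\<chi>}. N)"
  proof (rule sum_mono)
    fix \<alpha>
    have two: "card e = 2" if "e \<in> Ec \<alpha>" for e using graph Ec_in[OF that] by (auto simp: simple_graph_def)
    have "card (\<Union>(Ec \<alpha>)) = (\<Sum>e\<in>Ec \<alpha>. card e)"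
    proof (rule card_Union_disjoint)
      show "pairwise disjnt (Ec \<alpha>)" using matching by (fastforce simp: pairwise_def disjnt_def)
      show "\<And>e. e \<in> Ec \<alpha> \<Longrightarrow> finite e" using edge_finite edgeE Ec_in by blast
    qed
    then have "2 * card (Ec \<alpha>) = card (\<Union>(Ec \<alpha>))" using two by simp
    also have "\<dots> \<le> card K" by (rule card_mono) (use edge_K Ec_in in auto)
    finally show "2 * card (Ec \<alpha>) \<le> N" by (simp add: K_def)
  qed
  finally show ?thesis by simp
qed

text \<open>The physical modes keep their Jordan-Wigner qubits; all other wires may go anywhere
  else, including the qubits of the auxiliary modes. There is room because \<nu> N + 2 N is at most
  (2 \<nu> + 1) N when \<nu> is at least 1.\<close>

lemma qubit_assignment:
  assumes \<nu>: "\<chi> \<le> 2 * \<nu>" "1 \<le> \<nu>" and Q: "Q = {..<N + (2 * \<nu> + 1) * N}"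
  shows "\<exists>\<iota>. inj_on \<iota> W \<and> \<iota> ` W \<subseteq> Q \<and> (\<forall>i\<in>K. \<iota> (P i) = mode_pos \<nu> (Phys i))"
proof -
  define p where "p i = mode_pos \<nu> (Phys i)" for i
  let ?R = "B ` E \<union> U ` K \<union> V ` K"
  have pi: "inj_on p K"
  proof (rule inj_onI)
    fix i j assume "i \<in> K" "j \<in> K" "p i = p j"
    then have "i - 1 = j - 1" "1 \<le> i" "1 \<le> j" unfolding p_def mode_pos.simps mult_cancel2 by (auto simp: K_def)
    then show "i = j" by simp
  qed
  have pQ: "p ` K \<subseteq> Q"
  proof
    fix q assume "q \<in> p ` K"
    then obtain i where i: "1 \<le> i" "i \<le> N" "q = (i - 1) * (\<nu> + 1)" by (auto simp: p_def K_def)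
    have "(i - 1) * (\<nu> + 1) < N * (\<nu> + 1)" using i by (intro mult_strict_right_mono) auto
    also have "\<dots> \<le> N + (2 * \<nu> + 1) * N" by (simp add: algebra_simps)
    finally show "q \<in> Q" using i Q by simp
  qed
  have fR: "finite ?R" "finite (Q - p ` K)" using finite_E Q by auto
  have "card ?R \<le> card (Q - p ` K)"
  proof -
    have "card ?R \<le> card (B ` E) + card (U ` K) + card (V ` K)"
      using card_Un_le[of "B ` E \<union> U ` K" "V ` K"] card_Un_le[of "B ` E" "U ` K"] by linarith
    also have "\<dots> \<le> card E + N + N"
      using card_image_le[OF finite_E, of B] card_image_le[OF finite_K, of U] card_image_le[OF finite_K, of V]
      by (simp add: K_def)
    also have "\<dots> \<le> (2 * \<nu> + 1) * N"
    proof -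
      have "2 * card E \<le> 2 * (\<nu> * N)" using order_trans[OF card_E mult_le_mono1[OF \<nu>(1)]] by (simp only: mult.assoc)
      moreover have "N \<le> \<nu> * N" using \<nu>(2) by simp
      moreover have "(2 * \<nu> + 1) * N = 2 * (\<nu> * N) + N" by (simp add: algebra_simps)
      ultimately show ?thesis by linarith
    qed
    also have "\<dots> = card Q - card (p ` K)" using Q card_image[OF pi] by (simp add: K_def)
    also have "\<dots> = card (Q - p ` K)" by (rule card_Diff_subset[symmetric]) (use pQ in auto)
    finally show ?thesis .
  qed
  then obtain f where f: "f ` ?R \<subseteq> Q - p ` K" "inj_on f ?R" using card_le_inj[OF fR] by blast
  define \<iota> where "\<iota> w = (case w of P i \<Rightarrow> p i | _ \<Rightarrow> f w)" for w
  have \<iota>R: "\<iota> w = f w" if "w \<in> ?R" for w using that by (auto simp: \<iota>_def)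
  have \<iota>P: "\<iota> (P i) = p i" for i by (simp add: \<iota>_def)
  have WR: "W = P ` K \<union> ?R" by (auto simp: W_def)
  have iR: "\<iota> ` ?R = f ` ?R" by (rule image_cong[OF refl \<iota>R])
  have iPK: "\<iota> ` P ` K = p ` K" by (simp add: image_image \<iota>P)
  have "inj_on \<iota> (P ` K \<union> ?R)"
  proof (rule inj_on_Un[THEN iffD2], intro conjI)
    show "inj_on \<iota> (P ` K)" using pi by (auto simp: inj_on_def \<iota>P)
    show "inj_on \<iota> ?R" using f(2) by (subst inj_on_cong[OF \<iota>R])
    have "\<iota> ` P ` K \<inter> \<iota> ` ?R = {}" unfolding iR iPK using f(1) by blast
    then show "\<iota> ` (P ` K - ?R) \<inter> \<iota> ` (?R - P ` K) = {}" by blast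
  qed
  then have "inj_on \<iota> W" unfolding WR .
  moreover have "\<iota> ` W \<subseteq> Q"
  proof -
    have "\<iota> ` W = \<iota> ` P ` K \<union> \<iota> ` ?R" unfolding WR by (rule image_Un)
    then show ?thesis unfolding iR iPK using f(1) pQ by blast
  qed
  ultimately show ?thesis using \<iota>P by (auto simp: p_def)
qed

section \<open>Encoded states on the numbered qubits\<close>

lemma subset_image_iff_back:
  assumes "inj_on f A" "C \<subseteq> A"
  shows "x \<subseteq> f ` A \<and> {a \<in> A. f a \<in> x} \<subseteq> C \<longleftrightarrow> x \<subseteq> f ` C"
proof
  assume x: "x \<subseteq> f ` C"
  have "a \<in> C" if "a \<in> A" "f a \<in> x" for a
  proof -
    obtain c where "c \<in> C" "f a = f c" using x \<open>f a \<in> x\<close> by blast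
    then show ?thesis using assms that by (auto dest: inj_onD)
  qed
  then show "x \<subseteq> f ` A \<and> {a \<in> A. f a \<in> x} \<subseteq> C" using x assms(2) by blast
qed blast

lemma push_enc:
  assumes \<iota>: "inj_on \<iota> W" "\<forall>i\<in>K. \<iota> (P i) = mode_pos \<nu> (Phys i)"
  shows "push \<iota> W (enc \<chi> \<psi>) = jw_encode N \<nu> (lift N \<psi>)"
proof
  fix x
  let ?L = "set (mode_list N \<nu>)" and ?p = "mode_pos \<nu>"
  have ph: "phys_modes N \<subseteq> ?L" unfolding set_mode_list by blast
  have im: "\<iota> ` P ` K = ?p ` phys_modes N" using \<iota>(2) by (simp add: phys_image image_image K_def)
  have PW: "P ` K \<subseteq> W" by (auto simp: W_def)
  have 1: "push \<iota> W (enc \<chi> \<psi>) x = (if x \<subseteq> \<iota> ` P ` K then \<psi> {i \<in> K. \<iota> (P i) \<in> x} else 0)"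
  proof -
    have "occ K {w \<in> W. \<iota> w \<in> x} = {i \<in> K. \<iota> (P i) \<in> x}" using PW by auto
    then show ?thesis
      unfolding push_def enc_top using subset_image_iff_back[OF \<iota>(1) PW, of x] by auto
  qed
  have 2: "jw_encode N \<nu> (lift N \<psi>) x = (if x \<subseteq> ?p ` phys_modes N then \<psi> {i. Phys i \<in> {m \<in> ?L. ?p m \<in> x}} else 0)"
    unfolding jw_encode_def lift_def using subset_image_iff_back[OF inj_on_mode_pos ph, of x] by auto
  have 3: "{i. Phys i \<in> {m \<in> ?L. ?p m \<in> x}} = {i \<in> K. \<iota> (P i) \<in> x}"
  proof -
    have "Phys i \<in> ?L \<longleftrightarrow> i \<in> K" for i unfolding set_mode_list by (auto simp: phys_modes_def aux_modes_def K_def)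
    then show ?thesis using \<iota>(2) by auto
  qed
  show "push \<iota> W (enc \<chi> \<psi>) x = jw_encode N \<nu> (lift N \<psi>) x" unfolding 1 2 3 im ..
qed

lemma ket_norm_push:
  assumes \<iota>: "inj_on \<iota> W" "\<iota> ` W \<subseteq> Q" and Q: "finite Q"
  shows "ket_norm Q (push \<iota> W (enc \<chi> \<psi>)) = sqrt (mass \<psi>)"
proof -
  have PW: "P ` K \<subseteq> W" by (auto simp: W_def)
  have iP: "inj_on (\<lambda>i. \<iota> (P i)) K"
    using comp_inj_on[of P K \<iota>] inj_on_subset[OF \<iota>(1) PW] by (simp add: comp_def inj_on_def)
  have sub: "(\<lambda>i. \<iota> (P i)) ` K \<subseteq> Q" using \<iota>(2) PW by blast
  have val: "push \<iota> W (enc \<chi> \<psi>) ((\<lambda>i. \<iota> (P i)) ` S) = \<psi> S" if "S \<subseteq> K" for S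
  proof -
    have "(\<lambda>i. \<iota> (P i)) ` S = \<iota> ` P ` S" by (simp add: image_image)
    moreover have "P ` S \<subseteq> W" using that PW by blast
    moreover have "occ K (P ` S) = S" using that by auto
    moreover have "P ` S \<subseteq> P ` K" using that by blast
    ultimately show ?thesis by (simp add: push_image[OF \<iota>(1)] enc_top)
  qed
  have zero: "push \<iota> W (enc \<chi> \<psi>) x = 0" if "\<not> x \<subseteq> (\<lambda>i. \<iota> (P i)) ` K" for x
  proof -
    have "\<not> x \<subseteq> \<iota> ` P ` K" using that by (simp add: image_image)
    then show ?thesis unfolding push_def enc_top using subset_image_iff_back[OF \<iota>(1) PW, of x] by auto
  qed
  have "(\<Sum>x\<in>Pow Q. (cmod (push \<iota> W (enc \<chi> \<psi>) x))\<^sup>2) = (\<Sum>x\<in>Pow ((\<lambda>i. \<iota> (P i)) ` K). (cmod (push \<iota> W (enc \<chi> \<psi>) x))\<^sup>2)"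
    by (rule sum.mono_neutral_right) (use Q sub zero in auto)
  also have "\<dots> = mass \<psi>"
    unfolding sum_Pow_image[OF iP] mass_def by (rule sum.cong) (use val in auto)
  finally show ?thesis by (simp add: ket_norm_def)
qed

text \<open>The target vector has norm 1, since the rotations preserve \<open>mass\<close>. For a
  history of positive probability the factor left open by \<open>reach\<close> is nonzero, and
  normalization removes its modulus, so only a global phase remains.\<close>

theorem evolution_circuit:
  assumes \<nu>: "\<chi> \<le> 2 * \<nu>" "1 \<le> \<nu>" and Q: "Q = {..<N + (2 * \<nu> + 1) * N}" and L: "2 * N + 1 < 2 ^ L"
  shows "\<exists>c. valid_circuit Q c \<and> depth c = \<chi> * (22 * L + 5) + M * (\<chi> * 15) + 3 \<and>
    (\<forall>\<Psi> h. state_on (phys_modes N) \<Psi> \<and> length h = depth c \<and> run c h (jw_encode N \<nu> \<Psi>) \<noteq> (\<lambda>x. 0) \<longrightarrow>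
      (\<exists>\<theta>. post_state Q c h (jw_encode N \<nu> \<Psi>) =
        scale (cis \<theta>) (jw_encode N \<nu> (aux_phys_product N \<nu> vac (trotter \<nu> t E col \<chi> \<tau> M \<Psi>)))))"
proof -
  obtain \<iota> where \<iota>: "inj_on \<iota> W" "\<iota> ` W \<subseteq> Q" "\<forall>i\<in>K. \<iota> (P i) = mode_pos \<nu> (Phys i)"
    using qubit_assignment[OF \<nu> Q] by blast
  have finQ: "finite Q" by (simp add: Q)
  let ?d = "\<chi> * (22 * L + 5) + M * (\<chi> * 15) + 3"
  define ev where "ev = (sweep (\<lambda>e. \<tau> * t (lo e) (hi e)) 0 ^^ M)"
  have rank: "rank \<alpha> i < 2 ^ L" if "i \<in> K" for \<alpha> i
    using rank_bound[OF that, of \<alpha>] L by linarith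
  obtain c where c: "valid_circuit Q c" "depth c = ?d"
    "\<And>\<psi> h. length h = ?d \<Longrightarrow> \<exists>z. run c h (push \<iota> W (enc \<chi> \<psi>)) = scale z (push \<iota> W (enc \<chi> (ev \<psi>)))"
    using reach_circuit[OF reach_evolution[OF rank] \<iota>(1,2) finite_W] unfolding ev_def by blast
  show ?thesis
  proof (intro exI[of _ c] conjI allI impI)
    fix \<Psi> h
    assume a: "state_on (phys_modes N) \<Psi> \<and> length h = depth c \<and> run c h (jw_encode N \<nu> \<Psi>) \<noteq> (\<lambda>x. 0)"
    define \<psi> where "\<psi> S = \<Psi> (Phys ` S)" for S
    have \<Psi>: "\<Psi> = lift N \<psi>"
    proof
      fix S
      show "\<Psi> S = lift N \<psi> S"
      proof (cases "S \<subseteq> phys_modes N")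
        case True
        then have "Phys ` {i. Phys i \<in> S} = S" by (auto simp: phys_image)
        then show ?thesis using True by (simp add: lift_def \<psi>_def)
      next
        case False
        then show ?thesis using a by (auto simp: state_on_def lift_def)
      qed
    qed
    have m1: "mass \<psi> = 1"
    proof -
      have "ket_norm (phys_modes N) \<Psi> = 1" using a by (simp add: state_on_def)
      then have "(\<Sum>S\<in>Pow (Phys ` K). (cmod (\<Psi> S))\<^sup>2) = 1" by (simp add: ket_norm_def phys_image K_def)
      moreover have "inj_on Phys K" by (simp add: inj_on_def)
      ultimately show ?thesis by (simp add: sum_Pow_image mass_def \<psi>_def)
    qed
    define target where "target = push \<iota> W (enc \<chi> (ev \<psi>))"
    have nt: "ket_norm Q target = 1"
      unfolding target_def ket_norm_push[OF \<iota>(1,2) finQ] ev_def mass_sweep m1 by simp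
    have enc: "jw_encode N \<nu> \<Psi> = push \<iota> W (enc \<chi> \<psi>)" unfolding \<Psi> push_enc[OF \<iota>(1,3)] ..
    have out: "target = jw_encode N \<nu> (aux_phys_product N \<nu> vac (trotter \<nu> t E col \<chi> \<tau> M \<Psi>))"
    proof -
      have tr: "trotter \<nu> t E col \<chi> \<tau> M \<Psi> = lift N (ev \<psi>)" unfolding \<Psi> ev_def by (rule trotter_lift)
      have "creation_poly N \<nu> (lift N (ev \<psi>)) vac = lift N (ev \<psi>)"
        by (rule creation_poly_vac) (auto simp: lift_def set_mode_list split: if_splits)
      moreover have "creation_poly N \<nu> vac \<phi> = \<phi>" for \<phi>
      proof
        fix T
        have "creation_poly N \<nu> vac \<phi> T = (\<Sum>S\<in>Pow (set (mode_list N \<nu>)). if S = {} then \<phi> T else 0)"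
          unfolding creation_poly_def by (rule sum.cong) (auto simp: vac_def)
        then show "creation_poly N \<nu> vac \<phi> T = \<phi> T" by (simp add: sum.delta)
      qed
      ultimately have "aux_phys_product N \<nu> vac (lift N (ev \<psi>)) = lift N (ev \<psi>)" by (simp add: aux_phys_product_def)
      then show ?thesis unfolding tr target_def push_enc[OF \<iota>(1,3)] by simp
    qed
    obtain z where z: "run c h (jw_encode N \<nu> \<Psi>) = scale z target"
      unfolding enc target_def using c(2,3) a by metis
    have "z \<noteq> 0"
    proof
      assume "z = 0"
      then show False using a z by (simp add: scale_def)
    qed
    have "ket_norm Q (scale z target) = cmod z * ket_norm Q target"
      by (simp add: ket_norm_def scale_def norm_mult power_mult_distrib real_sqrt_mult flip: sum_distrib_left)
    then have "post_state Q c h (jw_encode N \<nu> \<Psi>) = scale (of_real (inverse (cmod z)) * z) target"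
      unfolding post_state_def z by (simp add: nt scale_scale)
    also have "of_real (inverse (cmod z)) * z = cis (Arg z)"
      using \<open>z \<noteq> 0\<close> by (simp add: cis_Arg sgn_div_norm scaleR_conv_of_real)
    finally show "\<exists>\<theta>. post_state Q c h (jw_encode N \<nu> \<Psi>) =
        scale (cis \<theta>) (jw_encode N \<nu> (aux_phys_product N \<nu> vac (trotter \<nu> t E col \<chi> \<tau> M \<Psi>)))"
      unfolding out by blast
  qed (use c in auto)
qed

end

section \<open>Constants and conclusion\<close>

lemma state_on_vac: "state_on (aux_modes N \<nu>) vac"
proof -
  have "aux_modes N \<nu> \<subseteq> set (mode_list N \<nu>)" unfolding set_mode_list by blast
  then have "finite (aux_modes N \<nu>)" using finite_modes finite_subset by blast
  moreover have "(\<Sum>x\<in>Pow (aux_modes N \<nu>). (cmod (vac x))\<^sup>2) = (\<Sum>x\<in>Pow (aux_modes N \<nu>). if x = {} then 1 else 0)"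
    by (rule sum.cong) (auto simp: vac_def)
  ultimately show ?thesis by (auto simp: state_on_def ket_norm_def vac_def sum.delta)
qed

text \<open>The ranks are at most 2 N + 1, which is below 4 N. Rounding up the binary logarithm of 4
  N gives at most 3 + ln N / ln 2, and 1 / ln 2 is at most 2; the constant is 5 = 3 + 2.\<close>

lemma digits_bound:
  assumes "1 \<le> N"
  shows "\<exists>L. 2 * N + 1 < 2 ^ L \<and> real L \<le> 5 * log1 (real N)"
proof -
  define L where "L = nat \<lceil>log 2 (4 * real N)\<rceil>"
  have pos: "log 2 (4 * real N) > 0" using assms by simp
  have "4 * real N = 2 powr log 2 (4 * real N)" using assms by simp
  also have "\<dots> \<le> 2 powr real L" unfolding L_def by (intro powr_mono real_nat_ceiling_ge) simp
  finally have "4 * real N \<le> 2 ^ L" by (simp add: powr_realpow)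
  then have "4 * N \<le> 2 ^ L" by (metis (mono_tags) of_nat_le_iff of_nat_mult of_nat_numeral of_nat_power)
  then have 1: "2 * N + 1 < 2 ^ L" using assms by linarith
  have "real L \<le> log 2 (4 * real N) + 1" unfolding L_def using pos by linarith
  also have "log 2 (4 * real N) = 2 + ln (real N) / ln 2"
  proof -
    have "log 2 4 = (2::real)" using log_pow_cancel[of 2 2] by simp
    moreover have "log 2 (4 * real N) = log 2 4 + log 2 (real N)" using assms by (intro log_mult_pos) auto
    ultimately show ?thesis by (simp add: log_def[of 2 "real N"])
  qed
  also have "ln (real N) / ln 2 \<le> 2 * ln (real N)"
  proof -
    have "1 \<le> ln ((2::real) ^ 2)" using exp_le by (subst ln_ge_iff) auto
    then have "1 \<le> 2 * ln (2::real)" by (subst (asm) ln_realpow) auto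
    then have "ln (real N) * 1 \<le> ln (real N) * (2 * ln 2)" using assms by (intro mult_left_mono) auto
    then show ?thesis by (simp add: divide_simps mult_ac)
  qed
  finally have "real L \<le> 2 * ln (real N) + 3" by simp
  moreover have "ln (real N) \<le> log1 (real N)" "1 \<le> log1 (real N)" by (auto simp: log1_def)
  ultimately have "real L \<le> 5 * log1 (real N)" by linarith
  with 1 show ?thesis by blast
qed

theorem mainTheorem1:
  shows "\<exists>C C' :: real. \<forall>(N::nat) (E::nat set set) (\<chi>::nat) (col::nat set \<Rightarrow> nat) (t::nat \<Rightarrow> nat \<Rightarrow> real) (\<nu>::nat) (Q::nat set).
    simple_graph {1..N} E \<and> E \<noteq> {} \<and> \<chi> = chromatic_index E \<and> proper_edge_coloring E \<chi> col \<and>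
    \<nu> = nat \<lceil>real \<chi> / 2\<rceil> \<and> Q = {..<N + (2 * \<nu> + 1) * N} \<longrightarrow>
    (\<exists>(prep::circuit) (\<Psi>aux::history \<Rightarrow> mode ket).
      (\<forall>g. state_on (aux_modes N \<nu>) (\<Psi>aux g)) \<and>
      (\<forall>(\<tau>::real) (M::nat). M \<ge> 1 \<longrightarrow>
        (\<exists>c::circuit. valid_circuit Q c \<and> begins_with c prep \<and>
          (\<forall>\<Psi>phys h. state_on (phys_modes N) \<Psi>phys \<and>
             possible_history c h \<and> length h = depth c \<and>
             run c h (jw_encode N \<nu> \<Psi>phys) \<noteq> (\<lambda>x. 0) \<longrightarrow>
             (\<exists>\<theta>::real. post_state Q c h (jw_encode N \<nu> \<Psi>phys) =
                scale (cis \<theta>) (jw_encode N \<nu>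
                  (aux_phys_product N \<nu> (\<Psi>aux (drop (depth c - depth prep) h))
                     (trotter \<nu> t E col \<chi> \<tau> M \<Psi>phys))))) \<and>
          real (depth c) \<le> C * (real \<chi> * log1 (real \<chi>) + real \<chi> * log1 (real N)
                                + real M * real \<chi> * log1 (real \<chi>)) \<and>
          (real M \<ge> ln (real N) \<longrightarrow>
             real (depth c) \<le> C' * (real M * real \<chi> * log1 (real \<chi>))))))"
proof (rule exI[of _ 118], rule exI[of _ 133], intro allI impI, elim conjE, goal_cases)
  case g: (1 N E \<chi> col t \<nu> Q)
  note \<nu> = g(5) and Q = g(6)
  interpret colored N E \<chi> col by standard (rule g)+
  obtain e where e: "e \<in> E" using g(2) by blast
  have \<chi>1: "1 \<le> \<chi>" using col_range[OF e] by linarith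
  have N1: "1 \<le> N" using lo_hi_K(1)[OF e] by (auto simp: K_def)
  have "real \<chi> / 2 \<le> real \<nu>" unfolding \<nu> by linarith
  then have \<nu>2: "\<chi> \<le> 2 * \<nu>" by linarith
  then have \<nu>1: "1 \<le> \<nu>" using \<chi>1 by linarith
  obtain L where L: "2 * N + 1 < 2 ^ L" "real L \<le> 5 * log1 (real N)" using digits_bound[OF N1] by blast
  show ?case
  \<comment> \<open>The auxiliary state is the vacuum for every outcome, so the preparation is the
    circuit without layers.\<close>
  proof (rule exI[of _ "Circuit 0 (\<lambda>_. [])"], rule exI[of _ "\<lambda>_. vac"], intro conjI allI impI, goal_cases)
    case (2 \<tau> M)
    note M = this
    obtain c where c: "valid_circuit Q c" "depth c = \<chi> * (22 * L + 5) + M * (\<chi> * 15) + 3"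
      "\<And>\<Psi> h. state_on (phys_modes N) \<Psi> \<and> length h = depth c \<and> run c h (jw_encode N \<nu> \<Psi>) \<noteq> (\<lambda>x. 0) \<Longrightarrow>
      \<exists>\<theta>. post_state Q c h (jw_encode N \<nu> \<Psi>) =
        scale (cis \<theta>) (jw_encode N \<nu> (aux_phys_product N \<nu> vac (trotter \<nu> t E col \<chi> \<tau> M \<Psi>)))"
      using evolution_circuit[OF \<nu>2 \<nu>1 Q L(1), of M t \<tau>] by blast
    have x: "1 \<le> real \<chi>" "1 \<le> real M" using \<chi>1 M by auto
    have lx: "1 \<le> log1 (real \<chi>)" "1 \<le> log1 (real N)" by (auto simp: log1_def)
    \<comment> \<open>The depth is at most 115 \<open>a\<close> + 18 \<open>b\<close>: 22 times 5
      from the digits and 5 more per color, each \<chi> being at most \<open>a\<close>, and 15 + 3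
      from the sweeps and the decoding. The constant 118 exceeds both coefficients; 133 is their
      sum, for the case that \<open>a\<close> is at most \<open>b\<close>.\<close>
    define a where "a = real \<chi> * log1 (real N)"
    define b where "b = real M * real \<chi>"
    have b1: "1 \<le> b" unfolding b_def using mult_mono[OF x(2) x(1)] by simp
    have a1: "real \<chi> \<le> a" unfolding a_def using mult_left_mono[OF lx(2), of "real \<chi>"] x by simp
    have bl: "b \<le> b * log1 (real \<chi>)" using mult_left_mono[OF lx(1), of b] b1 by simp
    have "real (depth c) = 22 * (real \<chi> * real L) + 5 * real \<chi> + 15 * b + 3"
      unfolding c(2) b_def by (simp add: algebra_simps)
    moreover have "real \<chi> * real L \<le> 5 * a"
      unfolding a_def using mult_left_mono[OF L(2), of "real \<chi>"] by (simp add: mult_ac)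
    ultimately have d: "real (depth c) \<le> 115 * a + 18 * b" using a1 b1 by linarith
    have p: "0 \<le> real \<chi> * log1 (real \<chi>)" using x lx by simp
    have C: "real (depth c) \<le> 118 * (real \<chi> * log1 (real \<chi>) + real \<chi> * log1 (real N)
                                + real M * real \<chi> * log1 (real \<chi>))"
    proof -
      have "y \<le> 118 * (q + a + r)" if "y \<le> 115 * a + 18 * b" "b \<le> r" "0 \<le> q" for y q r :: real
        using that a1 b1 x(1) by (simp add: distrib_left)
      from this[OF d bl p] show ?thesis unfolding a_def b_def .
    qed
    have C': "real (depth c) \<le> 133 * (real M * real \<chi> * log1 (real \<chi>))" if "ln (real N) \<le> real M"
    proof -
      \<comment> \<open>The maximum with 1 in \<open>log1\<close> is covered by \<open>M\<close>
        being at least 1.\<close>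
      have "log1 (real N) \<le> real M" using that x by (simp add: log1_def)
      then have "a \<le> b" unfolding a_def b_def using mult_left_mono[of "log1 (real N)" "real M" "real \<chi>"] by (simp add: mult_ac)
      then show ?thesis using d bl unfolding b_def[symmetric] by linarith
    qed
    show ?case
    proof (intro exI[of _ c] conjI allI impI)
      show "begins_with c (Circuit 0 (\<lambda>_. []))" by (simp add: begins_with_def)
    qed (use c C C' in auto)
  qed (rule state_on_vac)
qed

end
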